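(* Let $\mathbb{K}$ be a field, let $n\geq m\geq1$ and set $\ell=n-m+1$. Let $\mathcal{M}_\ell^{(m)}$ be the full subcategory of $\operatorname{mod}A_\ell^{(m)}$ with set of objects $\{\varepsilon(\sigma)\mid\sigma\in\Delta(m,n)\}$. The following statements hold. (1) The functor $\varepsilon\colon\Delta(m,n)\to\mathcal{M}_\ell^{(m)}\hookrightarrow\operatorname{mod}A_\ell^{(m)}$ defines an $n$-simplex of $\mathrm{S}_\bullet^{\langle m\rangle}(\operatorname{mod}A_\ell^{(m)})$, that is, an object of $\mathrm{S}_n^{\langle m\rangle}(\operatorname{mod}A_\ell^{(m)})$. (2) The $n$-simplex $\varepsilon$ is universal: for every $\mathbb{K}$-linear abelian category $\mathcal{B}$, the functor $\operatorname{Fun}_{\mathbb{K}}^{\mathrm{ex}}(\mathcal{M}_\ell^{(m)},\mathcal{B})\to\mathrm{S}_n^{\langle m\rangle}(\mathcal{B})$ induced by pullback along $\varepsilon$ is an equivalence of categories, where $\operatorname{Fun}_{\mathbb{K}}^{\mathrm{ex}}(\mathcal{M}_\ell^{(m)},\mathcal{B})$ is the category of exact $\mathbb{K}$-linear functors $\mathcal{M}_\ell^{(m)}\to\mathcal{B}$, i.e. $\mathbb{K}$-linear functors which send sequences $0\to M_{m+1}\to M_m\to\cdots\to M_1\to M_0\to0$ in $\mathcal{M}_\ell^{(m)}$ that are exact in $\operatorname{mod}A_\ell^{(m)}$ to exact sequences in $\mathcal{B}$.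
   Context: $[n]=\{0<1<\dots<n\}$. $\Delta(m,n)$ is the poset of monotone maps $[m]\to[n]$ ordered pointwise (viewed as a category); $\Delta(m,n)^\sharp$ is the subset of strictly monotone (non-degenerate) maps and $\Delta(m,n)^\flat$ its complement (degenerate maps). $d^i\colon[m]\to[m+1]$ is the strictly monotone map whose image omits $i$. $\mathbb{K}\Delta(m,n)$ is the $\mathbb{K}$-linear envelope of the category $\Delta(m,n)$, and $\underline{\mathbb{K}\Delta}(m,n)$ is its quotient in which each morphism space is divided by the subspace of morphisms factoring through an object of $\Delta(m,n)^\flat$. For a $\mathbb{K}$-category $\mathcal{A}$ with finitely many objects, $\operatorname{End}(\mathcal A)=\bigoplus_{x,y}\mathcal A(x,y)$. For $n\ge m\ge1$, $\ell=n-m+1$, $A_\ell^{(m)}$ is Iyama's $m$-dimensional (higher) Auslander algebra of type $\mathbb{A}_\ell$: $A_\ell^{(1)}$ is the path algebra of $1\to2\to\dots\to\ell$ and $A_\ell^{(m+1)}=\operatorname{End}_{A_\ell^{(m)}}(M)^{\mathrm{op}}$, with $M$ the (up to multiplicity of summands unique) $m$-cluster tilting $A_\ell^{(m)}$-module. One has $A_\ell^{(m)}\cong\operatorname{End}(\underline{\mathbb{K}\Delta}(m-1,n-1))$, and the category $\operatorname{mod}A_\ell^{(m)}$ of finitely generated right modules is identified with the category $\operatorname{Fun}_{\mathbb{K}}(\underline{\mathbb{K}\Delta}(m-1,n-1)^{\mathrm{op}},\operatorname{mod}\mathbb{K})$ of contravariant $\mathbb{K}$-linear functors to finite-dimensional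 vector spaces. Let $\gamma=([0]*-)\colon\Delta(m-1,n-1)\hookrightarrow\Delta(m,n)$, $\gamma(\sigma)_0=0$, $\gamma(\sigma)_i=\sigma_{i-1}+1$ for $1\le i\le m$; it induces a fully faithful functor $\underline{\mathbb{K}\Delta}(m-1,n-1)\to\underline{\mathbb{K}\Delta}(m,n)$. The functor $\varepsilon\colon\Delta(m,n)\to\operatorname{mod}A_\ell^{(m)}$ is $\varepsilon(\sigma)=\operatorname{Hom}_{\underline{\mathbb{K}\Delta}(m,n)}(\gamma(-),\sigma)$. For an abelian category $\mathcal{B}$, $\mathrm{S}_n^{\langle m\rangle}(\mathcal{B})\subset\operatorname{Fun}(\Delta(m,n),\mathcal{B})$ is the full subcategory of functors $X$ which map degenerate simplices to zero objects and such that for every non-degenerate $\sigma\colon[m+1]\to[n]$ the sequence $0\to X(\sigma\circ d^{m+1})\to X(\sigma\circ d^m)\to\dots\to X(\sigma\circ d^0)\to0$ is exact. Via functoriality of $\Delta(m,n)$ in $[n]$ this gives a simplicial category $\mathrm{S}_\bullet^{\langle m\rangle}(\mathcal{B})$, the $m$-dimensional Waldhausen $\mathrm{S}_\bullet$-construction of $\mathcal{B}$. *)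

theory Defs
  imports "HOL-Algebra.AbelCoset" "HOL-Algebra.Module"
begin

section \<open>Categories and functors\<close>

text \<open>
  Morphism sets are indexed by source and target and need not be disjoint; accordingly composition
  takes the three objects as arguments: \<open>cmp C x y z g f\<close> is \<open>g \<circ> f\<close> for \<open>f : x \<rightarrow> y\<close>, \<open>g : y \<rightarrow> z\<close>.
\<close>

record ('o, 'a) cat =
  Ob :: "'o set"
  Mor :: "'o \<Rightarrow> 'o \<Rightarrow> 'a set"
  idm :: "'o \<Rightarrow> 'a"
  cmp :: "'o \<Rightarrow> 'o \<Rightarrow> 'o \<Rightarrow> 'a \<Rightarrow> 'a \<Rightarrow> 'a"

locale category =
  fixes C :: "('o, 'a, 'z) cat_scheme"
  assumes idm_closed: "x \<in> Ob C \<Longrightarrow> idm C x \<in> Mor C x x"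
    and cmp_closed: "\<lbrakk>x \<in> Ob C; y \<in> Ob C; z \<in> Ob C; f \<in> Mor C x y; g \<in> Mor C y z\<rbrakk>
      \<Longrightarrow> cmp C x y z g f \<in> Mor C x z"
    and cmp_idm_right: "\<lbrakk>x \<in> Ob C; y \<in> Ob C; f \<in> Mor C x y\<rbrakk> \<Longrightarrow> cmp C x x y f (idm C x) = f"
    and cmp_idm_left: "\<lbrakk>x \<in> Ob C; y \<in> Ob C; f \<in> Mor C x y\<rbrakk> \<Longrightarrow> cmp C x y y (idm C y) f = f"
    and cmp_assoc: "\<lbrakk>w \<in> Ob C; x \<in> Ob C; y \<in> Ob C; z \<in> Ob C;
        f \<in> Mor C w x; g \<in> Mor C x y; h \<in> Mor C y z\<rbrakk>
      \<Longrightarrow> cmp C w y z h (cmp C w x y g f) = cmp C w x z (cmp C x y z h g) f"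

definition full_subcat :: "('o, 'a, 'z) cat_scheme \<Rightarrow> 'o set \<Rightarrow> ('o, 'a, 'z) cat_scheme" where
  "full_subcat C S = C\<lparr>Ob := Ob C \<inter> S\<rparr>"

definition isomorphic :: "('o, 'a, 'z) cat_scheme \<Rightarrow> 'o \<Rightarrow> 'o \<Rightarrow> bool" where
  "isomorphic C x y \<longleftrightarrow> (\<exists>f \<in> Mor C x y. \<exists>g \<in> Mor C y x.
     cmp C x y x g f = idm C x \<and> cmp C y x y f g = idm C y)"

definition monic :: "('o, 'a, 'z) cat_scheme \<Rightarrow> 'o \<Rightarrow> 'o \<Rightarrow> 'a \<Rightarrow> bool" where
  "monic C x y f \<longleftrightarrow> f \<in> Mor C x y \<and>
     (\<forall>w \<in> Ob C. \<forall>g \<in> Mor C w x. \<forall>h \<in> Mor C w x. cmp C w x y f g = cmp C w x y f h \<longrightarrow> g = h)"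

definition epic :: "('o, 'a, 'z) cat_scheme \<Rightarrow> 'o \<Rightarrow> 'o \<Rightarrow> 'a \<Rightarrow> bool" where
  "epic C x y f \<longleftrightarrow> f \<in> Mor C x y \<and>
     (\<forall>w \<in> Ob C. \<forall>g \<in> Mor C y w. \<forall>h \<in> Mor C y w. cmp C x y w g f = cmp C x y w h f \<longrightarrow> g = h)"

definition zero_object :: "('o, 'a, 'z) cat_scheme \<Rightarrow> 'o \<Rightarrow> bool" where
  "zero_object C z \<longleftrightarrow> z \<in> Ob C \<and>
     (\<forall>x \<in> Ob C. (\<exists>!f. f \<in> Mor C z x) \<and> (\<exists>!f. f \<in> Mor C x z))"

record ('o, 'a, 'p, 'b) func =
  fob :: "'o \<Rightarrow> 'p"
  farr :: "'o \<Rightarrow> 'o \<Rightarrow> 'a \<Rightarrow> 'b"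

text \<open>
  Functors are normalised to \<^const>\<open>undefined\<close> off their domain, so that two functors are equal iff
  they agree on objects and morphisms of the source category.
\<close>

definition mk_func :: "('o, 'a, 'z) cat_scheme \<Rightarrow> ('o \<Rightarrow> 'p) \<Rightarrow> ('o \<Rightarrow> 'o \<Rightarrow> 'a \<Rightarrow> 'b)
    \<Rightarrow> ('o, 'a, 'p, 'b) func" where
  "mk_func C F0 F1 =
     \<lparr>fob = restrict F0 (Ob C),
      farr = (\<lambda>x y. restrict (F1 x y) {f \<in> Mor C x y. x \<in> Ob C \<and> y \<in> Ob C})\<rparr>"

definition is_functor :: "('o, 'a, 'z) cat_scheme \<Rightarrow> ('p, 'b, 'y) cat_scheme
    \<Rightarrow> ('o, 'a, 'p, 'b) func \<Rightarrow> bool" where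
  "is_functor C D F \<longleftrightarrow>
     mk_func C (fob F) (farr F) = F \<and>
     (\<forall>x \<in> Ob C. fob F x \<in> Ob D) \<and>
     (\<forall>x \<in> Ob C. \<forall>y \<in> Ob C. \<forall>f \<in> Mor C x y. farr F x y f \<in> Mor D (fob F x) (fob F y)) \<and>
     (\<forall>x \<in> Ob C. farr F x x (idm C x) = idm D (fob F x)) \<and>
     (\<forall>x \<in> Ob C. \<forall>y \<in> Ob C. \<forall>z \<in> Ob C. \<forall>f \<in> Mor C x y. \<forall>g \<in> Mor C y z.
        farr F x z (cmp C x y z g f)
          = cmp D (fob F x) (fob F y) (fob F z) (farr F y z g) (farr F x y f))"

definition id_func :: "('o, 'a, 'z) cat_scheme \<Rightarrow> ('o, 'a, 'o, 'a) func" where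
  "id_func C = mk_func C (\<lambda>x. x) (\<lambda>x y f. f)"

definition comp_func :: "('o, 'a, 'z) cat_scheme \<Rightarrow> ('p, 'b, 'q, 'c) func
    \<Rightarrow> ('o, 'a, 'p, 'b) func \<Rightarrow> ('o, 'a, 'q, 'c) func" where
  "comp_func C G F = mk_func C (\<lambda>x. fob G (fob F x))
     (\<lambda>x y f. farr G (fob F x) (fob F y) (farr F x y f))"

definition nat_trans :: "('o, 'a, 'z) cat_scheme \<Rightarrow> ('p, 'b, 'y) cat_scheme
    \<Rightarrow> ('o, 'a, 'p, 'b) func \<Rightarrow> ('o, 'a, 'p, 'b) func \<Rightarrow> ('o \<Rightarrow> 'b) set" where
  "nat_trans C D F G =
     {\<eta> \<in> (\<Pi>\<^sub>E x \<in> Ob C. Mor D (fob F x) (fob G x)).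
        \<forall>x \<in> Ob C. \<forall>y \<in> Ob C. \<forall>f \<in> Mor C x y.
          cmp D (fob F x) (fob G x) (fob G y) (farr G x y f) (\<eta> x)
            = cmp D (fob F x) (fob F y) (fob G y) (\<eta> y) (farr F x y f)}"

definition fun_cat :: "('o, 'a, 'z) cat_scheme \<Rightarrow> ('p, 'b, 'y) cat_scheme
    \<Rightarrow> (('o, 'a, 'p, 'b) func, 'o \<Rightarrow> 'b) cat" where
  "fun_cat C D =
     \<lparr>Ob = {F. is_functor C D F},
      Mor = nat_trans C D,
      idm = (\<lambda>F. \<lambda>x \<in> Ob C. idm D (fob F x)),
      cmp = (\<lambda>F G H \<beta> \<alpha>. \<lambda>x \<in> Ob C. cmp D (fob F x) (fob G x) (fob H x) (\<beta> x) (\<alpha> x))\<rparr>"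

definition is_equivalence :: "('o, 'a, 'z) cat_scheme \<Rightarrow> ('p, 'b, 'y) cat_scheme
    \<Rightarrow> ('o, 'a, 'p, 'b) func \<Rightarrow> bool" where
  "is_equivalence C D F \<longleftrightarrow> is_functor C D F \<and>
     (\<exists>G. is_functor D C G \<and>
        isomorphic (fun_cat C C) (comp_func C G F) (id_func C) \<and>
        isomorphic (fun_cat D D) (comp_func D F G) (id_func D))"

text \<open>
  Pullback \<open>F \<mapsto> F \<circ> E\<close> along a functor \<open>E\<close> with source \<open>C\<close>; here \<open>X\<close> is a category whose objects are
  functors out of the target of \<open>E\<close> and whose morphisms are natural transformations.
\<close>

definition pullback :: "(('p, 'b, 'q, 'c) func, 'p \<Rightarrow> 'c, 'z) cat_scheme \<Rightarrow> ('o, 'a, 'y) cat_scheme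
    \<Rightarrow> ('o, 'a, 'p, 'b) func
    \<Rightarrow> (('p, 'b, 'q, 'c) func, 'p \<Rightarrow> 'c, ('o, 'a, 'q, 'c) func, 'o \<Rightarrow> 'c) func" where
  "pullback X C E = mk_func X (\<lambda>F. comp_func C F E) (\<lambda>F G \<eta>. \<lambda>x \<in> Ob C. \<eta> (fob E x))"


section \<open>Linear and abelian categories\<close>

text \<open>
  The type of modules extends that of rings; the fields \<^const>\<open>monoid.mult\<close> and \<^const>\<open>monoid.one\<close>
  play no role for modules.
\<close>

definition mk_module :: "'v set \<Rightarrow> 'v \<Rightarrow> ('v \<Rightarrow> 'v \<Rightarrow> 'v) \<Rightarrow> ('k \<Rightarrow> 'v \<Rightarrow> 'v) \<Rightarrow> ('k, 'v) module" where
  "mk_module V z a s =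
     \<lparr>carrier = V, monoid.mult = undefined, one = undefined, zero = z, add = a, smult = s\<rparr>"

definition linear_map :: "('k, 'r) ring_scheme \<Rightarrow> ('k, 'v) module \<Rightarrow> ('k, 'w) module
    \<Rightarrow> ('v \<Rightarrow> 'w) \<Rightarrow> bool" where
  "linear_map K V W f \<longleftrightarrow> f \<in> carrier V \<rightarrow> carrier W \<and>
     (\<forall>u \<in> carrier V. \<forall>v \<in> carrier V. f (u \<oplus>\<^bsub>V\<^esub> v) = f u \<oplus>\<^bsub>W\<^esub> f v) \<and>
     (\<forall>c \<in> carrier K. \<forall>v \<in> carrier V. f (c \<odot>\<^bsub>V\<^esub> v) = c \<odot>\<^bsub>W\<^esub> f v)"

record ('k, 'o, 'a) lcat = "('o, 'a) cat" +
  lin :: "'o \<Rightarrow> 'o \<Rightarrow> ('k, 'a) module"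

locale linear_category = category C
  for K :: "('k, 'r) ring_scheme" and C :: "('k, 'o, 'a) lcat" +
  assumes lin_module: "\<lbrakk>x \<in> Ob C; y \<in> Ob C\<rbrakk> \<Longrightarrow> module K (lin C x y)"
    and lin_carrier: "\<lbrakk>x \<in> Ob C; y \<in> Ob C\<rbrakk> \<Longrightarrow> carrier (lin C x y) = Mor C x y"
    and cmp_linear_left: "\<lbrakk>x \<in> Ob C; y \<in> Ob C; z \<in> Ob C; f \<in> Mor C x y\<rbrakk>
      \<Longrightarrow> linear_map K (lin C y z) (lin C x z) (\<lambda>g. cmp C x y z g f)"
    and cmp_linear_right: "\<lbrakk>x \<in> Ob C; y \<in> Ob C; z \<in> Ob C; g \<in> Mor C y z\<rbrakk>
      \<Longrightarrow> linear_map K (lin C x y) (lin C x z) (\<lambda>f. cmp C x y z g f)"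

definition op_lcat :: "('k, 'o, 'a) lcat \<Rightarrow> ('k, 'o, 'a) lcat" where
  "op_lcat C = \<lparr>Ob = Ob C, Mor = (\<lambda>x y. Mor C y x), idm = idm C,
     cmp = (\<lambda>x y z g f. cmp C z y x f g), lin = (\<lambda>x y. lin C y x)\<rparr>"

abbreviation zero_mor :: "('k, 'o, 'a) lcat \<Rightarrow> 'o \<Rightarrow> 'o \<Rightarrow> 'a" where
  "zero_mor C x y \<equiv> \<zero>\<^bsub>lin C x y\<^esub>"

definition is_kernel :: "('k, 'o, 'a) lcat \<Rightarrow> 'o \<Rightarrow> 'o \<Rightarrow> 'a \<Rightarrow> 'o \<Rightarrow> 'a \<Rightarrow> bool" where
  "is_kernel C x y f k i \<longleftrightarrow> k \<in> Ob C \<and> i \<in> Mor C k x \<and> cmp C k x y f i = zero_mor C k y \<and>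
     (\<forall>w \<in> Ob C. \<forall>g \<in> Mor C w x. cmp C w x y f g = zero_mor C w y
        \<longrightarrow> (\<exists>!h. h \<in> Mor C w k \<and> cmp C w k x i h = g))"

definition is_cokernel :: "('k, 'o, 'a) lcat \<Rightarrow> 'o \<Rightarrow> 'o \<Rightarrow> 'a \<Rightarrow> 'o \<Rightarrow> 'a \<Rightarrow> bool" where
  "is_cokernel C x y f q p \<longleftrightarrow> q \<in> Ob C \<and> p \<in> Mor C y q \<and> cmp C x y q p f = zero_mor C x q \<and>
     (\<forall>w \<in> Ob C. \<forall>g \<in> Mor C y w. cmp C x y w g f = zero_mor C x w
        \<longrightarrow> (\<exists>!h. h \<in> Mor C q w \<and> cmp C y q w h p = g))"

definition is_biproduct :: "('k, 'o, 'a) lcat \<Rightarrow> 'o \<Rightarrow> 'o \<Rightarrow> 'o \<Rightarrow> bool" where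
  "is_biproduct C x y s \<longleftrightarrow> s \<in> Ob C \<and>
     (\<exists>i \<in> Mor C x s. \<exists>j \<in> Mor C y s. \<exists>p \<in> Mor C s x. \<exists>q \<in> Mor C s y.
        cmp C x s x p i = idm C x \<and> cmp C y s y q j = idm C y \<and>
        cmp C y s x p j = zero_mor C y x \<and> cmp C x s y q i = zero_mor C x y \<and>
        cmp C s x s i p \<oplus>\<^bsub>lin C s s\<^esub> cmp C s y s j q = idm C s)"

locale abelian_linear_category = linear_category K B
  for K :: "('k, 'r) ring_scheme" and B :: "('k, 'o, 'a) lcat" +
  assumes has_zero: "\<exists>z. zero_object B z"
    and has_biproducts: "\<lbrakk>x \<in> Ob B; y \<in> Ob B\<rbrakk> \<Longrightarrow> \<exists>s. is_biproduct B x y s"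
    and has_kernels: "\<lbrakk>x \<in> Ob B; y \<in> Ob B; f \<in> Mor B x y\<rbrakk> \<Longrightarrow> \<exists>k i. is_kernel B x y f k i"
    and has_cokernels: "\<lbrakk>x \<in> Ob B; y \<in> Ob B; f \<in> Mor B x y\<rbrakk> \<Longrightarrow> \<exists>q p. is_cokernel B x y f q p"
    and mono_normal: "\<lbrakk>x \<in> Ob B; y \<in> Ob B; monic B x y f\<rbrakk>
      \<Longrightarrow> \<exists>z \<in> Ob B. \<exists>g \<in> Mor B y z. is_kernel B y z g x f"
    and epi_normal: "\<lbrakk>x \<in> Ob B; y \<in> Ob B; epic B x y f\<rbrakk>
      \<Longrightarrow> \<exists>w \<in> Ob B. \<exists>g \<in> Mor B w x. is_cokernel B w x g y f"

text \<open>
  Exactness of \<open>x \<rightarrow> y \<rightarrow> z\<close> at \<open>y\<close>: the image of \<open>f\<close>, i.e. the kernel of the cokernel of \<open>f\<close>,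
  coincides with the kernel of \<open>g\<close>.
\<close>

definition exact_at :: "('k, 'o, 'a) lcat \<Rightarrow> 'o \<Rightarrow> 'o \<Rightarrow> 'o \<Rightarrow> 'a \<Rightarrow> 'a \<Rightarrow> bool" where
  "exact_at C x y z f g \<longleftrightarrow> f \<in> Mor C x y \<and> g \<in> Mor C y z \<and>
     (\<exists>q p k i. is_cokernel C x y f q p \<and> is_kernel C y q p k i \<and> is_kernel C y z g k i)"

text \<open>
  Exactness of \<open>0 \<rightarrow> X\<^sub>N \<rightarrow> X\<^bsub>N-1\<^esub> \<rightarrow> \<dots> \<rightarrow> X\<^sub>0 \<rightarrow> 0\<close> (for \<open>N \<ge> 1\<close>), with \<open>f\<^sub>i : X\<^bsub>i+1\<^esub> \<rightarrow> X\<^sub>i\<close>.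
\<close>

definition exact_sequence :: "('k, 'o, 'a) lcat \<Rightarrow> nat \<Rightarrow> (nat \<Rightarrow> 'o) \<Rightarrow> (nat \<Rightarrow> 'a) \<Rightarrow> bool" where
  "exact_sequence C N X f \<longleftrightarrow>
     (\<forall>i \<le> N. X i \<in> Ob C) \<and> (\<forall>i < N. f i \<in> Mor C (X (Suc i)) (X i)) \<and>
     (\<exists>z. zero_object C z \<and>
        exact_at C z (X N) (X (N - 1)) (zero_mor C z (X N)) (f (N - 1)) \<and>
        (\<forall>i. Suc i < N \<longrightarrow> exact_at C (X (Suc (Suc i))) (X (Suc i)) (X i) (f (Suc i)) (f i)) \<and>
        exact_at C (X 1) (X 0) z (f 0) (zero_mor C (X 0) z))"

definition is_linear_functor :: "('k, 'r) ring_scheme \<Rightarrow> ('k, 'o, 'a) lcat \<Rightarrow> ('k, 'p, 'b) lcat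
    \<Rightarrow> ('o, 'a, 'p, 'b) func \<Rightarrow> bool" where
  "is_linear_functor K C D F \<longleftrightarrow> is_functor C D F \<and>
     (\<forall>x \<in> Ob C. \<forall>y \<in> Ob C. linear_map K (lin C x y) (lin D (fob F x) (fob F y)) (farr F x y))"

definition lin_fun_cat :: "('k, 'r) ring_scheme \<Rightarrow> ('k, 'o, 'a) lcat \<Rightarrow> ('k, 'p, 'b) lcat
    \<Rightarrow> ('k, ('o, 'a, 'p, 'b) func, 'o \<Rightarrow> 'b) lcat" where
  "lin_fun_cat K C D =
     \<lparr>Ob = {F. is_linear_functor K C D F},
      Mor = Mor (fun_cat C D),
      idm = idm (fun_cat C D),
      cmp = cmp (fun_cat C D),
      lin = (\<lambda>F G. mk_module (nat_trans C D F G)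
        (\<lambda>x \<in> Ob C. zero_mor D (fob F x) (fob G x))
        (\<lambda>\<alpha> \<beta>. \<lambda>x \<in> Ob C. \<alpha> x \<oplus>\<^bsub>lin D (fob F x) (fob G x)\<^esub> \<beta> x)
        (\<lambda>c \<alpha>. \<lambda>x \<in> Ob C. c \<odot>\<^bsub>lin D (fob F x) (fob G x)\<^esub> \<alpha> x))\<rparr>"

text \<open>
  Linear functors \<open>M \<rightarrow> B\<close>, for the full subcategory \<open>M\<close> of \<open>A\<close> on the objects in \<open>S\<close>, which preserve
  exactness of the sequences \<open>0 \<rightarrow> M\<^sub>N \<rightarrow> \<dots> \<rightarrow> M\<^sub>0 \<rightarrow> 0\<close> with all terms in \<open>M\<close>. The exactness
  hypothesis refers to the ambient category \<open>A\<close>, not to \<open>M\<close>.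
\<close>

definition exact_lin_fun_cat :: "('k, 'r) ring_scheme \<Rightarrow> nat \<Rightarrow> ('k, 'o, 'a) lcat \<Rightarrow> 'o set
    \<Rightarrow> ('k, 'p, 'b) lcat \<Rightarrow> (('o, 'a, 'p, 'b) func, 'o \<Rightarrow> 'b) cat" where
  "exact_lin_fun_cat K N A S B = full_subcat (fun_cat (full_subcat A S) B)
     {F. is_linear_functor K (full_subcat A S) B F \<and>
         (\<forall>X f. (\<forall>i \<le> N. X i \<in> S) \<and> exact_sequence A N X f \<longrightarrow>
            exact_sequence B N (\<lambda>i. fob F (X i)) (\<lambda>i. farr F (X (Suc i)) (X i) (f i)))}"


section \<open>Finite-dimensional vector spaces\<close>

text \<open>
  The category of finite-dimensional \<open>K\<close>-vector spaces whose elements are taken from the type \<open>'v\<close>.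
  If \<open>'v\<close> is large enough (as it is in its use below, see \<open>mod_A\<close>) this category contains
  a copy of every finite-dimensional vector space.
\<close>

definition finite_dim :: "('k, 'r) ring_scheme \<Rightarrow> ('k, 'v) module \<Rightarrow> bool" where
  "finite_dim K V \<longleftrightarrow> (\<exists>S. finite S \<and> S \<subseteq> carrier V \<and>
     (\<forall>W. submodule W K V \<and> S \<subseteq> W \<longrightarrow> W = carrier V))"

definition linear_maps :: "('k, 'r) ring_scheme \<Rightarrow> ('k, 'v) module \<Rightarrow> ('k, 'w) module \<Rightarrow> ('v \<Rightarrow> 'w) set"
  where "linear_maps K V W = {f \<in> extensional (carrier V). linear_map K V W f}"

definition fd_vec :: "('k, 'r) ring_scheme \<Rightarrow> ('k, ('k, 'v) module, 'v \<Rightarrow> 'v) lcat" where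
  "fd_vec K =
     \<lparr>Ob = {V. module K V \<and> finite_dim K V},
      Mor = linear_maps K,
      idm = (\<lambda>V. \<lambda>v \<in> carrier V. v),
      cmp = (\<lambda>U V W g f. compose (carrier U) g f),
      lin = (\<lambda>V W. mk_module (linear_maps K V W)
        (\<lambda>v \<in> carrier V. \<zero>\<^bsub>W\<^esub>)
        (\<lambda>f g. \<lambda>v \<in> carrier V. f v \<oplus>\<^bsub>W\<^esub> g v)
        (\<lambda>c f. \<lambda>v \<in> carrier V. c \<odot>\<^bsub>W\<^esub> f v))\<rparr>"


section \<open>Linear envelopes and quotients\<close>

text \<open>Morphisms of the linear envelope are formal linear combinations, given by their coefficients.\<close>

definition formal_sums :: "('k, 'r) ring_scheme \<Rightarrow> 'a set \<Rightarrow> ('a \<Rightarrow> 'k) set" where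
  "formal_sums K A = {f. (\<forall>a. f a \<in> carrier K) \<and> (\<forall>a. a \<notin> A \<longrightarrow> f a = \<zero>\<^bsub>K\<^esub>) \<and>
     finite {a. f a \<noteq> \<zero>\<^bsub>K\<^esub>}}"

definition basis_elt :: "('k, 'r) ring_scheme \<Rightarrow> 'a \<Rightarrow> 'a \<Rightarrow> 'k" where
  "basis_elt K u = (\<lambda>a. if a = u then \<one>\<^bsub>K\<^esub> else \<zero>\<^bsub>K\<^esub>)"

definition lin_envelope :: "('k, 'r) ring_scheme \<Rightarrow> ('o, 'a) cat \<Rightarrow> ('k, 'o, 'a \<Rightarrow> 'k) lcat" where
  "lin_envelope K C =
     \<lparr>Ob = Ob C,
      Mor = (\<lambda>x y. formal_sums K (Mor C x y)),
      idm = (\<lambda>x. basis_elt K (idm C x)),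
      cmp = (\<lambda>x y z g f c. \<Oplus>\<^bsub>K\<^esub>p \<in> {(b, a). b \<in> Mor C y z \<and> a \<in> Mor C x y \<and>
          g b \<noteq> \<zero>\<^bsub>K\<^esub> \<and> f a \<noteq> \<zero>\<^bsub>K\<^esub> \<and> cmp C x y z b a = c}. g (fst p) \<otimes>\<^bsub>K\<^esub> f (snd p)),
      lin = (\<lambda>x y. mk_module (formal_sums K (Mor C x y))
        (\<lambda>a. \<zero>\<^bsub>K\<^esub>) (\<lambda>f g a. f a \<oplus>\<^bsub>K\<^esub> g a) (\<lambda>c f a. c \<otimes>\<^bsub>K\<^esub> f a))\<rparr>"

definition lin_envelope_func :: "('k, 'r) ring_scheme \<Rightarrow> ('o, 'a) cat \<Rightarrow> ('o, 'a, 'p, 'b) func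
    \<Rightarrow> ('o, 'a \<Rightarrow> 'k, 'p, 'b \<Rightarrow> 'k) func" where
  "lin_envelope_func K C F = mk_func (lin_envelope K C) (fob F)
     (\<lambda>x y f b. \<Oplus>\<^bsub>K\<^esub>a \<in> {a \<in> Mor C x y. f a \<noteq> \<zero>\<^bsub>K\<^esub> \<and> farr F x y a = b}. f a)"

text \<open>The subspace generated by the morphisms \<open>x \<rightarrow> y\<close> which factor through an object in \<open>D\<close>.\<close>

definition factor_through :: "('k, 'r) ring_scheme \<Rightarrow> ('k, 'o, 'a) lcat \<Rightarrow> 'o set \<Rightarrow> 'o \<Rightarrow> 'o \<Rightarrow> 'a set"
  where "factor_through K C D x y = \<Inter>{N. submodule N K (lin C x y) \<and>
     (\<forall>d \<in> D. \<forall>g \<in> Mor C x d. \<forall>h \<in> Mor C d y. cmp C x d y h g \<in> N)}"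

definition quotient_cat :: "('k, 'o, 'a) lcat \<Rightarrow> ('o \<Rightarrow> 'o \<Rightarrow> 'a set) \<Rightarrow> ('k, 'o, 'a set) lcat" where
  "quotient_cat C I =
     \<lparr>Ob = Ob C,
      Mor = (\<lambda>x y. a_rcosets\<^bsub>lin C x y\<^esub> (I x y)),
      idm = (\<lambda>x. I x x +>\<^bsub>lin C x x\<^esub> idm C x),
      cmp = (\<lambda>x y z G F. \<Union>g \<in> G. \<Union>f \<in> F. I x z +>\<^bsub>lin C x z\<^esub> cmp C x y z g f),
      lin = (\<lambda>x y. mk_module (a_rcosets\<^bsub>lin C x y\<^esub> (I x y))
        (I x y) (set_add (lin C x y)) (\<lambda>c F. \<Union>f \<in> F. I x y +>\<^bsub>lin C x y\<^esub> (c \<odot>\<^bsub>lin C x y\<^esub> f)))\<rparr>"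

text \<open>The functor induced on quotients by \<open>F : C \<rightarrow> D\<close>, where \<open>J\<close> is the ideal of \<open>D\<close>.\<close>

definition quotient_func :: "('k, 'o, 'a) lcat \<Rightarrow> ('o \<Rightarrow> 'o \<Rightarrow> 'a set) \<Rightarrow> ('k, 'p, 'b) lcat
    \<Rightarrow> ('p \<Rightarrow> 'p \<Rightarrow> 'b set) \<Rightarrow> ('o, 'a, 'p, 'b) func \<Rightarrow> ('o, 'a set, 'p, 'b set) func" where
  "quotient_func C I D J F = mk_func (quotient_cat C I) (fob F)
     (\<lambda>x y A. \<Union>f \<in> A. J (fob F x) (fob F y) +>\<^bsub>lin D (fob F x) (fob F y)\<^esub> farr F x y f)"


section \<open>The posets of simplices\<close>

text \<open>Simplices \<open>[m] \<rightarrow> [n]\<close> are monotone functions on \<open>{..m}\<close>, \<^const>\<open>undefined\<close> elsewhere.\<close>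

type_synonym simplex = "nat \<Rightarrow> nat"

definition simplices :: "nat \<Rightarrow> nat \<Rightarrow> simplex set" where
  "simplices m n = {\<sigma> \<in> {..m} \<rightarrow>\<^sub>E {..n}. mono_on {..m} \<sigma>}"

definition nondegenerate :: "nat \<Rightarrow> nat \<Rightarrow> simplex set" where
  "nondegenerate m n = {\<sigma> \<in> simplices m n. strict_mono_on {..m} \<sigma>}"

definition degenerate :: "nat \<Rightarrow> nat \<Rightarrow> simplex set" where
  "degenerate m n = simplices m n - nondegenerate m n"

definition coface :: "nat \<Rightarrow> nat \<Rightarrow> nat" where
  "coface i j = (if j < i then j else Suc j)"

text \<open>\<open>face m \<sigma> i\<close> is \<open>\<sigma> \<circ> d\<^sup>i\<close> for \<open>\<sigma> : [m+1] \<rightarrow> [n]\<close> and \<open>d\<^sup>i : [m] \<rightarrow> [m+1]\<close>.\<close>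

definition face :: "nat \<Rightarrow> simplex \<Rightarrow> nat \<Rightarrow> simplex" where
  "face m \<sigma> i = compose {..m} \<sigma> (coface i)"

text \<open>The unique morphism \<open>\<sigma> \<rightarrow> \<tau>\<close> of the poset, if it exists, is the pair \<open>(\<sigma>, \<tau>)\<close>.\<close>

definition Delta :: "nat \<Rightarrow> nat \<Rightarrow> (simplex, simplex \<times> simplex) cat" where
  "Delta m n =
     \<lparr>Ob = simplices m n,
      Mor = (\<lambda>\<sigma> \<tau>. {u. u = (\<sigma>, \<tau>) \<and> (\<forall>i \<le> m. \<sigma> i \<le> \<tau> i)}),
      idm = (\<lambda>\<sigma>. (\<sigma>, \<sigma>)),
      cmp = (\<lambda>\<rho> \<sigma> \<tau> v u. (\<rho>, \<tau>))\<rparr>"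

definition S_cat :: "nat \<Rightarrow> nat \<Rightarrow> ('k, 'o, 'a) lcat
    \<Rightarrow> ((simplex, simplex \<times> simplex, 'o, 'a) func, simplex \<Rightarrow> 'a) cat" where
  "S_cat m n B = full_subcat (fun_cat (Delta m n) B)
     {X. (\<forall>\<sigma> \<in> degenerate m n. zero_object B (fob X \<sigma>)) \<and>
         (\<forall>\<sigma> \<in> nondegenerate (Suc m) n. exact_sequence B (Suc m)
            (\<lambda>i. fob X (face m \<sigma> i))
            (\<lambda>i. farr X (face m \<sigma> (Suc i)) (face m \<sigma> i) (face m \<sigma> (Suc i), face m \<sigma> i)))}"

definition KDelta :: "('k, 'r) ring_scheme \<Rightarrow> nat \<Rightarrow> nat
    \<Rightarrow> ('k, simplex, simplex \<times> simplex \<Rightarrow> 'k) lcat" where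
  "KDelta K m n = lin_envelope K (Delta m n)"

definition deg_ideal :: "('k, 'r) ring_scheme \<Rightarrow> nat \<Rightarrow> nat \<Rightarrow> simplex \<Rightarrow> simplex
    \<Rightarrow> (simplex \<times> simplex \<Rightarrow> 'k) set" where
  "deg_ideal K m n = factor_through K (KDelta K m n) (degenerate m n)"

definition uKDelta :: "('k, 'r) ring_scheme \<Rightarrow> nat \<Rightarrow> nat
    \<Rightarrow> ('k, simplex, (simplex \<times> simplex \<Rightarrow> 'k) set) lcat" where
  "uKDelta K m n = quotient_cat (KDelta K m n) (deg_ideal K m n)"


section \<open>Higher Auslander algebras of type \<open>\<A>\<close> and the functor \<open>\<epsilon>\<close>\<close>

text \<open>
  Right modules over the algebra \<open>A\<^sub>l\<^sup>(\<^sup>m\<^sup>) \<cong> End(uKDelta K (m - 1) (n - 1))\<close>, \<open>n = l + m - 1\<close>, are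
  identified with contravariant linear functors on \<open>uKDelta K (m - 1) (n - 1)\<close>. Elements of vector
  spaces are taken from the type of morphisms of \<^const>\<open>uKDelta\<close>. That type contains
  \<open>K\<^sup>d\<close> for every \<open>d\<close>, as the singletons of formal sums of \<open>d\<close> fixed elements of the infinite type
  \<^typ>\<open>simplex \<times> simplex\<close>.
\<close>

type_synonym 'k vect = "(simplex \<times> simplex \<Rightarrow> 'k) set"

type_synonym 'k amod =
  "(simplex, (simplex \<times> simplex \<Rightarrow> 'k) set, ('k, 'k vect) module, 'k vect \<Rightarrow> 'k vect) func"

definition mod_A :: "('k, 'r) ring_scheme \<Rightarrow> nat \<Rightarrow> nat
    \<Rightarrow> ('k, 'k amod, simplex \<Rightarrow> 'k vect \<Rightarrow> 'k vect) lcat" where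
  "mod_A K m l = lin_fun_cat K (op_lcat (uKDelta K (m - 1) (l + m - 2))) (fd_vec K)"

definition gamma :: "nat \<Rightarrow> simplex \<Rightarrow> simplex" where
  "gamma m \<sigma> = (\<lambda>i \<in> {..m}. if i = 0 then 0 else \<sigma> (i - 1) + 1)"

definition gamma_func :: "nat \<Rightarrow> nat
    \<Rightarrow> (simplex, simplex \<times> simplex, simplex, simplex \<times> simplex) func" where
  "gamma_func m n = mk_func (Delta (m - 1) (n - 1)) (gamma m)
     (\<lambda>\<sigma> \<tau> u. (gamma m \<sigma>, gamma m \<tau>))"

definition gamma_bar :: "('k, 'r) ring_scheme \<Rightarrow> nat \<Rightarrow> nat
    \<Rightarrow> (simplex, (simplex \<times> simplex \<Rightarrow> 'k) set, simplex, (simplex \<times> simplex \<Rightarrow> 'k) set) func" where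
  "gamma_bar K m n =
     quotient_func (KDelta K (m - 1) (n - 1)) (deg_ideal K (m - 1) (n - 1))
       (KDelta K m n) (deg_ideal K m n)
       (lin_envelope_func K (Delta (m - 1) (n - 1)) (gamma_func m n))"

definition eps_ob :: "('k, 'r) ring_scheme \<Rightarrow> nat \<Rightarrow> nat \<Rightarrow> simplex \<Rightarrow> 'k amod" where
  "eps_ob K m n \<sigma> = mk_func (op_lcat (uKDelta K (m - 1) (n - 1)))
     (\<lambda>x. lin (uKDelta K m n) (gamma m x) \<sigma>)
     (\<lambda>x y f. \<lambda>h \<in> Mor (uKDelta K m n) (gamma m x) \<sigma>.
        cmp (uKDelta K m n) (gamma m y) (gamma m x) \<sigma> h (farr (gamma_bar K m n) y x f))"

definition eps :: "('k, 'r) ring_scheme \<Rightarrow> nat \<Rightarrow> nat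
    \<Rightarrow> (simplex, simplex \<times> simplex, 'k amod, simplex \<Rightarrow> 'k vect \<Rightarrow> 'k vect) func" where
  "eps K m n = mk_func (Delta m n) (eps_ob K m n)
     (\<lambda>\<sigma> \<tau> u. \<lambda>x \<in> simplices (m - 1) (n - 1). \<lambda>h \<in> Mor (uKDelta K m n) (gamma m x) \<sigma>.
        cmp (uKDelta K m n) (gamma m x) \<sigma> \<tau>
          (deg_ideal K m n \<sigma> \<tau> +>\<^bsub>lin (KDelta K m n) \<sigma> \<tau>\<^esub> basis_elt K u) h)"

text \<open>The objects of \<open>\<M>\<^sub>l\<^sup>(\<^sup>m\<^sup>)\<close>, where \<open>n = l + m - 1\<close>.\<close>

definition M_objects :: "('k, 'r) ring_scheme \<Rightarrow> nat \<Rightarrow> nat \<Rightarrow> 'k amod set" where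
  "M_objects K m l = fob (eps K m (l + m - 1)) ` simplices m (l + m - 1)"

end

theory Submission
  imports Defs
begin

text \<open>
  Two simplices \<open>\<sigma>\<close>, \<open>\<tau>\<close> \<^emph>\<open>interlace\<close> if \<open>\<sigma> 0 \<le> \<tau> 0 < \<sigma> 1 \<le> \<tau> 1 < \<dots> < \<sigma> m \<le> \<tau> m\<close>. An interval
  \<open>\<sigma> \<le> \<tau>\<close> of the poset contains a degenerate simplex exactly if its ends do not interlace, so
  the morphism space \<open>\<sigma> \<rightarrow> \<tau>\<close> of the quotient of the linear envelope is one-dimensional for interlacing
  simplices and zero otherwise. Consequently \<open>\<epsilon>(\<sigma>)\<close> is a thin module: it is one-dimensional at the
  points of the \<^emph>\<open>box\<close> of \<open>\<sigma>\<close>, the product of the half-open intervals from \<open>\<sigma> i\<close> to \<open>\<sigma> (i + 1)\<close>, and zero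
  elsewhere. A morphism \<open>\<epsilon>(\<sigma>) \<rightarrow> \<epsilon>(\<tau>)\<close> is given by a scalar on the common part of the two boxes, and
  naturality along the boundary leaves room for a nonzero scalar only if \<open>\<sigma>\<close> and \<open>\<tau>\<close> interlace
  (\<open>eps_hom_multiple\<close>, \<open>eps_edge_nonzero\<close>). In particular degenerate simplices go to zero objects.

  The faces of a nondegenerate simplex \<open>\<zeta>\<close> give an exact sequence because each point in the box of a
  face lies in the box of exactly one of the two neighbouring faces (\<open>face_box_exact\<close>). Exactness can
  be checked pointwise, since image functors provide the required kernels and cokernels
  (\<open>exact_at_pointwise\<close>). This is the first part (\<open>eps_faces_exact\<close>).

  The second part is a formal consequence of these properties, which are collected in the locale
  \<open>interlacing_functor\<close>. Every nonzero morphism of \<open>\<M>\<close> is a multiple of the image of some \<open>\<sigma> \<le> \<tau>\<close>, so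
  naturality over \<open>\<M>\<close> can be checked over the poset, and pullback is fully faithful. Conversely an
  object \<open>X\<close> of the \<open>S\<close>-construction extends to a linear functor by sending \<open>c \<cdot> \<epsilon>(\<sigma> \<le> \<tau>)\<close> to
  \<open>c \<cdot> X(\<sigma> \<le> \<tau>)\<close>; this respects composition because \<open>X\<close>, too, kills every \<open>\<sigma> \<le> \<tau>\<close> that factors
  through a degenerate simplex.

  The extension must preserve \<^emph>\<open>all\<close> exact sequences with \<open>m + 2\<close> terms of the form \<open>\<epsilon>(\<sigma>)\<close>, not just those
  given by faces. The projective and injective modules at a point are themselves of the
  form \<open>\<epsilon>(\<sigma>)\<close>, and testing with them turns exactness into the condition that each point of each
  box lies in exactly one neighbouring box joined to it by a nonzero morphism
  (\<open>exact_sequence_box_exact\<close>). A combinatorial classification (\<open>box_exact_cases\<close>) then shows that,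
  up to nonzero scalars, such a sequence either consists of the faces of a simplex, and is preserved
  since \<open>X\<close> is exact on faces, or is put together from zero objects and identities, and is preserved by
  any linear functor (\<open>extension_exact\<close>).
\<close>

section \<open>Functors, functor categories and equivalences\<close>

lemma fob_mk_func [simp]: "x \<in> Ob C \<Longrightarrow> fob (mk_func C F0 F1) x = F0 x"
  by (simp add: mk_func_def)

lemma farr_mk_func [simp]:
  "\<lbrakk>x \<in> Ob C; y \<in> Ob C; f \<in> Mor C x y\<rbrakk> \<Longrightarrow> farr (mk_func C F0 F1) x y f = F1 x y f"
  by (simp add: mk_func_def)

lemma mk_func_idem [simp]:
  "mk_func C (fob (mk_func C F0 F1)) (farr (mk_func C F0 F1)) = mk_func C F0 F1"
  by (auto simp: mk_func_def restrict_def fun_eq_iff)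

lemma is_functor_mk_func:
  assumes "\<And>x. x \<in> Ob C \<Longrightarrow> F0 x \<in> Ob D"
    and "\<And>x y f. \<lbrakk>x \<in> Ob C; y \<in> Ob C; f \<in> Mor C x y\<rbrakk> \<Longrightarrow> F1 x y f \<in> Mor D (F0 x) (F0 y)"
    and "\<And>x. x \<in> Ob C \<Longrightarrow> F1 x x (idm C x) = idm D (F0 x)"
    and "\<And>x y z f g. \<lbrakk>x \<in> Ob C; y \<in> Ob C; z \<in> Ob C; f \<in> Mor C x y; g \<in> Mor C y z\<rbrakk>
      \<Longrightarrow> F1 x z (cmp C x y z g f) = cmp D (F0 x) (F0 y) (F0 z) (F1 y z g) (F1 x y f)"
    and "category C"
  shows "is_functor C D (mk_func C F0 F1)"
proof -
  interpret C: category C by fact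
  show ?thesis
    using assms(1-4) unfolding is_functor_def
    by (auto simp: C.idm_closed C.cmp_closed)
qed

context
  fixes C :: "('o, 'a, 'z) cat_scheme" and D :: "('p, 'b, 'y) cat_scheme" and F
  assumes F: "is_functor C D F"
begin

lemma functor_ob: "x \<in> Ob C \<Longrightarrow> fob F x \<in> Ob D"
  using F by (simp add: is_functor_def)

lemma functor_arr:
  "\<lbrakk>f \<in> Mor C x y; x \<in> Ob C; y \<in> Ob C\<rbrakk> \<Longrightarrow> farr F x y f \<in> Mor D (fob F x) (fob F y)"
  using F by (simp add: is_functor_def)

lemma functor_id: "x \<in> Ob C \<Longrightarrow> farr F x x (idm C x) = idm D (fob F x)"
  using F by (simp add: is_functor_def)

lemma functor_cmp:
  "\<lbrakk>x \<in> Ob C; y \<in> Ob C; z \<in> Ob C; f \<in> Mor C x y; g \<in> Mor C y z\<rbrakk>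
    \<Longrightarrow> farr F x z (cmp C x y z g f)
      = cmp D (fob F x) (fob F y) (fob F z) (farr F y z g) (farr F x y f)"
  using F by (simp add: is_functor_def)

end

lemma category_full_subcat: "category C \<Longrightarrow> category (full_subcat C S)"
  by (simp add: category_def full_subcat_def)

lemma full_subcat_simps [simp]:
  "Ob (full_subcat C S) = Ob C \<inter> S" "Mor (full_subcat C S) = Mor C"
  "idm (full_subcat C S) = idm C" "cmp (full_subcat C S) = cmp C"
  by (simp_all add: full_subcat_def)

lemma lin_full_subcat [simp]: "lin (full_subcat C S) = lin C"
  by (simp add: full_subcat_def)

lemma is_functor_comp_func:
  assumes "category C" "is_functor C D F" "is_functor D E G"
  shows "is_functor C E (comp_func C G F)"
  unfolding comp_func_def
  using assms(2,3)
  by (intro is_functor_mk_func)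
    (auto simp: functor_ob functor_arr functor_id functor_cmp assms(1))

lemma is_functor_id_func: "category C \<Longrightarrow> is_functor C C (id_func C)"
  unfolding id_func_def by (rule is_functor_mk_func) auto

lemma is_functor_into_full_subcat:
  assumes "is_functor C D F" "\<And>x. x \<in> Ob C \<Longrightarrow> fob F x \<in> S"
  shows "is_functor C (full_subcat D S) F"
  using assms by (simp add: is_functor_def)

lemma nat_trans_arr: "\<lbrakk>\<eta> \<in> nat_trans C D F G; x \<in> Ob C\<rbrakk> \<Longrightarrow> \<eta> x \<in> Mor D (fob F x) (fob G x)"
  by (auto simp: nat_trans_def)

lemma nat_trans_natural:
  "\<lbrakk>\<eta> \<in> nat_trans C D F G; x \<in> Ob C; y \<in> Ob C; f \<in> Mor C x y\<rbrakk>
    \<Longrightarrow> cmp D (fob F x) (fob G x) (fob G y) (farr G x y f) (\<eta> x)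
      = cmp D (fob F x) (fob F y) (fob G y) (\<eta> y) (farr F x y f)"
  by (auto simp: nat_trans_def)

lemma nat_trans_extensional: "\<eta> \<in> nat_trans C D F G \<Longrightarrow> \<eta> \<in> extensional (Ob C)"
  by (auto simp: nat_trans_def PiE_def)

lemma nat_trans_eqI:
  assumes "\<eta> \<in> nat_trans C D F G" "\<theta> \<in> nat_trans C D F' G'" "\<And>x. x \<in> Ob C \<Longrightarrow> \<eta> x = \<theta> x"
  shows "\<eta> = \<theta>"
  by (rule extensionalityI[OF nat_trans_extensional[OF assms(1)] nat_trans_extensional[OF assms(2)]])
     (rule assms(3))

lemma nat_transI:
  assumes "\<And>x. x \<in> Ob C \<Longrightarrow> \<eta> x \<in> Mor D (fob F x) (fob G x)"
    and "\<And>x y f. \<lbrakk>x \<in> Ob C; y \<in> Ob C; f \<in> Mor C x y\<rbrakk>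
      \<Longrightarrow> cmp D (fob F x) (fob G x) (fob G y) (farr G x y f) (\<eta> x)
        = cmp D (fob F x) (fob F y) (fob G y) (\<eta> y) (farr F x y f)"
  shows "restrict \<eta> (Ob C) \<in> nat_trans C D F G"
  using assms by (auto simp: nat_trans_def)

lemma fun_cat_simps [simp]:
  "Ob (fun_cat C D) = {F. is_functor C D F}" "Mor (fun_cat C D) = nat_trans C D"
  "idm (fun_cat C D) F = (\<lambda>x \<in> Ob C. idm D (fob F x))"
  "cmp (fun_cat C D) F G H \<beta> \<alpha> =
    (\<lambda>x \<in> Ob C. cmp D (fob F x) (fob G x) (fob H x) (\<beta> x) (\<alpha> x))"
  by (simp_all add: fun_cat_def)

lemma (in category) cmp_nat_trans:
  assumes "is_functor X C F" "is_functor X C G" "is_functor X C H"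
    and a: "\<alpha> \<in> nat_trans X C F G" and b: "\<beta> \<in> nat_trans X C G H"
  shows "(\<lambda>x \<in> Ob X. cmp C (fob F x) (fob G x) (fob H x) (\<beta> x) (\<alpha> x)) \<in> nat_trans X C F H"
proof (rule nat_transI)
  note ob = functor_ob[OF assms(1)] functor_ob[OF assms(2)] functor_ob[OF assms(3)]
  note arr = functor_arr[OF assms(1)] functor_arr[OF assms(2)] functor_arr[OF assms(3)]
    nat_trans_arr[OF a] nat_trans_arr[OF b]
  fix x y f assume xy: "x \<in> Ob X" "y \<in> Ob X" "f \<in> Mor X x y"
  let ?Fx = "fob F x" and ?Fy = "fob F y" and ?Gx = "fob G x" and ?Gy = "fob G y"
    and ?Hx = "fob H x" and ?Hy = "fob H y"
  have "cmp C ?Fx ?Hx ?Hy (farr H x y f) (cmp C ?Fx ?Gx ?Hx (\<beta> x) (\<alpha> x))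
      = cmp C ?Fx ?Gx ?Hy (cmp C ?Gx ?Hx ?Hy (farr H x y f) (\<beta> x)) (\<alpha> x)"
    by (rule cmp_assoc) (use xy in \<open>auto intro: ob arr\<close>)
  also have "\<dots> = cmp C ?Fx ?Gx ?Hy (cmp C ?Gx ?Gy ?Hy (\<beta> y) (farr G x y f)) (\<alpha> x)"
    by (simp add: nat_trans_natural[OF b] xy)
  also have "\<dots> = cmp C ?Fx ?Gy ?Hy (\<beta> y) (cmp C ?Fx ?Gx ?Gy (farr G x y f) (\<alpha> x))"
    by (rule cmp_assoc[symmetric]) (use xy in \<open>auto intro: ob arr\<close>)
  also have "\<dots> = cmp C ?Fx ?Gy ?Hy (\<beta> y) (cmp C ?Fx ?Fy ?Gy (\<alpha> y) (farr F x y f))"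
    by (simp add: nat_trans_natural[OF a] xy)
  also have "\<dots> = cmp C ?Fx ?Fy ?Hy (cmp C ?Fy ?Gy ?Hy (\<beta> y) (\<alpha> y)) (farr F x y f)"
    by (rule cmp_assoc) (use xy in \<open>auto intro: ob arr\<close>)
  finally show "cmp C ?Fx ?Hx ?Hy (farr H x y f) (cmp C ?Fx ?Gx ?Hx (\<beta> x) (\<alpha> x))
      = cmp C ?Fx ?Fy ?Hy (cmp C ?Fy ?Gy ?Hy (\<beta> y) (\<alpha> y)) (farr F x y f)" .
qed (use assms in \<open>auto intro!: cmp_closed intro: functor_ob nat_trans_arr\<close>)

lemma category_fun_cat:
  assumes "category D"
  shows "category (fun_cat C D)"
proof -
  interpret D: category D by fact
  show ?thesis
  proof (unfold_locales, goal_cases)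
    case (1 F)
    then have F: "is_functor C D F" by simp
    show ?case
      by (auto intro!: nat_transI D.idm_closed functor_ob[OF F]
          simp: D.cmp_idm_left D.cmp_idm_right functor_ob[OF F] functor_arr[OF F])
  next
    case (2 F G H \<alpha> \<beta>)
    then show ?case by (simp add: D.cmp_nat_trans)
  next
    case (3 F G \<alpha>)
    then have "\<alpha> x = cmp D (fob F x) (fob F x) (fob G x) (\<alpha> x) (idm D (fob F x))" if "x \<in> Ob C" for x
      using that by (auto simp: D.cmp_idm_right functor_ob nat_trans_arr)
    with 3 show ?case
      by (auto intro!: extensionalityI[of _ "Ob C"] simp: nat_trans_extensional)
  next
    case (4 F G \<alpha>)
    then have "\<alpha> x = cmp D (fob F x) (fob G x) (fob G x) (idm D (fob G x)) (\<alpha> x)" if "x \<in> Ob C" for x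
      using that by (auto simp: D.cmp_idm_left functor_ob nat_trans_arr)
    with 4 show ?case
      by (auto intro!: extensionalityI[of _ "Ob C"] simp: nat_trans_extensional)
  next
    case (5 F G H I \<alpha> \<beta> \<gamma>)
    then show ?case
      by (auto intro!: restrict_ext D.cmp_assoc simp: functor_ob nat_trans_arr)
  qed
qed

lemma isomorphicI:
  assumes "f \<in> Mor C x y" "g \<in> Mor C y x"
    and "cmp C x y x g f = idm C x" "cmp C y x y f g = idm C y"
  shows "isomorphic C x y"
  using assms unfolding isomorphic_def by blast

lemma isomorphic_full_subcat [simp]: "isomorphic (full_subcat C S) = isomorphic C"
  by (simp add: isomorphic_def fun_eq_iff)

text \<open>Inverting a natural transformation componentwise preserves naturality, so only one direction
  needs to be checked.\<close>

lemma isomorphic_fun_catI: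
  assumes "category D" and F: "is_functor C D F" and G: "is_functor C D G"
    and arr: "\<And>x. x \<in> Ob C \<Longrightarrow> \<alpha> x \<in> Mor D (fob F x) (fob G x)"
    and inv: "\<And>x. x \<in> Ob C \<Longrightarrow> \<beta> x \<in> Mor D (fob G x) (fob F x)"
    and ba: "\<And>x. x \<in> Ob C \<Longrightarrow> cmp D (fob F x) (fob G x) (fob F x) (\<beta> x) (\<alpha> x) = idm D (fob F x)"
    and ab: "\<And>x. x \<in> Ob C \<Longrightarrow> cmp D (fob G x) (fob F x) (fob G x) (\<alpha> x) (\<beta> x) = idm D (fob G x)"
    and nat: "\<And>x y f. \<lbrakk>x \<in> Ob C; y \<in> Ob C; f \<in> Mor C x y\<rbrakk>
      \<Longrightarrow> cmp D (fob F x) (fob G x) (fob G y) (farr G x y f) (\<alpha> x)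
        = cmp D (fob F x) (fob F y) (fob G y) (\<alpha> y) (farr F x y f)"
  shows "isomorphic (fun_cat C D) F G"
proof (rule isomorphicI)
  interpret D: category D by fact
  note ob = functor_ob[OF F] functor_ob[OF G]
  note ar = functor_arr[OF F] functor_arr[OF G] arr inv
  show "restrict \<alpha> (Ob C) \<in> Mor (fun_cat C D) F G"
    by (simp add: nat_transI arr nat)
  have "cmp D (fob G x) (fob F x) (fob F y) (farr F x y f) (\<beta> x)
        = cmp D (fob G x) (fob G y) (fob F y) (\<beta> y) (farr G x y f)"
    if xy: "x \<in> Ob C" "y \<in> Ob C" "f \<in> Mor C x y" for x y f
  proof -
    let ?Fx = "fob F x" and ?Fy = "fob F y" and ?Gx = "fob G x" and ?Gy = "fob G y"
    let ?Ff = "farr F x y f" and ?Gf = "farr G x y f"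
    have "cmp D ?Gx ?Fx ?Fy ?Ff (\<beta> x)
        = cmp D ?Gx ?Fy ?Fy (cmp D ?Fy ?Gy ?Fy (\<beta> y) (\<alpha> y)) (cmp D ?Gx ?Fx ?Fy ?Ff (\<beta> x))"
      using xy by (simp add: ba D.cmp_idm_left D.cmp_closed ob ar)
    also have "\<dots> = cmp D ?Gx ?Gy ?Fy (\<beta> y) (cmp D ?Gx ?Fy ?Gy (\<alpha> y) (cmp D ?Gx ?Fx ?Fy ?Ff (\<beta> x)))"
      by (rule D.cmp_assoc[symmetric]) (use xy in \<open>auto intro!: ob ar D.cmp_closed\<close>)
    also have "cmp D ?Gx ?Fy ?Gy (\<alpha> y) (cmp D ?Gx ?Fx ?Fy ?Ff (\<beta> x))
        = cmp D ?Gx ?Fx ?Gy (cmp D ?Fx ?Fy ?Gy (\<alpha> y) ?Ff) (\<beta> x)"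
      by (rule D.cmp_assoc) (use xy in \<open>auto intro!: ob ar D.cmp_closed\<close>)
    also have "\<dots> = cmp D ?Gx ?Fx ?Gy (cmp D ?Fx ?Gx ?Gy ?Gf (\<alpha> x)) (\<beta> x)"
      by (simp add: nat xy)
    also have "\<dots> = cmp D ?Gx ?Gx ?Gy ?Gf (cmp D ?Gx ?Fx ?Gx (\<alpha> x) (\<beta> x))"
      by (rule D.cmp_assoc[symmetric]) (use xy in \<open>auto intro!: ob ar D.cmp_closed\<close>)
    also have "\<dots> = ?Gf"
      using xy by (simp add: ab D.cmp_idm_right ob ar)
    finally show ?thesis .
  qed
  then show "restrict \<beta> (Ob C) \<in> Mor (fun_cat C D) G F"
    by (simp add: nat_transI inv)
qed (auto intro!: restrict_ext simp: ba ab)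

text \<open>The inverse functor picks, for every object \<open>d\<close>, a preimage \<open>G0 d\<close> up to an isomorphism
  \<open>\<phi> d : F (G0 d) \<rightarrow> d\<close>; conjugating with \<open>\<phi>\<close> and lifting along the bijections on morphisms makes
  it functorial, and turns \<open>\<phi>\<close> into a natural isomorphism.\<close>

lemma is_equivalenceI:
  assumes "category C" "category D" and F: "is_functor C D F"
    and full: "\<And>x y g. \<lbrakk>x \<in> Ob C; y \<in> Ob C; g \<in> Mor D (fob F x) (fob F y)\<rbrakk>
      \<Longrightarrow> \<exists>f \<in> Mor C x y. farr F x y f = g"
    and faithful: "\<And>x y f f'. \<lbrakk>x \<in> Ob C; y \<in> Ob C; f \<in> Mor C x y; f' \<in> Mor C x y;
      farr F x y f = farr F x y f'\<rbrakk> \<Longrightarrow> f = f'"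
    and ess_surj: "\<And>d. d \<in> Ob D \<Longrightarrow> \<exists>x \<in> Ob C. isomorphic D (fob F x) d"
  shows "is_equivalence C D F"
proof -
  interpret C: category C by fact
  interpret D: category D by fact
  note Fob = functor_ob[OF F] and Farr = functor_arr[OF F]
  define L where "L x y g = (SOME f. f \<in> Mor C x y \<and> farr F x y f = g)" for x y g
  have L: "L x y g \<in> Mor C x y" "farr F x y (L x y g) = g"
    if "x \<in> Ob C" "y \<in> Ob C" "g \<in> Mor D (fob F x) (fob F y)" for x y g
  proof -
    have "L x y g \<in> Mor C x y \<and> farr F x y (L x y g) = g"
      unfolding L_def by (rule someI_ex) (use full[OF that] in blast)
    then show "L x y g \<in> Mor C x y" "farr F x y (L x y g) = g" by auto
  qed
  have "\<forall>d \<in> Ob D. \<exists>x f g. x \<in> Ob C \<and> f \<in> Mor D (fob F x) d \<and> g \<in> Mor D d (fob F x) \<and>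
      cmp D (fob F x) d (fob F x) g f = idm D (fob F x) \<and> cmp D d (fob F x) d f g = idm D d"
    using ess_surj unfolding isomorphic_def by meson
  then obtain G0 \<phi> \<psi> where *: "\<forall>d \<in> Ob D. G0 d \<in> Ob C \<and> \<phi> d \<in> Mor D (fob F (G0 d)) d
      \<and> \<psi> d \<in> Mor D d (fob F (G0 d)) \<and>
      cmp D (fob F (G0 d)) d (fob F (G0 d)) (\<psi> d) (\<phi> d) = idm D (fob F (G0 d)) \<and>
      cmp D d (fob F (G0 d)) d (\<phi> d) (\<psi> d) = idm D d"
    by metis
  then have G0: "G0 d \<in> Ob C" and \<phi>: "\<phi> d \<in> Mor D (fob F (G0 d)) d"
    and \<psi>: "\<psi> d \<in> Mor D d (fob F (G0 d))"
    and \<psi>\<phi>: "cmp D (fob F (G0 d)) d (fob F (G0 d)) (\<psi> d) (\<phi> d) = idm D (fob F (G0 d))"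
    and \<phi>\<psi>: "cmp D d (fob F (G0 d)) d (\<phi> d) (\<psi> d) = idm D d"
    if "d \<in> Ob D" for d
    using that by auto
  note mem = G0 \<phi> \<psi> Fob Farr D.cmp_closed D.idm_closed
  define c where "c d e g = cmp D (fob F (G0 d)) e (fob F (G0 e)) (\<psi> e)
      (cmp D (fob F (G0 d)) d e g (\<phi> d))" for d e g
  have c_closed: "c d e g \<in> Mor D (fob F (G0 d)) (fob F (G0 e))"
    if "d \<in> Ob D" "e \<in> Ob D" "g \<in> Mor D d e" for d e g
    unfolding c_def by (rule D.cmp_closed) (use that in \<open>auto intro!: mem\<close>)
  have \<phi>c: "cmp D (fob F (G0 d)) (fob F (G0 e)) e (\<phi> e) (c d e g) = cmp D (fob F (G0 d)) d e g (\<phi> d)"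
    if "d \<in> Ob D" "e \<in> Ob D" "g \<in> Mor D d e" for d e g
  proof -
    have "cmp D (fob F (G0 d)) (fob F (G0 e)) e (\<phi> e) (c d e g)
      = cmp D (fob F (G0 d)) e e (cmp D e (fob F (G0 e)) e (\<phi> e) (\<psi> e)) (cmp D (fob F (G0 d)) d e
          g (\<phi> d))"
      unfolding c_def by (rule D.cmp_assoc) (use that in \<open>auto intro!: mem\<close>)
    also have "\<dots> = cmp D (fob F (G0 d)) d e g (\<phi> d)"
      unfolding \<phi>\<psi>[OF that(2)] by (rule D.cmp_idm_left) (use that in \<open>auto intro!: mem\<close>)
    finally show ?thesis .
  qed
  have \<phi>_cancel: "a = b" if "d \<in> Ob D" "x \<in> Ob D" "a \<in> Mor D x (fob F (G0 d))"
    "b \<in> Mor D x (fob F (G0 d))"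
    "cmp D x (fob F (G0 d)) d (\<phi> d) a = cmp D x (fob F (G0 d)) d (\<phi> d) b" for a b d x
  proof -
    have "cmp D x d (fob F (G0 d)) (\<psi> d) (cmp D x (fob F (G0 d)) d (\<phi> d) r) = r"
      if r: "r \<in> Mor D x (fob F (G0 d))" for r
    proof -
      have "cmp D x d (fob F (G0 d)) (\<psi> d) (cmp D x (fob F (G0 d)) d (\<phi> d) r)
        = cmp D x (fob F (G0 d)) (fob F (G0 d)) (cmp D (fob F (G0 d)) d (fob F (G0 d)) (\<psi> d) (\<phi> d)) r"
        by (rule D.cmp_assoc) (use r \<open>d \<in> Ob D\<close> \<open>x \<in> Ob D\<close> in \<open>auto intro!: mem\<close>)
      also have "\<dots> = r"
        unfolding \<psi>\<phi>[OF \<open>d \<in> Ob D\<close>]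
        by (rule D.cmp_idm_left) (use r \<open>d \<in> Ob D\<close> \<open>x \<in> Ob D\<close> in \<open>auto intro!: mem\<close>)
      finally show ?thesis .
    qed
    with that show ?thesis by metis
  qed
  have c_id: "c d d (idm D d) = idm D (fob F (G0 d))" if "d \<in> Ob D" for d
    unfolding c_def using that by (simp add: D.cmp_idm_left mem \<psi>\<phi>)
  have c_cmp: "c d e' (cmp D d e e' h g)
      = cmp D (fob F (G0 d)) (fob F (G0 e)) (fob F (G0 e')) (c e e' h) (c d e g)"
    if ob: "d \<in> Ob D" "e \<in> Ob D" "e' \<in> Ob D" and g: "g \<in> Mor D d e" and h: "h \<in> Mor D e e'"
    for d e e' g h
  proof (rule \<phi>_cancel[of e' "fob F (G0 d)"])
    let ?d = "fob F (G0 d)" and ?e = "fob F (G0 e)" and ?e' = "fob F (G0 e')"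
    have "cmp D ?d ?e' e' (\<phi> e') (cmp D ?d ?e ?e' (c e e' h) (c d e g))
      = cmp D ?d ?e e' (cmp D ?e ?e' e' (\<phi> e') (c e e' h)) (c d e g)"
      by (rule D.cmp_assoc) (use ob g h in \<open>auto intro!: mem c_closed\<close>)
    also have "\<dots> = cmp D ?d ?e e' (cmp D ?e e e' h (\<phi> e)) (c d e g)"
      using ob g h by (simp add: \<phi>c)
    also have "\<dots> = cmp D ?d e e' h (cmp D ?d ?e e (\<phi> e) (c d e g))"
      by (rule D.cmp_assoc[symmetric]) (use ob g h in \<open>auto intro!: mem c_closed\<close>)
    also have "\<dots> = cmp D ?d e e' h (cmp D ?d d e g (\<phi> d))"
      using ob g h by (simp add: \<phi>c)
    also have "\<dots> = cmp D ?d d e' (cmp D d e e' h g) (\<phi> d)"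
      by (rule D.cmp_assoc) (use ob g h in \<open>auto intro!: mem c_closed\<close>)
    also have "\<dots> = cmp D ?d ?e' e' (\<phi> e') (c d e' (cmp D d e e' h g))"
      using ob g h by (simp add: \<phi>c D.cmp_closed)
    finally show "cmp D ?d ?e' e' (\<phi> e') (c d e' (cmp D d e e' h g))
      = cmp D ?d ?e' e' (\<phi> e') (cmp D ?d ?e ?e' (c e e' h) (c d e g))" by simp
  qed (use ob g h in \<open>auto intro!: mem c_closed\<close>)
  define G where "G = mk_func D G0 (\<lambda>d e g. L (G0 d) (G0 e) (c d e g))"
  have G: "is_functor D C G"
    unfolding G_def
  proof (rule is_functor_mk_func)
    fix d assume d: "d \<in> Ob D"
    show "L (G0 d) (G0 d) (c d d (idm D d)) = idm C (G0 d)"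
      by (rule faithful[of "G0 d" "G0 d"])
        (use d in \<open>auto intro!: mem L(1) c_closed C.idm_closed simp: L c_id functor_id[OF F] mem\<close>)
  next
    fix d e e' g h
    assume a: "d \<in> Ob D" "e \<in> Ob D" "e' \<in> Ob D" "g \<in> Mor D d e" "h \<in> Mor D e e'"
    show "L (G0 d) (G0 e') (c d e' (cmp D d e e' h g))
      = cmp C (G0 d) (G0 e) (G0 e') (L (G0 e) (G0 e') (c e e' h)) (L (G0 d) (G0 e) (c d e g))"
      by (rule faithful[of "G0 d" "G0 e'"])
        (use a in \<open>auto intro!: mem L(1) c_closed C.cmp_closed
          simp: L c_cmp functor_cmp[OF F] mem c_closed\<close>)
  qed (auto intro!: mem L(1) c_closed assms)
  have Gob: "fob G d = G0 d" if "d \<in> Ob D" for d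
    using that by (simp add: G_def)
  have Garr: "farr G d e g = L (G0 d) (G0 e) (c d e g)"
    if "d \<in> Ob D" "e \<in> Ob D" "g \<in> Mor D d e" for d e g
    using that by (simp add: G_def)
  have 1: "isomorphic (fun_cat D D) (comp_func D F G) (id_func D)"
  proof (rule isomorphic_fun_catI[where \<alpha> = \<phi> and \<beta> = \<psi>])
    show "is_functor D D (comp_func D F G)" "is_functor D D (id_func D)"
      by (auto intro: is_functor_comp_func is_functor_id_func assms G)
  qed (use \<open>category D\<close> in \<open>auto simp: comp_func_def id_func_def Gob Garr mem \<psi>\<phi> \<phi>\<psi> L c_closed \<phi>c\<close>)
  have 2: "isomorphic (fun_cat C C) (comp_func C G F) (id_func C)"
  proof (rule isomorphic_fun_catI[where \<alpha> = "\<lambda>x. L (G0 (fob F x)) x (\<phi> (fob F x))"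
        and \<beta> = "\<lambda>x. L x (G0 (fob F x)) (\<psi> (fob F x))"])
    show "is_functor C C (comp_func C G F)" "is_functor C C (id_func C)"
      by (auto intro: is_functor_comp_func is_functor_id_func assms G)
    fix x assume x: "x \<in> Ob C"
    let ?x = "G0 (fob F x)"
    have x': "?x \<in> Ob C" by (auto intro: mem x)
    show "cmp C (fob (comp_func C G F) x) (fob (id_func C) x) (fob (comp_func C G F) x)
      (L x ?x (\<psi> (fob F x))) (L ?x x (\<phi> (fob F x))) = idm C (fob (comp_func C G F) x)"
      by (rule faithful[of ?x ?x])
        (use x x' in \<open>auto intro!: C.cmp_closed C.idm_closed
          simp: L comp_func_def id_func_def Gob mem functor_cmp[OF F] functor_id[OF F] \<psi>\<phi>\<close>)
    show "cmp C (fob (id_func C) x) (fob (comp_func C G F) x) (fob (id_func C) x)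
      (L ?x x (\<phi> (fob F x))) (L x ?x (\<psi> (fob F x))) = idm C (fob (id_func C) x)"
      by (rule faithful[of x x])
        (use x x' in \<open>auto intro!: C.cmp_closed C.idm_closed
          simp: L comp_func_def id_func_def Gob mem functor_cmp[OF F] functor_id[OF F] \<phi>\<psi>\<close>)
  next
    fix x y f assume xy: "x \<in> Ob C" "y \<in> Ob C" "f \<in> Mor C x y"
    let ?x = "G0 (fob F x)" and ?y = "G0 (fob F y)"
    have x': "?x \<in> Ob C" "?y \<in> Ob C" by (auto intro: mem xy)
    have "cmp C ?x x y f (L ?x x (\<phi> (fob F x)))
      = cmp C ?x ?y y (L ?y y (\<phi> (fob F y))) (L ?x ?y (c (fob F x) (fob F y) (farr F x y f)))"
      by (rule faithful[of ?x y])
        (use xy x' in \<open>auto intro!: C.cmp_closed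
          simp: L mem functor_cmp[OF F] c_closed \<phi>c\<close>)
    with xy show "cmp C (fob (comp_func C G F) x) (fob (id_func C) x) (fob (id_func C) y)
        (farr (id_func C) x y f) (L ?x x (\<phi> (fob F x)))
      = cmp C (fob (comp_func C G F) x) (fob (comp_func C G F) y) (fob (id_func C) y)
        (L ?y y (\<phi> (fob F y))) (farr (comp_func C G F) x y f)"
      by (simp add: comp_func_def id_func_def Gob Garr mem)
  qed (use \<open>category C\<close> in \<open>auto simp: comp_func_def id_func_def Gob mem L\<close>)
  show ?thesis
    unfolding is_equivalence_def using F G 1 2 by blast
qed


section \<open>Linear categories\<close>

lemma linear_map_zero:
  assumes "module K V" "module K W" "linear_map K V W f"
  shows "f \<zero>\<^bsub>V\<^esub> = \<zero>\<^bsub>W\<^esub>"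
proof -
  interpret V: module K V by fact
  interpret W: module K W by fact
  have f: "f \<zero>\<^bsub>V\<^esub> \<in> carrier W" and "f (\<zero>\<^bsub>V\<^esub> \<oplus>\<^bsub>V\<^esub> \<zero>\<^bsub>V\<^esub>) = f \<zero>\<^bsub>V\<^esub> \<oplus>\<^bsub>W\<^esub> f \<zero>\<^bsub>V\<^esub>"
    using assms(3) V.zero_closed unfolding linear_map_def by blast+
  then show ?thesis by simp
qed

lemma smult_eq_zero_iff:
  assumes "field K" "module K V" "c \<in> carrier K" "v \<in> carrier V"
  shows "c \<odot>\<^bsub>V\<^esub> v = \<zero>\<^bsub>V\<^esub> \<longleftrightarrow> c = \<zero>\<^bsub>K\<^esub> \<or> v = \<zero>\<^bsub>V\<^esub>"
proof -
  interpret K: field K by fact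
  interpret V: module K V by fact
  have "v = \<zero>\<^bsub>V\<^esub>" if "c \<odot>\<^bsub>V\<^esub> v = \<zero>\<^bsub>V\<^esub>" "c \<noteq> \<zero>\<^bsub>K\<^esub>"
  proof -
    have c: "c \<in> Units K" using that assms by (simp add: K.field_Units)
    have "v = (inv\<^bsub>K\<^esub> c \<otimes>\<^bsub>K\<^esub> c) \<odot>\<^bsub>V\<^esub> v"
      using c assms by simp
    also have "\<dots> = inv\<^bsub>K\<^esub> c \<odot>\<^bsub>V\<^esub> (c \<odot>\<^bsub>V\<^esub> v)"
      using c assms by (intro V.smult_assoc1) auto
    also have "\<dots> = \<zero>\<^bsub>V\<^esub>" using c that by (simp add: V.smult_r_null)
    finally show ?thesis .
  qed
  then show ?thesis using assms by (auto simp: V.smult_l_null V.smult_r_null)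
qed

context linear_category
begin

lemma zero_mor_closed: "\<lbrakk>x \<in> Ob C; y \<in> Ob C\<rbrakk> \<Longrightarrow> zero_mor C x y \<in> Mor C x y"
  using module.axioms(2)[OF lin_module, THEN abelian_group.axioms(1), THEN abelian_monoid.zero_closed]
  by (simp add: lin_carrier)

lemma smult_mor_closed:
  "\<lbrakk>x \<in> Ob C; y \<in> Ob C; c \<in> carrier K; f \<in> Mor C x y\<rbrakk> \<Longrightarrow> c \<odot>\<^bsub>lin C x y\<^esub> f \<in> Mor C x y"
  using module.smult_closed[OF lin_module] by (simp add: lin_carrier)

lemma cmp_zero_left:
  "\<lbrakk>x \<in> Ob C; y \<in> Ob C; z \<in> Ob C; f \<in> Mor C x y\<rbrakk>
    \<Longrightarrow> cmp C x y z (zero_mor C y z) f = zero_mor C x z"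
  using linear_map_zero[OF lin_module lin_module cmp_linear_left] by blast

lemma cmp_zero_right:
  "\<lbrakk>x \<in> Ob C; y \<in> Ob C; z \<in> Ob C; g \<in> Mor C y z\<rbrakk>
    \<Longrightarrow> cmp C x y z g (zero_mor C x y) = zero_mor C x z"
  using linear_map_zero[OF lin_module lin_module cmp_linear_right] by blast

lemma cmp_smult_left:
  "\<lbrakk>x \<in> Ob C; y \<in> Ob C; z \<in> Ob C; c \<in> carrier K; f \<in> Mor C x y; g \<in> Mor C y z\<rbrakk>
    \<Longrightarrow> cmp C x y z (c \<odot>\<^bsub>lin C y z\<^esub> g) f = c \<odot>\<^bsub>lin C x z\<^esub> cmp C x y z g f"
  using cmp_linear_left[of x y z f] by (simp add: linear_map_def lin_carrier)

lemma cmp_smult_right: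
  "\<lbrakk>x \<in> Ob C; y \<in> Ob C; z \<in> Ob C; c \<in> carrier K; f \<in> Mor C x y; g \<in> Mor C y z\<rbrakk>
    \<Longrightarrow> cmp C x y z g (c \<odot>\<^bsub>lin C x y\<^esub> f) = c \<odot>\<^bsub>lin C x z\<^esub> cmp C x y z g f"
  using cmp_linear_right[of x y z g] by (simp add: linear_map_def lin_carrier)

lemma zero_smult_mor:
  "\<lbrakk>x \<in> Ob C; y \<in> Ob C; f \<in> Mor C x y\<rbrakk> \<Longrightarrow> \<zero>\<^bsub>K\<^esub> \<odot>\<^bsub>lin C x y\<^esub> f = zero_mor C x y"
  using module.smult_l_null[OF lin_module] by (simp add: lin_carrier)

lemma smult_zero_mor:
  "\<lbrakk>x \<in> Ob C; y \<in> Ob C; c \<in> carrier K\<rbrakk> \<Longrightarrow> c \<odot>\<^bsub>lin C x y\<^esub> zero_mor C x y = zero_mor C x y"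
  using module.smult_r_null[OF lin_module] by simp

lemma one_smult_mor:
  "\<lbrakk>x \<in> Ob C; y \<in> Ob C; f \<in> Mor C x y\<rbrakk> \<Longrightarrow> \<one>\<^bsub>K\<^esub> \<odot>\<^bsub>lin C x y\<^esub> f = f"
  using module.smult_one[OF lin_module] by (simp add: lin_carrier)

lemma smult_smult_mor:
  "\<lbrakk>x \<in> Ob C; y \<in> Ob C; c \<in> carrier K; d \<in> carrier K; f \<in> Mor C x y\<rbrakk>
    \<Longrightarrow> c \<odot>\<^bsub>lin C x y\<^esub> (d \<odot>\<^bsub>lin C x y\<^esub> f) = (c \<otimes>\<^bsub>K\<^esub> d) \<odot>\<^bsub>lin C x y\<^esub> f"
  using module.smult_assoc1[OF lin_module] by (simp add: lin_carrier)

lemma smult_mor_eq_zero_iff: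
  "\<lbrakk>field K; x \<in> Ob C; y \<in> Ob C; c \<in> carrier K; f \<in> Mor C x y\<rbrakk>
    \<Longrightarrow> c \<odot>\<^bsub>lin C x y\<^esub> f = zero_mor C x y \<longleftrightarrow> c = \<zero>\<^bsub>K\<^esub> \<or> f = zero_mor C x y"
  by (rule smult_eq_zero_iff) (simp_all add: lin_module lin_carrier)

lemma zero_objectI:
  assumes x: "x \<in> Ob C" and id0: "idm C x = zero_mor C x x"
  shows "zero_object C x"
  unfolding zero_object_def
proof (intro conjI x ballI)
  fix y assume y: "y \<in> Ob C"
  have "f = zero_mor C x y" if "f \<in> Mor C x y" for f
    using cmp_idm_right[OF x y that] x y that by (simp add: id0 cmp_zero_right)
  then show "\<exists>!f. f \<in> Mor C x y"
    using zero_mor_closed[OF x y] by blast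
  have "f = zero_mor C y x" if "f \<in> Mor C y x" for f
    using cmp_idm_left[OF y x that] x y that by (simp add: id0 cmp_zero_left)
  then show "\<exists>!f. f \<in> Mor C y x"
    using zero_mor_closed[OF y x] by blast
qed

lemma zero_object_Ob: "zero_object C z \<Longrightarrow> z \<in> Ob C"
  by (simp add: zero_object_def)

lemma from_zero_object: "\<lbrakk>zero_object C z; x \<in> Ob C; f \<in> Mor C z x\<rbrakk> \<Longrightarrow> f = zero_mor C z x"
  using zero_mor_closed unfolding zero_object_def by metis

lemma to_zero_object: "\<lbrakk>zero_object C z; x \<in> Ob C; f \<in> Mor C x z\<rbrakk> \<Longrightarrow> f = zero_mor C x z"
  using zero_mor_closed unfolding zero_object_def by metis

text \<open>Here the cokernel of the first morphism is an identity, so its image and the kernel of the second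
  are zero objects; dually below.\<close>

lemma exact_at_zero_mono:
  assumes ob: "x \<in> Ob C" "y \<in> Ob C" "z \<in> Ob C" "zero_object C o'" and g: "g \<in> Mor C y z"
    and mono: "\<And>w h. \<lbrakk>w \<in> Ob C; h \<in> Mor C w y; cmp C w y z g h = zero_mor C w z\<rbrakk>
      \<Longrightarrow> h = zero_mor C w y"
  shows "exact_at C x y z (zero_mor C x y) g"
proof -
  note o = zero_object_Ob[OF ob(4)]
  have kernel: "is_kernel C y v k o' (zero_mor C o' y)"
    if v: "v \<in> Ob C" and k: "k \<in> Mor C y v" and
      m: "\<And>w h. \<lbrakk>w \<in> Ob C; h \<in> Mor C w y; cmp C w y v k h = zero_mor C w v\<rbrakk> \<Longrightarrow> h = zero_mor C w y"
    for v k
    unfolding is_kernel_def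
  proof (intro conjI ballI impI)
    fix w h assume "w \<in> Ob C" "h \<in> Mor C w y" "cmp C w y v k h = zero_mor C w v"
    then have "h = zero_mor C w y" "w \<in> Ob C" using m by auto
    then show "\<exists>!h'. h' \<in> Mor C w o' \<and> cmp C w o' y (zero_mor C o' y) h' = h"
      using o ob by (intro ex1I[of _ "zero_mor C w o'"])
        (auto simp: zero_mor_closed cmp_zero_right to_zero_object)
  qed (use o ob v k in \<open>auto simp: zero_mor_closed cmp_zero_right\<close>)
  have "is_cokernel C x y (zero_mor C x y) y (idm C y)"
    unfolding is_cokernel_def using ob
    by (auto intro!: idm_closed cmp_zero_right cmp_idm_right) (metis cmp_idm_right)
  moreover have "is_kernel C y y (idm C y) o' (zero_mor C o' y)"
    using ob by (intro kernel) (auto simp: idm_closed cmp_idm_left)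
  moreover have "is_kernel C y z g o' (zero_mor C o' y)"
    using ob g mono by (intro kernel) auto
  ultimately show ?thesis
    unfolding exact_at_def using ob g by (blast intro: zero_mor_closed)
qed

lemma exact_at_epi_zero:
  assumes ob: "x \<in> Ob C" "y \<in> Ob C" "z \<in> Ob C" "zero_object C o'" and f: "f \<in> Mor C x y"
    and epi: "\<And>w h. \<lbrakk>w \<in> Ob C; h \<in> Mor C y w; cmp C x y w h f = zero_mor C x w\<rbrakk>
      \<Longrightarrow> h = zero_mor C y w"
  shows "exact_at C x y z f (zero_mor C y z)"
proof -
  note o = zero_object_Ob[OF ob(4)]
  have "is_cokernel C x y f o' (zero_mor C y o')"
    unfolding is_cokernel_def
  proof (intro conjI ballI impI)
    fix w h assume "w \<in> Ob C" "h \<in> Mor C y w" "cmp C x y w h f = zero_mor C x w"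
    then have "h = zero_mor C y w" "w \<in> Ob C" using epi by auto
    then show "\<exists>!h'. h' \<in> Mor C o' w \<and> cmp C y o' w h' (zero_mor C y o') = h"
      using o ob by (intro ex1I[of _ "zero_mor C o' w"])
        (auto simp: zero_mor_closed cmp_zero_left from_zero_object)
  qed (use o ob f in \<open>auto simp: zero_mor_closed cmp_zero_left\<close>)
  moreover have "is_kernel C y v (zero_mor C y v) y (idm C y)" if "v \<in> Ob C" for v
    unfolding is_kernel_def using ob that
    by (auto intro!: idm_closed cmp_zero_left cmp_idm_left) (metis cmp_idm_left)
  ultimately show ?thesis
    unfolding exact_at_def using ob f o by (blast intro: zero_mor_closed)
qed

text \<open>Kernels and cokernels only depend on which composites with the given morphism vanish.\<close>

lemma is_kernel_cong:
  assumes "x \<in> Ob C" "y \<in> Ob C" "z \<in> Ob C"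
    and "\<And>w h. \<lbrakk>w \<in> Ob C; h \<in> Mor C w x\<rbrakk>
      \<Longrightarrow> cmp C w x y f h = zero_mor C w y \<longleftrightarrow> cmp C w x z g h = zero_mor C w z"
  shows "is_kernel C x y f k i \<longleftrightarrow> is_kernel C x z g k i"
  unfolding is_kernel_def using assms(4) by blast

lemma is_cokernel_cong:
  assumes "x \<in> Ob C" "y \<in> Ob C" "z \<in> Ob C"
    and "\<And>w h. \<lbrakk>w \<in> Ob C; h \<in> Mor C y w\<rbrakk>
      \<Longrightarrow> cmp C x y w h f = zero_mor C x w \<longleftrightarrow> cmp C z y w h g = zero_mor C z w"
  shows "is_cokernel C x y f q p \<longleftrightarrow> is_cokernel C z y g q p"
  unfolding is_cokernel_def using assms(4) by blast

lemma exact_at_smult: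
  assumes "field K" and ob: "x \<in> Ob C" "y \<in> Ob C" "z \<in> Ob C" and ex: "exact_at C x y z f g"
    and c: "c \<in> carrier K" "c \<noteq> \<zero>\<^bsub>K\<^esub>" and d: "d \<in> carrier K" "d \<noteq> \<zero>\<^bsub>K\<^esub>"
  shows "exact_at C x y z (c \<odot>\<^bsub>lin C x y\<^esub> f) (d \<odot>\<^bsub>lin C y z\<^esub> g)"
proof -
  have f: "f \<in> Mor C x y" and g: "g \<in> Mor C y z" using ex by (auto simp: exact_at_def)
  have "is_kernel C y z (d \<odot>\<^bsub>lin C y z\<^esub> g) k i \<longleftrightarrow> is_kernel C y z g k i" for k i
    using ob g d assms(1)
    by (intro is_kernel_cong) (simp_all add: cmp_smult_left smult_mor_eq_zero_iff cmp_closed)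
  moreover have "is_cokernel C x y (c \<odot>\<^bsub>lin C x y\<^esub> f) q p \<longleftrightarrow> is_cokernel C x y f q p" for q p
    using ob f c assms(1)
    by (intro is_cokernel_cong) (simp_all add: cmp_smult_right smult_mor_eq_zero_iff cmp_closed)
  ultimately show ?thesis
    using ex ob f g c d by (auto simp: exact_at_def smult_mor_closed)
qed

text \<open>The first morphism factors through its image, which is the kernel of the second.\<close>

lemma exact_at_cmp_zero:
  assumes ob: "x \<in> Ob C" "y \<in> Ob C" "z \<in> Ob C" and ex: "exact_at C x y z f g"
  shows "cmp C x y z g f = zero_mor C x z"
proof -
  obtain q p k i where q: "is_cokernel C x y f q p" and i: "is_kernel C y q p k i"
    and i': "is_kernel C y z g k i" and f: "f \<in> Mor C x y" and g: "g \<in> Mor C y z"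
    using ex by (auto simp: exact_at_def)
  obtain h where h: "h \<in> Mor C x k" "cmp C x k y i h = f"
    using q i ob f unfolding is_kernel_def is_cokernel_def by metis
  have k: "k \<in> Ob C" "i \<in> Mor C k y" "cmp C k y z g i = zero_mor C k z"
    using i' by (auto simp: is_kernel_def)
  have "cmp C x y z g f = cmp C x k z (cmp C k y z g i) h"
    unfolding h(2)[symmetric] by (rule cmp_assoc) (use ob k h g in auto)
  also have "\<dots> = zero_mor C x z"
    using ob k h by (simp add: cmp_zero_left)
  finally show ?thesis .
qed

text \<open>A morphism killed by \<open>g\<close> lifts to the image of \<open>f\<close>, on which every \<open>t\<close> that kills \<open>f\<close>
  vanishes.\<close>

lemma exact_at_cmp_zero_across:
  assumes ob: "x \<in> Ob C" "y \<in> Ob C" "z \<in> Ob C" "u \<in> Ob C" "v \<in> Ob C"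
    and ex: "exact_at C x y z f g"
    and w: "w \<in> Mor C u y" "cmp C u y z g w = zero_mor C u z"
    and t: "t \<in> Mor C y v" "cmp C x y v t f = zero_mor C x v"
  shows "cmp C u y v t w = zero_mor C u v"
proof -
  obtain q p k i where q: "is_cokernel C x y f q p" and i: "is_kernel C y q p k i"
    and i': "is_kernel C y z g k i"
    using ex by (auto simp: exact_at_def)
  have k: "k \<in> Ob C" "i \<in> Mor C k y" and pi: "cmp C k y q p i = zero_mor C k q"
    using i by (auto simp: is_kernel_def)
  have p: "q \<in> Ob C" "p \<in> Mor C y q" using q by (auto simp: is_cokernel_def)
  obtain h where h: "h \<in> Mor C u k" "cmp C u k y i h = w"
    using i' ob w unfolding is_kernel_def by metis
  obtain s where s: "s \<in> Mor C q v" "cmp C y q v s p = t"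
    using q ob t unfolding is_cokernel_def by metis
  have "cmp C u y q p w = cmp C u k q (cmp C k y q p i) h"
    unfolding h(2)[symmetric] by (rule cmp_assoc) (use ob k p h in auto)
  also have "\<dots> = zero_mor C u q" using ob k p h by (simp add: pi cmp_zero_left)
  finally have pw: "cmp C u y q p w = zero_mor C u q" .
  have "cmp C u y v t w = cmp C u q v s (cmp C u y q p w)"
    unfolding s(2)[symmetric] by (rule cmp_assoc[symmetric]) (use ob p s w in auto)
  then show ?thesis using ob p s by (simp add: pw cmp_zero_right)
qed

text \<open>Padding the sequence by zero objects at both ends gives the conditions at all terms the same
  form.\<close>

lemma exact_sequence_iff:
  assumes "0 < N"
  shows "exact_sequence C N X f \<longleftrightarrow>
    (\<forall>i\<le>N. X i \<in> Ob C) \<and> (\<forall>i<N. f i \<in> Mor C (X (Suc i)) (X i)) \<and>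
    (\<exists>z. zero_object C z \<and>
      (\<forall>i\<le>N. exact_at C (if i < N then X (Suc i) else z) (X i) (if 0 < i then X (i - 1) else z)
        (if i < N then f i else zero_mor C z (X i))
        (if 0 < i then f (i - 1) else zero_mor C (X i) z)))"
proof -
  have "(\<forall>i\<le>N. exact_at C (if i < N then X (Suc i) else z) (X i) (if 0 < i then X (i - 1) else z)
        (if i < N then f i else zero_mor C z (X i))
        (if 0 < i then f (i - 1) else zero_mor C (X i) z)) \<longleftrightarrow>
      exact_at C z (X N) (X (N - 1)) (zero_mor C z (X N)) (f (N - 1)) \<and>
      (\<forall>i. Suc i < N \<longrightarrow> exact_at C (X (Suc (Suc i))) (X (Suc i)) (X i) (f (Suc i)) (f i)) \<and>
      exact_at C (X 1) (X 0) z (f 0) (zero_mor C (X 0) z)" (is "(\<forall>i\<le>N. ?P i) \<longleftrightarrow> ?R") for z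
  proof
    assume P: "\<forall>i\<le>N. ?P i"
    have "exact_at C (X (Suc (Suc i))) (X (Suc i)) (X i) (f (Suc i)) (f i)" if "Suc i < N" for i
      using P[rule_format, of "Suc i"] that by simp
    then show ?R
      using P[rule_format, of N] P[rule_format, of 0] assms by simp
  next
    assume R: ?R
    show "\<forall>i\<le>N. ?P i"
    proof (intro allI impI)
      fix i assume "i \<le> N"
      with R assms show "?P i" by (cases i; cases "i = N") auto
    qed
  qed
  then show ?thesis by (simp add: exact_sequence_def)
qed

lemma exact_sequence_smult:
  assumes "field K" "0 < N" "exact_sequence C N X f"
    and c: "\<And>i. i < N \<Longrightarrow> c i \<in> carrier K \<and> c i \<noteq> \<zero>\<^bsub>K\<^esub>"
  shows "exact_sequence C N X (\<lambda>i. c i \<odot>\<^bsub>lin C (X (Suc i)) (X i)\<^esub> f i)"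
proof -
  interpret K: field K by fact
  obtain z where z: "zero_object C z" and X: "\<forall>i\<le>N. X i \<in> Ob C"
    and f: "\<forall>i<N. f i \<in> Mor C (X (Suc i)) (X i)"
    and ex: "\<And>i. i \<le> N \<Longrightarrow> exact_at C (if i < N then X (Suc i) else z) (X i) (if 0 < i then X (i -
        1) else z)
        (if i < N then f i else zero_mor C z (X i))
        (if 0 < i then f (i - 1) else zero_mor C (X i) z)"
    using assms(3) unfolding exact_sequence_iff[OF assms(2)] by blast
  have z0: "zero_mor C z (X i) = \<one>\<^bsub>K\<^esub> \<odot>\<^bsub>lin C z (X i)\<^esub> zero_mor C z (X i)"
    "zero_mor C (X i) z = \<one>\<^bsub>K\<^esub> \<odot>\<^bsub>lin C (X i) z\<^esub> zero_mor C (X i) z" if "i \<le> N" for i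
    using zero_object_Ob[OF z] X that by (simp_all add: smult_zero_mor)
  have "exact_at C (if i < N then X (Suc i) else z) (X i) (if 0 < i then X (i - 1) else z)
        (if i < N then c i \<odot>\<^bsub>lin C (X (Suc i)) (X i)\<^esub> f i else zero_mor C z (X i))
        (if 0 < i then c (i - 1) \<odot>\<^bsub>lin C (X (Suc (i - 1))) (X (i - 1))\<^esub> f (i - 1) else zero_mor C
            (X i) z)"
    if i: "i \<le> N" for i
  proof -
    have "exact_at C (if i < N then X (Suc i) else z) (X i) (if 0 < i then X (i - 1) else z)
      ((if i < N then c i else \<one>\<^bsub>K\<^esub>) \<odot>\<^bsub>lin C (if i < N then X (Suc i) else z) (X i)\<^esub>
        (if i < N then f i else zero_mor C z (X i)))
      ((if 0 < i then c (i - 1) else \<one>\<^bsub>K\<^esub>) \<odot>\<^bsub>lin C (X i) (if 0 < i then X (i - 1) else z)\<^esub>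
        (if 0 < i then f (i - 1) else zero_mor C (X i) z))"
      by (rule exact_at_smult[OF assms(1) _ _ _ ex[OF i]])
        (use i X c[of i] c[of "i - 1"] zero_object_Ob[OF z] in auto)
    then show ?thesis
      using z0[OF i] by (cases "i < N"; cases "0 < i") simp_all
  qed
  moreover have "\<forall>i<N. c i \<odot>\<^bsub>lin C (X (Suc i)) (X i)\<^esub> f i \<in> Mor C (X (Suc i)) (X i)"
    using X f c by (auto intro!: smult_mor_closed)
  ultimately show ?thesis
    unfolding exact_sequence_iff[OF assms(2)] using z X by blast
qed

lemma exact_sequence_cong:
  assumes "0 < N" "\<And>i. i \<le> N \<Longrightarrow> X i = Y i" "\<And>i. i < N \<Longrightarrow> f i = g i"
  shows "exact_sequence C N X f \<longleftrightarrow> exact_sequence C N Y g"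
  unfolding exact_sequence_def using assms by (simp cong: conj_cong imp_cong)

end


section \<open>Interlacing simplices and their boxes\<close>

definition interlaced :: "nat \<Rightarrow> simplex \<Rightarrow> simplex \<Rightarrow> bool" where
  "interlaced m \<sigma> \<tau> \<longleftrightarrow> (\<forall>i\<le>m. \<sigma> i \<le> \<tau> i) \<and> (\<forall>i<m. \<tau> i < \<sigma> (Suc i))"

definition box :: "nat \<Rightarrow> simplex \<Rightarrow> simplex set" where
  "box m \<sigma> = {x. \<forall>i<m. \<sigma> i \<le> x i \<and> x i < \<sigma> (Suc i)}"

lemma box_ge: "\<lbrakk>x \<in> box m \<sigma>; i < m\<rbrakk> \<Longrightarrow> \<sigma> i \<le> x i"
  and box_less: "\<lbrakk>x \<in> box m \<sigma>; i < m\<rbrakk> \<Longrightarrow> x i < \<sigma> (Suc i)"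
  by (auto simp: box_def)

lemma simplices_le: "\<lbrakk>\<sigma> \<in> simplices m n; i \<le> m\<rbrakk> \<Longrightarrow> \<sigma> i \<le> n"
  by (auto simp: simplices_def)

lemma simplices_mono: "\<lbrakk>\<sigma> \<in> simplices m n; i \<le> j; j \<le> m\<rbrakk> \<Longrightarrow> \<sigma> i \<le> \<sigma> j"
  by (auto simp: simplices_def mono_on_def)

lemma simplices_extensional: "\<sigma> \<in> simplices m n \<Longrightarrow> \<sigma> \<in> extensional {..m}"
  by (auto simp: simplices_def PiE_def)

lemma simplices_eqI:
  "\<lbrakk>\<sigma> \<in> simplices m n; \<tau> \<in> simplices m n'; \<And>i. i \<le> m \<Longrightarrow> \<sigma> i = \<tau> i\<rbrakk> \<Longrightarrow> \<sigma> = \<tau>"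
  by (rule extensionalityI[of _ "{..m}"]) (auto simp: simplices_extensional)

lemma mono_from_Suc:
  fixes \<sigma> :: "nat \<Rightarrow> nat"
  assumes "\<And>i. i < m \<Longrightarrow> \<sigma> i \<le> \<sigma> (Suc i)"
  shows "\<lbrakk>i \<le> j; j \<le> m\<rbrakk> \<Longrightarrow> \<sigma> i \<le> \<sigma> j"
proof (induction j)
  case (Suc j)
  show ?case
  proof (cases "i = Suc j")
    case False
    then have "\<sigma> i \<le> \<sigma> j" using Suc by simp
    also have "\<dots> \<le> \<sigma> (Suc j)" using Suc by (intro assms) simp
    finally show ?thesis .
  qed simp
qed simp

lemma simplicesI:
  assumes "\<sigma> \<in> extensional {..m}" "\<And>i. i < m \<Longrightarrow> \<sigma> i \<le> \<sigma> (Suc i)" "\<sigma> m \<le> n"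
  shows "\<sigma> \<in> simplices m n"
  using assms mono_from_Suc[of m \<sigma>] le_trans[OF mono_from_Suc[of m \<sigma> _ m] assms(3)]
  by (auto simp: simplices_def PiE_def mono_on_def)

lemma nondegenerate_simplices: "\<sigma> \<in> nondegenerate m n \<Longrightarrow> \<sigma> \<in> simplices m n"
  by (simp add: nondegenerate_def)

lemma degenerate_simplices: "\<sigma> \<in> degenerate m n \<Longrightarrow> \<sigma> \<in> simplices m n"
  by (simp add: degenerate_def)

lemma nondegenerate_iff:
  assumes "\<sigma> \<in> simplices m n"
  shows "\<sigma> \<in> nondegenerate m n \<longleftrightarrow> (\<forall>i<m. \<sigma> i < \<sigma> (Suc i))"
proof
  assume *: "\<forall>i<m. \<sigma> i < \<sigma> (Suc i)"
  have "\<sigma> i < \<sigma> j" if "i < j" "j \<le> m" for i j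
    using * simplices_mono[OF assms, of "Suc i" j] that by (meson Suc_leI less_le_trans)
  with assms show "\<sigma> \<in> nondegenerate m n"
    by (auto simp: nondegenerate_def strict_mono_on_def)
qed (auto simp: nondegenerate_def strict_mono_on_def)

lemma interlaced_refl_iff:
  "\<sigma> \<in> simplices m n \<Longrightarrow> interlaced m \<sigma> \<sigma> \<longleftrightarrow> \<sigma> \<in> nondegenerate m n"
  by (auto simp: nondegenerate_iff interlaced_def)

lemma interlaced_less_Suc:
  assumes "interlaced m \<sigma> \<tau>" "i < m"
  shows "\<sigma> i < \<sigma> (Suc i)" "\<tau> i < \<tau> (Suc i)"
proof -
  have "\<sigma> i \<le> \<tau> i" "\<tau> i < \<sigma> (Suc i)" "\<sigma> (Suc i) \<le> \<tau> (Suc i)"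
    using assms by (auto simp: interlaced_def)
  then show "\<sigma> i < \<sigma> (Suc i)" "\<tau> i < \<tau> (Suc i)" by linarith+
qed

lemma interlaced_nondegenerate:
  assumes "interlaced m \<sigma> \<tau>"
  shows "\<sigma> \<in> simplices m n \<Longrightarrow> \<sigma> \<in> nondegenerate m n"
    and "\<tau> \<in> simplices m n \<Longrightarrow> \<tau> \<in> nondegenerate m n"
  using interlaced_less_Suc[OF assms] by (auto simp: nondegenerate_iff)

lemma interlaced_between:
  assumes "interlaced m \<rho> \<tau>" "\<And>i. i \<le> m \<Longrightarrow> \<rho> i \<le> \<sigma> i" "\<And>i. i \<le> m \<Longrightarrow> \<sigma> i \<le> \<tau> i"
  shows "interlaced m \<rho> \<sigma>" "interlaced m \<sigma> \<tau>"
proof -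
  have "\<tau> i < \<rho> (Suc i)" if "i < m" for i using assms(1) that by (simp add: interlaced_def)
  then have "\<sigma> i < \<rho> (Suc i)" "\<tau> i < \<sigma> (Suc i)" if "i < m" for i
    using that assms(2)[of "Suc i"] assms(3)[of i] by (meson le_less_trans less_le_trans
        less_imp_le_nat Suc_leI)+
  then show "interlaced m \<rho> \<sigma>" "interlaced m \<sigma> \<tau>"
    using assms(2,3) by (auto simp: interlaced_def)
qed

lemma interlaced_antisym:
  "\<lbrakk>interlaced m \<sigma> \<tau>; interlaced m \<tau> \<sigma>; \<sigma> \<in> simplices m n; \<tau> \<in> simplices m n\<rbrakk> \<Longrightarrow> \<sigma> = \<tau>"
  by (rule simplices_eqI) (auto simp: interlaced_def intro: le_antisym)

text \<open>If \<open>\<sigma> (i + 1) \<le> \<tau> i\<close>, raising the vertex \<open>\<sigma> i\<close> to \<open>\<sigma> (i + 1)\<close> gives a degenerate simplex that is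
  still below \<open>\<tau>\<close>.\<close>

lemma interlaced_iff_no_degenerate_between:
  assumes s: "\<sigma> \<in> simplices m n" and t: "\<tau> \<in> simplices m n" and le: "\<And>i. i \<le> m \<Longrightarrow> \<sigma> i \<le> \<tau> i"
  shows "interlaced m \<sigma> \<tau> \<longleftrightarrow>
    \<not> (\<exists>\<kappa> \<in> degenerate m n. (\<forall>i\<le>m. \<sigma> i \<le> \<kappa> i) \<and> (\<forall>i\<le>m. \<kappa> i \<le> \<tau> i))"
proof
  assume il: "interlaced m \<sigma> \<tau>"
  show "\<not> (\<exists>\<kappa> \<in> degenerate m n. (\<forall>i\<le>m. \<sigma> i \<le> \<kappa> i) \<and> (\<forall>i\<le>m. \<kappa> i \<le> \<tau> i))"
  proof clarify
    fix \<kappa> assume k: "\<kappa> \<in> degenerate m n" "\<forall>i\<le>m. \<sigma> i \<le> \<kappa> i" "\<forall>i\<le>m. \<kappa> i \<le> \<tau> i"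
    then have "interlaced m \<sigma> \<kappa>" using interlaced_between(1)[OF il] by simp
    then have "\<kappa> \<in> nondegenerate m n"
      using k(1) by (intro interlaced_nondegenerate(2)) (auto simp: degenerate_def)
    with k(1) show False by (simp add: degenerate_def)
  qed
next
  assume *: "\<not> (\<exists>\<kappa> \<in> degenerate m n. (\<forall>i\<le>m. \<sigma> i \<le> \<kappa> i) \<and> (\<forall>i\<le>m. \<kappa> i \<le> \<tau> i))"
  show "interlaced m \<sigma> \<tau>"
  proof (rule ccontr)
    assume "\<not> interlaced m \<sigma> \<tau>"
    then obtain i where i: "i < m" "\<sigma> (Suc i) \<le> \<tau> i"
      using le by (auto simp: interlaced_def not_less)
    let ?\<kappa> = "\<sigma>(i := \<sigma> (Suc i))"
    have "?\<kappa> \<in> simplices m n"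
    proof (rule simplicesI)
      fix j assume "j < m"
      then show "?\<kappa> j \<le> ?\<kappa> (Suc j)"
        using simplices_mono[OF s, of j "Suc j"] simplices_mono[OF s, of "j" "Suc (Suc j)"] i
        by auto
    qed (use simplices_extensional[OF s] i simplices_le[OF s] in \<open>auto simp: extensional_def\<close>)
    moreover have "?\<kappa> i = ?\<kappa> (Suc i)" by simp
    ultimately have "?\<kappa> \<in> degenerate m n"
      using i unfolding degenerate_def by (auto simp: nondegenerate_iff)
    moreover have "\<sigma> j \<le> ?\<kappa> j" "?\<kappa> j \<le> \<tau> j" if "j \<le> m" for j
      using that i le simplices_mono[OF s, of i "Suc i"] by auto
    ultimately show False using * by blast
  qed
qed

lemma interlaced_left_in_box: "interlaced m \<sigma> \<tau> \<Longrightarrow> \<sigma> \<in> box m \<sigma>"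
  by (auto simp: box_def interlaced_less_Suc)

lemma interlaced_right_in_box: "interlaced m \<sigma> \<tau> \<Longrightarrow> \<tau> \<in> box m \<tau>"
  by (auto simp: box_def interlaced_less_Suc)

lemma interlaced_right_in_left_box: "interlaced m \<sigma> \<tau> \<Longrightarrow> \<tau> \<in> box m \<sigma>"
  by (auto simp: box_def interlaced_def)

lemma nondegenerate_in_box: "\<sigma> \<in> nondegenerate m n \<Longrightarrow> \<sigma> \<in> box m \<sigma>"
  by (auto simp: box_def nondegenerate_def strict_mono_on_def)

section \<open>Faces\<close>

lemma face_apply: "j \<le> m \<Longrightarrow> face m \<zeta> i j = (if j < i then \<zeta> j else \<zeta> (Suc j))"
  by (simp add: face_def compose_def coface_def)

lemma face_simplices:
  assumes "\<zeta> \<in> simplices (Suc m) n"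
  shows "face m \<zeta> i \<in> simplices m n"
proof (rule simplicesI)
  fix j assume "j < m"
  then show "face m \<zeta> i j \<le> face m \<zeta> i (Suc j)"
    by (auto simp: face_apply intro!: simplices_mono[OF assms])
qed (auto simp: face_def compose_def coface_def simplices_le[OF assms])

lemma nondegenerate_less:
  "\<lbrakk>\<zeta> \<in> nondegenerate m n; i < j; j \<le> m\<rbrakk> \<Longrightarrow> \<zeta> i < \<zeta> j"
  by (auto simp: nondegenerate_def strict_mono_on_def)

lemma face_interlaced:
  assumes "\<zeta> \<in> nondegenerate (Suc m) n"
  shows "interlaced m (face m \<zeta> (Suc i)) (face m \<zeta> i)"
proof -
  have "\<zeta> j < \<zeta> (Suc j)" if "j \<le> m" for j
    using that by (intro nondegenerate_less[OF assms]) auto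
  then show ?thesis
    unfolding interlaced_def by (auto simp: face_apply intro: less_imp_le)
qed

text \<open>Combinatorial shadow of exactness of a sequence \<open>s N \<rightarrow> \<dots> \<rightarrow> s 0\<close> of interval modules,
  where \<open>e i\<close> records whether the morphism \<open>s (i + 1) \<rightarrow> s i\<close> is nonzero: at a point of the support
  of \<open>s i\<close> the module is one-dimensional, hence it must be hit from the left or survive to the
  right, but not both.\<close>

definition box_exact :: "nat \<Rightarrow> nat \<Rightarrow> (nat \<Rightarrow> simplex) \<Rightarrow> (nat \<Rightarrow> bool) \<Rightarrow> bool" where
  "box_exact m N s e \<longleftrightarrow> (\<forall>i\<le>N. \<forall>x \<in> box m (s i).
     (i < N \<and> e i \<and> x \<in> box m (s (Suc i))) \<noteq> (0 < i \<and> e (i - 1) \<and> x \<in> box m (s (i - 1))))"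

text \<open>In the box of the \<open>i\<close>-th face the coordinate \<open>x (i - 1)\<close> ranges over the interval from \<open>\<zeta> (i - 1)\<close> to
  \<open>\<zeta> (i + 1)\<close>. The omitted vertex \<open>\<zeta> i\<close> cuts it into the part shared with face \<open>i + 1\<close> and the part
  shared with face \<open>i - 1\<close>.\<close>

lemma face_box_exact:
  assumes \<zeta>: "\<zeta> \<in> nondegenerate (Suc m) n"
  shows "box_exact m (Suc m) (face m \<zeta>) (\<lambda>_. True)"
  unfolding box_exact_def
proof (intro allI ballI impI)
  fix i x assume i: "i \<le> Suc m" and x: "x \<in> box m (face m \<zeta> i)"
  have xj: "face m \<zeta> i j \<le> x j" "x j < face m \<zeta> i (Suc j)" if "j < m" for j
    using x that by (auto simp: box_def)
  note [intro] = nondegenerate_less[OF \<zeta>]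
  have less: "\<zeta> j < \<zeta> (Suc j)" if "j \<le> m" for j using that by auto
  have up: "x \<in> box m (face m \<zeta> (Suc i)) \<longleftrightarrow> i = 0 \<or> x (i - 1) < \<zeta> i" if "i \<le> m"
  proof
    assume "x \<in> box m (face m \<zeta> (Suc i))"
    then have "x (i - 1) < face m \<zeta> (Suc i) (Suc (i - 1))" if "i \<noteq> 0"
      using that \<open>i \<le> m\<close> by (intro box_less) auto
    then show "i = 0 \<or> x (i - 1) < \<zeta> i"
      using \<open>i \<le> m\<close> by (cases i) (auto simp: face_apply)
  next
    assume *: "i = 0 \<or> x (i - 1) < \<zeta> i"
    have "face m \<zeta> (Suc i) j \<le> x j \<and> x j < face m \<zeta> (Suc i) (Suc j)" if "j < m" for j
      using xj[OF that] that * less[of j] less[of "Suc j"] \<open>i \<le> m\<close>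
      by (cases "j = i"; cases "Suc j = i") (auto simp: face_apply split: if_splits)
    then show "x \<in> box m (face m \<zeta> (Suc i))" by (simp add: box_def)
  qed
  have down: "x \<in> box m (face m \<zeta> (i - 1)) \<longleftrightarrow> i = Suc m \<or> \<zeta> i \<le> x (i - 1)" if "0 < i"
  proof
    assume "x \<in> box m (face m \<zeta> (i - 1))"
    then have "face m \<zeta> (i - 1) (i - 1) \<le> x (i - 1)" if "i \<noteq> Suc m"
      using that i \<open>0 < i\<close> by (auto simp: box_def)
    then show "i = Suc m \<or> \<zeta> i \<le> x (i - 1)"
      using i \<open>0 < i\<close> by (auto simp: face_apply)
  next
    assume *: "i = Suc m \<or> \<zeta> i \<le> x (i - 1)"
    have "face m \<zeta> (i - 1) j \<le> x j \<and> x j < face m \<zeta> (i - 1) (Suc j)" if "j < m" for j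
      using xj[OF that] that * less[of j] less[of "Suc j"] \<open>0 < i\<close> i
      by (cases "Suc j = i"; cases "Suc (Suc j) = i") (auto simp: face_apply split: if_splits)
    then show "x \<in> box m (face m \<zeta> (i - 1))" by (simp add: box_def)
  qed
  show "(i < Suc m \<and> True \<and> x \<in> box m (face m \<zeta> (Suc i)))
    \<noteq> (0 < i \<and> True \<and> x \<in> box m (face m \<zeta> (i - 1)))"
    using up down i by (cases "i = 0"; cases "i = Suc m") auto
qed


text \<open>The lowest point of the part of the box of face \<open>k + 1\<close> that is not covered by face \<open>k + 2\<close>.\<close>

lemma box_face_corner:
  assumes \<zeta>: "\<zeta> \<in> nondegenerate (Suc m) n" and k: "k < m"
  defines "y \<equiv> \<lambda>i. if i < k then \<zeta> i else \<zeta> (Suc i)"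
  shows "y \<in> box m (face m \<zeta> (Suc k))" "y \<notin> box m (face m \<zeta> (Suc (Suc k)))"
proof -
  have less: "\<zeta> i < \<zeta> j" if "i < j" "j \<le> Suc m" for i j
    using that by (intro nondegenerate_less[OF \<zeta>]) auto
  have "face m \<zeta> (Suc k) i \<le> y i \<and> y i < face m \<zeta> (Suc k) (Suc i)" if "i < m" for i
    using that less[of i "Suc i"] less[of "Suc i" "Suc (Suc i)"] by (auto simp: face_apply y_def)
  then show "y \<in> box m (face m \<zeta> (Suc k))" by (simp add: box_def)
  have "face m \<zeta> (Suc (Suc k)) (Suc k) = y k" using k by (simp add: face_apply y_def)
  then show "y \<notin> box m (face m \<zeta> (Suc (Suc k)))"
    using box_less[OF _ k, of y "face m \<zeta> (Suc (Suc k))"] by auto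
qed

section \<open>Classification of the exact sequences of boxes\<close>

text \<open>Let \<open>s (b + 1)\<close> be the first term of a string of nonzero morphisms. Exactness forces its box into
  that of \<open>s b\<close>, so both simplices differ in the last vertex only. Together they span a simplex \<open>\<zeta>\<close>, and
  going down the string, the part of the box of a face that is not hit from the left prescribes all
  vertices of the next term except the last one. The last vertex is prescribed by exactness one
  step further down: if it were larger than that of \<open>\<zeta>\<close>, the uncovered part of the box would have to
  extend in two directions at once, and would not be a box. The string can only stop after all
  \<open>m + 2\<close> faces of \<open>\<zeta>\<close> have appeared.\<close>

context
  fixes m n :: nat and s :: "nat \<Rightarrow> simplex" and e :: "nat \<Rightarrow> bool"
  assumes m: "1 \<le> m"
    and simp_s: "\<And>i. i \<le> Suc m \<Longrightarrow> s i \<in> simplices m n"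
    and il: "\<And>i. \<lbrakk>i \<le> m; e i\<rbrakk> \<Longrightarrow> interlaced m (s (Suc i)) (s i)"
    and ex: "box_exact m (Suc m) s e"
begin

lemma string_start:
  assumes b: "b \<le> m" "e b" "b < m \<Longrightarrow> \<not> e (Suc b)" and i: "i < m"
  shows "s (Suc b) i = s b i"
proof -
  note ilb = il[OF b(1,2)]
  have "s (Suc b) \<in> box m (s (Suc b))" using ilb by (rule interlaced_left_in_box)
  then have "s (Suc b) \<in> box m (s b)"
    using ex[unfolded box_exact_def, rule_format, of "Suc b" "s (Suc b)"] b by auto
  then have "s b i \<le> s (Suc b) i" using i by (simp add: box_def)
  moreover have "s (Suc b) i \<le> s b i" using ilb i by (simp add: interlaced_def)
  ultimately show ?thesis by simp
qed

lemma string_step: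
  assumes \<zeta>: "\<zeta> \<in> nondegenerate (Suc m) n" and t: "Suc t \<le> m" "e (Suc t)" and j: "j \<le> m"
    and up: "s (Suc (Suc t)) = face m \<zeta> (Suc j)" and mid: "s (Suc t) = face m \<zeta> j"
    and tj: "t < j"
  shows "e t \<and> j \<noteq> 0 \<and> s t = face m \<zeta> (j - 1)"
proof -
  obtain k where k: "j = Suc k" using tj by (cases j) auto
  have less: "\<zeta> i < \<zeta> (Suc i)" if "i \<le> m" for i
    using that by (intro nondegenerate_less[OF \<zeta>]) auto
  have f: "s (Suc t) i = (if i < Suc k then \<zeta> i else \<zeta> (Suc i))" if "i \<le> m" for i
    using that by (simp add: mid k face_apply)
  have fu: "s (Suc (Suc t)) i = (if i < Suc (Suc k) then \<zeta> i else \<zeta> (Suc i))" if "i \<le> m" for i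
    using that by (simp add: up k face_apply)
  have ex_this: "(x \<in> box m (s (Suc (Suc t)))) \<noteq> (e t \<and> x \<in> box m (s t))"
    if "x \<in> box m (s (Suc t))" for x
    using ex[unfolded box_exact_def, rule_format, of "Suc t" x] that t by auto
  define y where "y = (\<lambda>i. if i < k then \<zeta> i else \<zeta> (Suc i))"
  have y_this: "y \<in> box m (s (Suc t))" and y_up: "y \<notin> box m (s (Suc (Suc t)))"
    using box_face_corner[OF \<zeta>, of k] j by (auto simp: mid up k y_def)
  have et: "e t" and y_t: "y \<in> box m (s t)"
    using ex_this[OF y_this] y_up by auto
  have ilt: "interlaced m (s (Suc t)) (s t)" using et t by (intro il) auto
  have ge: "s (Suc t) i \<le> s t i" if "i \<le> m" for i using ilt that by (simp add: interlaced_def)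
  have lt: "s t i < s (Suc t) (Suc i)" if "i < m" for i using ilt that by (simp add: interlaced_def)
  have t_t: "s t \<in> box m (s t)" using ilt by (rule interlaced_right_in_box)
  have t_this: "s t \<in> box m (s (Suc t))" using ilt by (rule interlaced_right_in_left_box)
  then have t_up: "s t \<notin> box m (s (Suc (Suc t)))" using ex_this et t_t by blast
  have st_le: "s t i \<le> y i" if "i < m" for i using y_t that by (simp add: box_def)
  have st: "s t i = y i" if "i < m" for i
  proof (cases "i = k")
    case True
    have "\<not> s t k < \<zeta> (Suc k)"
    proof
      assume *: "s t k < \<zeta> (Suc k)"
      have "s (Suc (Suc t)) i \<le> s t i \<and> s t i < s (Suc (Suc t)) (Suc i)" if "i < m" for i
      proof -
        have "s t i < \<zeta> (Suc i) \<or> (k < i \<and> s t i < \<zeta> (Suc (Suc i)))"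
          using lt[OF that] that * by (cases "i = k") (auto simp: f split: if_splits)
        moreover have "(if i < Suc k then \<zeta> i else \<zeta> (Suc i)) \<le> s t i"
          using ge[of i] that by (simp add: f)
        ultimately show ?thesis
          using that less[of i] by (auto simp: fu split: if_splits)
      qed
      with t_up show False by (simp add: box_def)
    qed
    then show ?thesis using st_le[OF that] True by (simp add: y_def)
  next
    case False
    then show ?thesis
      using ge[of i] st_le[OF that] that by (auto simp: f y_def split: if_splits)
  qed
  have last_ge: "\<zeta> (Suc m) \<le> s t m" using ge[of m] j k by (simp add: f)
  have last: "s t m = \<zeta> (Suc m)"
  proof (rule ccontr)
    assume "s t m \<noteq> \<zeta> (Suc m)"
    with last_ge have last_less: "\<zeta> (Suc m) < s t m" by simp
    obtain m' where m': "m = Suc m'" using m by (cases m) auto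
    have ex_t: "(x \<in> box m (s (Suc t))) \<noteq> (0 < t \<and> e (t - 1) \<and> x \<in> box m (s (t - 1)))"
      if "x \<in> box m (s t)" for x
      using ex[unfolded box_exact_def, rule_format, of t x] that t et by auto
    \<comment> \<open>a point beyond the box of \<open>s (t + 1)\<close> in the last direction\<close>
    define u where "u = (s t)(m' := \<zeta> (Suc m))"
    have y_last: "y m' \<le> \<zeta> m" using less[of m'] m' by (auto simp: y_def)
    have u_t: "u \<in> box m (s t)"
    proof -
      have "s t i \<le> u i \<and> u i < s t (Suc i)" if "i < m" for i
        using t_t that st[of m'] y_last less[of m] last_less
        by (cases "i = m'") (auto simp: u_def m' box_def)
      then show ?thesis by (simp add: box_def)
    qed
    have "s (Suc t) m = \<zeta> (Suc m)" using j k by (simp add: f)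
    then have "u \<notin> box m (s (Suc t))"
      unfolding box_def u_def m' by (auto intro!: exI[of _ m'])
    with ex_t[OF u_t] have t0: "0 < t" and e1: "e (t - 1)" and u1: "u \<in> box m (s (t - 1))" by auto
    then have k0: "0 < k" using tj k by simp
    have il1: "interlaced m (s t) (s (t - 1))" using il[of "t - 1"] t0 e1 t by simp
    have le1: "s (t - 1) i \<le> s t i" if "i < m" "i \<noteq> m'" for i
      using u1 that by (auto simp: u_def box_def)
    \<comment> \<open>a point beyond the box of \<open>s (t + 1)\<close> in the direction \<open>k - 1\<close>\<close>
    define v where "v = (s t)(k - 1 := \<zeta> k)"
    have v_t: "v \<in> box m (s t)"
    proof -
      have "s t i \<le> v i \<and> v i < s t (Suc i)" if "i < m" for i
        using t_t that st[of "k - 1"] st[of k] k0 j k less[of "k - 1"] less[of k]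
        by (cases "i = k - 1") (auto simp: v_def box_def y_def)
      then show ?thesis by (simp add: box_def)
    qed
    have "v \<notin> box m (s (Suc t))"
      using j k k0 unfolding box_def v_def by (auto simp: f intro!: exI[of _ "k - 1"])
    with ex_t[OF v_t] have v1: "v \<in> box m (s (t - 1))" by auto
    have "k - 1 \<noteq> m'" using j k k0 m' by auto
    then have "s (t - 1) m' \<le> s t m'" using v1 by (auto simp: v_def box_def m')
    with le1 have "s (t - 1) i \<le> s t i" if "i < m" for i using that by (cases "i = m'") auto
    moreover have "s t i < s (t - 1) (Suc i)" if "i < m" for i
    proof -
      have "s t i < s t (Suc i)" using t_t that by (simp add: box_def)
      also have "\<dots> \<le> s (t - 1) (Suc i)" using il1 that by (simp add: interlaced_def)
      finally show ?thesis .
    qed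
    ultimately have "s t \<in> box m (s (t - 1))" by (simp add: box_def)
    with ex_t[OF t_t] t_this t0 e1 show False by simp
  qed
  have "s t = face m \<zeta> (j - 1)"
  proof (rule simplices_eqI)
    show "face m \<zeta> (j - 1) \<in> simplices m n"
      by (intro face_simplices nondegenerate_simplices \<zeta>)
    show "s t i = face m \<zeta> (j - 1) i" if "i \<le> m" for i
      using that j k st[of i] last by (cases "i = m") (auto simp: face_apply y_def)
  qed (use t in \<open>auto intro: simp_s\<close>)
  with et k show ?thesis by simp
qed

text \<open>If some nonzero morphism is not between equal simplices, the string through it has no identity
  at its start, and is therefore the sequence of all faces.\<close>

lemma box_exact_cases:
  obtains (faces) \<zeta> where "\<zeta> \<in> nondegenerate (Suc m) n"
      "\<And>i. i \<le> Suc m \<Longrightarrow> s i = face m \<zeta> i" "\<And>i. i \<le> m \<Longrightarrow> e i"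
    | (identities) "\<And>i. \<lbrakk>i \<le> m; e i\<rbrakk> \<Longrightarrow> s (Suc i) = s i"
proof (cases "\<exists>i\<le>m. e i \<and> s (Suc i) \<noteq> s i")
  case False
  then show ?thesis using identities by blast
next
  case True
  then obtain i where i: "i \<le> m" "e i" "s (Suc i) \<noteq> s i" by blast
  define b where "b = (GREATEST b. b \<le> m \<and> (\<forall>k. i \<le> k \<and> k \<le> b \<longrightarrow> e k))"
  let ?P = "\<lambda>b. b \<le> m \<and> (\<forall>k. i \<le> k \<and> k \<le> b \<longrightarrow> e k)"
  have "?P i" using i by (auto dest: le_antisym)
  then have P: "?P b" and ib: "i \<le> b"
    unfolding b_def by (auto intro!: GreatestI_nat[of ?P i m] Greatest_le_nat[of ?P i m])
  have top: "\<not> e (Suc b)" if "b < m"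
  proof
    assume "e (Suc b)"
    with P that have "?P (Suc b)" by (auto simp: le_Suc_eq)
    then have "Suc b \<le> b" unfolding b_def by (rule Greatest_le_nat[of ?P _ m]) auto
    then show False by simp
  qed
  have b: "b \<le> m" "e b" using P ib by auto
  note ilb = il[OF b]
  have eq: "s (Suc b) i = s b i" if "i < m" for i using string_start[OF b top that] .
  have "s (Suc b) \<noteq> s b"
  proof
    assume same: "s (Suc b) = s b"
    with i(3) ib have "i < b" by (cases "i = b") auto
    then have e1: "e (b - 1)" using P by auto
    then have il1: "interlaced m (s b) (s (b - 1))" using il[of "b - 1"] b \<open>i < b\<close> by simp
    then have "s (b - 1) \<in> box m (s b)" "s (b - 1) \<in> box m (s (b - 1))"
      by (auto intro: interlaced_right_in_left_box interlaced_right_in_box)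
    then show False
      using ex[unfolded box_exact_def, rule_format, of b "s (b - 1)"] b same e1 \<open>i < b\<close> by auto
  qed
  moreover have "s (Suc b) = s b" if "s (Suc b) m = s b m"
  proof (rule simplices_eqI)
    show "s (Suc b) i = s b i" if "i \<le> m" for i
      using that eq[of i] \<open>s (Suc b) m = s b m\<close> by (cases "i = m") auto
  qed (use b in \<open>auto intro: simp_s\<close>)
  ultimately have "s (Suc b) m \<noteq> s b m" by blast
  moreover have "s (Suc b) m \<le> s b m" using ilb by (simp add: interlaced_def)
  ultimately have last: "s (Suc b) m < s b m" by simp
  define \<zeta> where "\<zeta> = (\<lambda>j\<in>{..Suc m}. if j \<le> m then s (Suc b) j else s b m)"
  have \<zeta>s: "\<zeta> \<in> simplices (Suc m) n"
    using interlaced_less_Suc(1)[OF ilb] simplices_le[OF simp_s[of b]] b last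
    by (intro simplicesI) (auto simp: \<zeta>_def less_Suc_eq less_imp_le)
  have \<zeta>: "\<zeta> \<in> nondegenerate (Suc m) n"
    unfolding nondegenerate_iff[OF \<zeta>s]
  proof (intro allI impI)
    fix i assume "i < Suc m"
    then show "\<zeta> i < \<zeta> (Suc i)"
      using last interlaced_less_Suc(1)[OF ilb, of i] by (cases "i = m") (simp_all add: \<zeta>_def)
  qed
  have top_face: "s (Suc b) = face m \<zeta> (Suc m)"
    using b by (intro simplices_eqI[OF simp_s[of "Suc b"] face_simplices[OF \<zeta>s]])
      (auto simp: face_apply \<zeta>_def)
  have next_face: "s b = face m \<zeta> m"
  proof (rule simplices_eqI[OF simp_s[of b] face_simplices[OF \<zeta>s]])
    show "s b i = face m \<zeta> m i" if "i \<le> m" for i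
      using that eq[of i] by (cases "i = m") (auto simp: face_apply \<zeta>_def)
  qed (use b in auto)
  have down: "j \<le> b \<and> e (b - j) \<and> s (Suc (b - j)) = face m \<zeta> (Suc (m - j)) \<and> s (b - j) = face m \<zeta>
      (m - j)"
    if "j \<le> m" for j
    using that
  proof (induction j)
    case 0
    then show ?case using b top_face next_face by simp
  next
    case (Suc j)
    then have IH: "j \<le> b" "e (b - j)" "s (Suc (b - j)) = face m \<zeta> (Suc (m - j))"
      "s (b - j) = face m \<zeta> (m - j)" by auto
    have jb: "j < b"
    proof (rule ccontr)
      assume "\<not> j < b"
      then have "b - j = 0" by simp
      \<comment> \<open>the string cannot stop at \<open>s 0\<close>, where the point \<open>?y\<close> is not hit from the left\<close>
      define k where "k = m - Suc j"
      have k: "k < m" "Suc k = m - j" using Suc.prems by (auto simp: k_def)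
      let ?y = "\<lambda>i. if i < k then \<zeta> i else \<zeta> (Suc i)"
      have "?y \<in> box m (s 0)" "?y \<notin> box m (s 1)"
        using box_face_corner[OF \<zeta> k(1)] IH(3,4) \<open>b - j = 0\<close> by (auto simp: k(2))
      then show False
        using ex[unfolded box_exact_def, rule_format, of 0 ?y] by auto
    qed
    have *: "Suc (b - Suc j) = b - j" using jb by simp
    have "e (b - Suc j) \<and> m - j \<noteq> 0 \<and> s (b - Suc j) = face m \<zeta> (m - j - 1)"
      by (rule string_step[OF \<zeta>]) (use IH Suc.prems jb b in \<open>auto simp: *\<close>)
    then show ?case using IH jb Suc.prems by (simp add: * Suc_diff_Suc)
  qed
  have bm: "b = m" using down[of m] b by simp
  show ?thesis
  proof (rule faces[OF \<zeta>])
    show "s i = face m \<zeta> i" if "i \<le> Suc m" for i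
      using down[of "m - i"] that top_face bm by (cases "i = Suc m") auto
    show "e i" if "i \<le> m" for i using down[of "m - i"] that bm by auto
  qed
qed

end


section \<open>Functors on the poset of simplices\<close>

abbreviation edge :: "(simplex, simplex \<times> simplex, 'o, 'a) func \<Rightarrow> simplex \<Rightarrow> simplex \<Rightarrow> 'a" where
  "edge X \<sigma> \<tau> \<equiv> farr X \<sigma> \<tau> (\<sigma>, \<tau>)"

lemma Delta_simps [simp]:
  "Ob (Delta m n) = simplices m n"
  "u \<in> Mor (Delta m n) \<sigma> \<tau> \<longleftrightarrow> u = (\<sigma>, \<tau>) \<and> (\<forall>i\<le>m. \<sigma> i \<le> \<tau> i)"
  "idm (Delta m n) \<sigma> = (\<sigma>, \<sigma>)" "cmp (Delta m n) \<rho> \<sigma> \<tau> v u = (\<rho>, \<tau>)"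
  by (simp_all add: Delta_def)

lemma category_Delta: "category (Delta m n)"
  by unfold_locales (auto intro: le_trans)

lemma interlaced_le: "interlaced m \<sigma> \<tau> \<Longrightarrow> \<forall>i\<le>m. \<sigma> i \<le> \<tau> i"
  by (simp add: interlaced_def)

context
  fixes m n :: nat and D :: "('o, 'a, 'z) cat_scheme" and X
  assumes X: "is_functor (Delta m n) D X"
begin

lemma edge_closed:
  "\<lbrakk>\<sigma> \<in> simplices m n; \<tau> \<in> simplices m n; \<forall>i\<le>m. \<sigma> i \<le> \<tau> i\<rbrakk>
    \<Longrightarrow> edge X \<sigma> \<tau> \<in> Mor D (fob X \<sigma>) (fob X \<tau>)"
  using functor_arr[OF X, of "(\<sigma>, \<tau>)" \<sigma> \<tau>] by simp

lemma edge_refl: "\<sigma> \<in> simplices m n \<Longrightarrow> edge X \<sigma> \<sigma> = idm D (fob X \<sigma>)"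
  using functor_id[OF X, of \<sigma>] by simp

lemma edge_cmp:
  "\<lbrakk>\<rho> \<in> simplices m n; \<sigma> \<in> simplices m n; \<tau> \<in> simplices m n;
    \<forall>i\<le>m. \<rho> i \<le> \<sigma> i; \<forall>i\<le>m. \<sigma> i \<le> \<tau> i\<rbrakk>
    \<Longrightarrow> cmp D (fob X \<rho>) (fob X \<sigma>) (fob X \<tau>) (edge X \<sigma> \<tau>) (edge X \<rho> \<sigma>) = edge X \<rho> \<tau>"
  using functor_cmp[OF X, of \<rho> \<sigma> \<tau> "(\<rho>, \<sigma>)" "(\<sigma>, \<tau>)"] by simp

lemma simplex_ob: "\<sigma> \<in> simplices m n \<Longrightarrow> fob X \<sigma> \<in> Ob D"
  using functor_ob[OF X] by simp

end

text \<open>The morphism factors through the zero object at a degenerate simplex between \<open>\<sigma>\<close> and \<open>\<tau>\<close>.\<close>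

lemma (in linear_category) edge_eq_zero:
  assumes X: "is_functor (Delta m n) C X"
    and zero: "\<And>\<kappa>. \<kappa> \<in> degenerate m n \<Longrightarrow> zero_object C (fob X \<kappa>)"
    and st: "\<sigma> \<in> simplices m n" "\<tau> \<in> simplices m n" "\<forall>i\<le>m. \<sigma> i \<le> \<tau> i" "\<not> interlaced m \<sigma> \<tau>"
  shows "edge X \<sigma> \<tau> = zero_mor C (fob X \<sigma>) (fob X \<tau>)"
proof -
  obtain \<kappa> where \<kappa>: "\<kappa> \<in> degenerate m n" and le: "\<forall>i\<le>m. \<sigma> i \<le> \<kappa> i" "\<forall>i\<le>m. \<kappa> i \<le> \<tau> i"
    using interlaced_iff_no_degenerate_between[OF st(1,2)] st(3,4) by auto
  note k = degenerate_simplices[OF \<kappa>]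
  note ob = simplex_ob[OF X]
  have "edge X \<sigma> \<tau> = cmp C (fob X \<sigma>) (fob X \<kappa>) (fob X \<tau>) (edge X \<kappa> \<tau>) (edge X \<sigma> \<kappa>)"
    using edge_cmp[OF X] st k le by simp
  also have "edge X \<sigma> \<kappa> = zero_mor C (fob X \<sigma>) (fob X \<kappa>)"
    using \<kappa> k st le by (intro to_zero_object zero ob edge_closed[OF X])
  finally show ?thesis
    using st k le by (simp add: cmp_zero_right ob edge_closed[OF X])
qed

text \<open>For a point \<open>x\<close> of a box, \<open>\<epsilon>\<close> sends \<open>gamma m x\<close> to the projective cover and \<open>cone_point m n x\<close> to the
  injective hull of the simple module at \<open>x\<close>.\<close>

definition cone_point :: "nat \<Rightarrow> nat \<Rightarrow> simplex \<Rightarrow> simplex" where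
  "cone_point m n x = (\<lambda>i\<in>{..m}. if i < m then x i else n)"

lemma gamma_apply: "i \<le> m \<Longrightarrow> gamma m x i = (if i = 0 then 0 else x (i - 1) + 1)"
  by (simp add: gamma_def)

lemma box_chain:
  assumes "\<sigma> \<in> simplices m n" "x \<in> box m \<sigma>"
  shows "Suc i < m \<Longrightarrow> x i < x (Suc i)" "i < m \<Longrightarrow> x i < n"
proof -
  show "x i < x (Suc i)" if "Suc i < m"
    using box_less[OF assms(2), of i] box_ge[OF assms(2), of "Suc i"] that by simp
  show "x i < n" if "i < m"
    using box_less[OF assms(2), of i] simplices_le[OF assms(1), of "Suc i"] that by simp
qed

lemma gamma_box_simplices:
  assumes "\<sigma> \<in> simplices m n" "x \<in> box m \<sigma>"
  shows "gamma m x \<in> simplices m n"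
proof (rule simplicesI)
  show "gamma m x \<in> extensional {..m}" by (simp add: gamma_def)
  show "gamma m x i \<le> gamma m x (Suc i)" if "i < m" for i
    using box_chain(1)[OF assms, of "i - 1"] that by (auto simp: gamma_apply)
  show "gamma m x m \<le> n"
    using box_chain(2)[OF assms, of "m - 1"] by (auto simp: gamma_apply)
qed

lemma cone_point_simplices:
  assumes "\<sigma> \<in> simplices m n" "x \<in> box m \<sigma>"
  shows "cone_point m n x \<in> simplices m n"
proof (rule simplicesI)
  show "cone_point m n x i \<le> cone_point m n x (Suc i)" if "i < m" for i
    using box_chain[OF assms, of i] that by (cases "Suc i = m") (auto simp: cone_point_def)
qed (auto simp: cone_point_def)

lemma interlaced_gamma_iff:
  "interlaced m (gamma m x) \<sigma> \<longleftrightarrow> x \<in> box m \<sigma>"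
proof
  assume *: "interlaced m (gamma m x) \<sigma>"
  have "\<sigma> i \<le> x i \<and> x i < \<sigma> (Suc i)" if "i < m" for i
  proof -
    have "\<sigma> i < gamma m x (Suc i)" "gamma m x (Suc i) \<le> \<sigma> (Suc i)"
      using * that by (auto simp: interlaced_def)
    then show ?thesis using that by (simp add: gamma_apply)
  qed
  then show "x \<in> box m \<sigma>" by (simp add: box_def)
next
  assume x: "x \<in> box m \<sigma>"
  have "gamma m x i \<le> \<sigma> i" if "i \<le> m" for i
    using that box_less[OF x, of "i - 1"] by (cases i) (auto simp: gamma_apply)
  moreover have "\<sigma> i < gamma m x (Suc i)" if "i < m" for i
    using that box_ge[OF x, of i] by (auto simp: gamma_apply)
  ultimately show "interlaced m (gamma m x) \<sigma>" by (simp add: interlaced_def)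
qed

lemma interlaced_cone_point_iff:
  "\<sigma> \<in> simplices m n \<Longrightarrow> interlaced m \<sigma> (cone_point m n x) \<longleftrightarrow> x \<in> box m \<sigma>"
  unfolding interlaced_def box_def cone_point_def
  by (auto simp: simplices_le le_eq_less_or_eq[of _ m])

lemma interlaced_gamma_cone_point:
  "\<lbrakk>\<sigma> \<in> simplices m n; x \<in> box m \<sigma>\<rbrakk> \<Longrightarrow> interlaced m (gamma m x) (cone_point m n x)"
  unfolding interlaced_gamma_iff
  by (auto simp: box_def cone_point_def box_chain[of \<sigma> m n x])

section \<open>Functors with the morphism spaces of the simplex poset\<close>

text \<open>The properties of \<open>\<epsilon>\<close> from which its universality follows.\<close>

locale interlacing_functor = linear_category K A
  for K :: "('k, 'r) ring_scheme" and A :: "('k, 'o, 'a) lcat" +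
  fixes m n :: nat and E :: "(simplex, simplex \<times> simplex, 'o, 'a) func"
  assumes field: "field K" and m_pos: "1 \<le> m"
    and E: "is_functor (Delta m n) A E"
    and hom_multiple: "\<lbrakk>\<sigma> \<in> simplices m n; \<tau> \<in> simplices m n; f \<in> Mor A (fob E \<sigma>) (fob E \<tau>);
        f \<noteq> zero_mor A (fob E \<sigma>) (fob E \<tau>)\<rbrakk>
      \<Longrightarrow> interlaced m \<sigma> \<tau> \<and> (\<exists>c \<in> carrier K. f = c \<odot>\<^bsub>lin A (fob E \<sigma>) (fob E \<tau>)\<^esub> edge E \<sigma> \<tau>)"
    and edge_nonzero: "\<lbrakk>\<sigma> \<in> simplices m n; \<tau> \<in> simplices m n; interlaced m \<sigma> \<tau>\<rbrakk>
      \<Longrightarrow> edge E \<sigma> \<tau> \<noteq> zero_mor A (fob E \<sigma>) (fob E \<tau>)"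
    and faces_exact: "\<zeta> \<in> nondegenerate (Suc m) n \<Longrightarrow> exact_sequence A (Suc m)
      (\<lambda>i. fob E (face m \<zeta> i)) (\<lambda>i. edge E (face m \<zeta> (Suc i)) (face m \<zeta> i))"
begin

lemmas E_ob = simplex_ob[OF E]
lemmas E_edge = edge_closed[OF E]

lemma E_degenerate: assumes "\<sigma> \<in> degenerate m n" shows "zero_object A (fob E \<sigma>)"
proof (rule zero_objectI)
  have s: "\<sigma> \<in> simplices m n" "\<not> interlaced m \<sigma> \<sigma>"
    using assms by (auto simp: degenerate_def interlaced_refl_iff[of _ m n])
  then show "fob E \<sigma> \<in> Ob A" by (simp add: E_ob)
  show "idm A (fob E \<sigma>) = zero_mor A (fob E \<sigma>) (fob E \<sigma>)"
    using hom_multiple[of \<sigma> \<sigma> "idm A (fob E \<sigma>)"] s by (auto simp: idm_closed E_ob)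
qed

lemma E_in_S_cat: "E \<in> Ob (S_cat m n A)"
  by (simp add: S_cat_def E E_degenerate faces_exact)

text \<open>\<open>E\<close> may identify degenerate simplices, all of which go to zero objects, but no others: equal objects
  share a nonzero identity, so their simplices interlace in both directions.\<close>

lemma E_eq_cases:
  assumes s: "\<sigma> \<in> simplices m n" and t: "\<tau> \<in> simplices m n" and eq: "fob E \<sigma> = fob E \<tau>"
  shows "\<sigma> = \<tau> \<or> \<sigma> \<in> degenerate m n \<and> \<tau> \<in> degenerate m n"
proof (cases "zero_object A (fob E \<sigma>)")
  case True
  have "\<rho> \<in> degenerate m n" if r: "\<rho> \<in> simplices m n" "zero_object A (fob E \<rho>)" for \<rho>
  proof (rule ccontr)
    assume "\<rho> \<notin> degenerate m n"
    then have "interlaced m \<rho> \<rho>" using r by (simp add: interlaced_refl_iff degenerate_def)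
    from edge_nonzero[OF r(1) r(1) this] show False
      using from_zero_object[OF r(2)] E_ob[OF r(1)] idm_closed by (simp add: edge_refl[OF E r(1)])
  qed
  with True s t eq show ?thesis by simp
next
  case False
  then have "idm A (fob E \<sigma>) \<noteq> zero_mor A (fob E \<sigma>) (fob E \<sigma>)"
    using zero_objectI E_ob[OF s] by blast
  then have "interlaced m \<sigma> \<tau>" "interlaced m \<tau> \<sigma>"
    using hom_multiple[OF s t, of "idm A (fob E \<sigma>)"] hom_multiple[OF t s, of "idm A (fob E \<sigma>)"]
      idm_closed E_ob[OF s] by (simp_all add: eq)
  then show ?thesis using interlaced_antisym s t by blast
qed

text \<open>At a point \<open>x\<close> of the box of \<open>\<sigma>\<close>, the canonical morphisms from the projective and to the
  injective object at \<open>x\<close> test whether a morphism vanishes at \<open>x\<close>.\<close>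

lemma exact_sequence_box_exact:
  assumes s: "\<And>i. i \<le> Suc m \<Longrightarrow> s i \<in> simplices m n"
    and ex: "exact_sequence A (Suc m) (\<lambda>i. fob E (s i)) f"
  shows "box_exact m (Suc m) s (\<lambda>i. f i \<noteq> zero_mor A (fob E (s (Suc i))) (fob E (s i)))"
  unfolding box_exact_def
proof (intro allI ballI impI)
  fix i x assume i: "i \<le> Suc m" and x: "x \<in> box m (s i)"
  let ?nz = "\<lambda>i. f i \<noteq> zero_mor A (fob E (s (Suc i))) (fob E (s i))"
  let ?Y = "fob E (s i)"
  obtain z where z: "zero_object A z"
    and f: "\<And>i. i \<le> m \<Longrightarrow> f i \<in> Mor A (fob E (s (Suc i))) (fob E (s i))"
    and exi: "exact_at A (if i < Suc m then fob E (s (Suc i)) else z) ?Y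
        (if 0 < i then fob E (s (i - 1)) else z)
        (if i < Suc m then f i else zero_mor A z ?Y)
        (if 0 < i then f (i - 1) else zero_mor A ?Y z)"
    using ex i unfolding exact_sequence_iff[OF zero_less_Suc] by (auto simp: less_Suc_eq_le)
  note si = s[OF i]
  note z_ob = zero_object_Ob[OF z]
  define p where "p = gamma m x"
  define q where "q = cone_point m n x"
  have p: "p \<in> simplices m n" and q: "q \<in> simplices m n"
    unfolding p_def q_def using gamma_box_simplices cone_point_simplices si x by blast+
  have ilp: "interlaced m p \<sigma> \<longleftrightarrow> x \<in> box m \<sigma>" for \<sigma>
    by (simp add: p_def interlaced_gamma_iff)
  have ilq: "interlaced m \<sigma> q \<longleftrightarrow> x \<in> box m \<sigma>" if "\<sigma> \<in> simplices m n" for \<sigma>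
    using that by (simp add: q_def interlaced_cone_point_iff)
  have ilpq: "interlaced m p q"
    unfolding p_def q_def using interlaced_gamma_cone_point si x by blast
  have le: "\<forall>i\<le>m. p i \<le> s i' i" "\<forall>i\<le>m. s i' i \<le> q i" if "x \<in> box m (s i')" "i' \<le> Suc m" for i'
    using that ilp ilq s interlaced_le by blast+
  have w: "edge E p (s i) \<in> Mor A (fob E p) ?Y" and t: "edge E (s i) q \<in> Mor A ?Y (fob E q)"
    using E_edge p q si le x i by auto
  have tw: "cmp A (fob E p) ?Y (fob E q) (edge E (s i) q) (edge E p (s i)) = edge E p q"
    using edge_cmp[OF E p si q] le x i by simp
  have left_zero: "cmp A (fob E (s (Suc i))) ?Y (fob E q) (edge E (s i) q) (f i)
      = zero_mor A (fob E (s (Suc i))) (fob E q)"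
    if "\<not> (?nz i \<and> x \<in> box m (s (Suc i)))" "i \<le> m"
  proof (cases "?nz i")
    case True
    then show ?thesis
      using that hom_multiple[of "s (Suc i)" q] ilq[of "s (Suc i)"] s q f t si
      by (metis E_ob Suc_le_mono cmp_closed i)
  next
    case False
    then show ?thesis using that s[of "Suc i"] s[of i] q t by (simp add: cmp_zero_right E_ob)
  qed
  have right_zero: "cmp A (fob E p) ?Y (fob E (s (i - 1))) (f (i - 1)) (edge E p (s i))
      = zero_mor A (fob E p) (fob E (s (i - 1)))"
    if "\<not> (?nz (i - 1) \<and> x \<in> box m (s (i - 1)))" "0 < i"
  proof (cases "?nz (i - 1)")
    case True
    have "f (i - 1) \<in> Mor A ?Y (fob E (s (i - 1)))" using f[of "i - 1"] that i by simp
    then show ?thesis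
      using that True hom_multiple[of p "s (i - 1)"] ilp[of "s (i - 1)"] s[of "i - 1"] i p w si
      by (meson E_ob cmp_closed diff_le_self order_trans)
  next
    case False
    then show ?thesis using that s[of "i - 1"] i p w si by (simp add: cmp_zero_left E_ob)
  qed
  have not_both: False if "i \<le> m" "?nz i" "x \<in> box m (s (Suc i))"
    "0 < i" "?nz (i - 1)" "x \<in> box m (s (i - 1))"
  proof -
    note nb = that
    let ?L = "s (Suc i)" and ?R = "s (i - 1)"
    have LR: "?L \<in> simplices m n" "?R \<in> simplices m n" using s i that by auto
    have fL: "f i \<in> Mor A (fob E ?L) ?Y" and fR: "f (i - 1) \<in> Mor A ?Y (fob E ?R)"
      using f[of i] f[of "i - 1"] that by auto
    obtain c where c: "c \<in> carrier K" "f i = c \<odot>\<^bsub>lin A (fob E ?L) ?Y\<^esub> edge E ?L (s i)"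
      and ilL: "interlaced m ?L (s i)"
      using hom_multiple[OF LR(1) si fL] nb by blast
    obtain d where d: "d \<in> carrier K" "f (i - 1) = d \<odot>\<^bsub>lin A ?Y (fob E ?R)\<^esub> edge E (s i) ?R"
      and ilR: "interlaced m (s i) ?R"
      using hom_multiple[OF si LR(2) fR] nb by auto
    have leLR: "\<forall>i\<le>m. ?L i \<le> ?R i" using ilL ilR by (auto simp: interlaced_def intro: le_trans)
    have "?R j < ?L (Suc j)" if "j < m" for j
      using box_ge[OF \<open>x \<in> box m ?R\<close> that] box_less[OF \<open>x \<in> box m ?L\<close> that] by simp
    with leLR have ilLR: "interlaced m ?L ?R" by (simp add: interlaced_def)
    note eL = E_edge[OF LR(1) si interlaced_le[OF ilL]]
    note eR = E_edge[OF si LR(2) interlaced_le[OF ilR]]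
    note eLR = E_edge[OF LR leLR]
    have "cmp A (fob E ?L) ?Y (fob E ?R) (f (i - 1)) (f i)
        = c \<odot>\<^bsub>lin A (fob E ?L) (fob E ?R)\<^esub> (d \<odot>\<^bsub>lin A (fob E ?L) (fob E ?R)\<^esub> edge E ?L ?R)"
      using eL eR LR si c d edge_cmp[OF E LR(1) si LR(2)] interlaced_le[OF ilL] interlaced_le[OF ilR]
      by (simp add: cmp_smult_left cmp_smult_right E_ob cmp_closed smult_mor_closed)
    moreover have "cmp A (fob E ?L) ?Y (fob E ?R) (f (i - 1)) (f i) = zero_mor A (fob E ?L) (fob E ?R)"
      using exact_at_cmp_zero[OF _ _ _ exi] that LR si by (simp add: E_ob)
    ultimately have "c = \<zero>\<^bsub>K\<^esub> \<or> d = \<zero>\<^bsub>K\<^esub>"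
      using edge_nonzero[OF LR ilLR] LR c d eLR field
      by (simp add: smult_mor_eq_zero_iff E_ob smult_mor_closed)
    then show False
      using that c d eL eR LR si by (auto simp: zero_smult_mor E_ob)
  qed
  have not_none: False
    if L: "\<not> (i \<le> m \<and> ?nz i \<and> x \<in> box m (s (Suc i)))"
      and R: "\<not> (0 < i \<and> ?nz (i - 1) \<and> x \<in> box m (s (i - 1)))"
  proof -
    have "cmp A (fob E p) ?Y (fob E q) (edge E (s i) q) (edge E p (s i)) = zero_mor A (fob E p)
        (fob E q)"
    proof (rule exact_at_cmp_zero_across[OF _ _ _ _ _ exi])
      show "cmp A (fob E p) ?Y (if 0 < i then fob E (s (i - 1)) else z)
          (if 0 < i then f (i - 1) else zero_mor A ?Y z) (edge E p (s i))
        = zero_mor A (fob E p) (if 0 < i then fob E (s (i - 1)) else z)"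
        using R right_zero w p si z_ob by (auto simp: cmp_zero_left E_ob)
      show "cmp A (if i < Suc m then fob E (s (Suc i)) else z) ?Y (fob E q) (edge E (s i) q)
          (if i < Suc m then f i else zero_mor A z ?Y)
        = zero_mor A (if i < Suc m then fob E (s (Suc i)) else z) (fob E q)"
        using L left_zero t q si z_ob by (auto simp: cmp_zero_right E_ob less_Suc_eq_le)
    qed (use w t p q si z_ob s i in \<open>auto simp: E_ob\<close>)
    with edge_nonzero[OF p q ilpq] show False by (simp add: tw)
  qed
  show "(i < Suc m \<and> ?nz i \<and> x \<in> box m (s (Suc i))) \<noteq> (0 < i \<and> ?nz (i - 1) \<and> x \<in> box m (s (i - 1)))"
    using not_both not_none by (auto simp: less_Suc_eq_le)
qed

end


section \<open>Universality\<close>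

context interlacing_functor
begin

abbreviation image_cat :: "('k, 'o, 'a) lcat" where
  "image_cat \<equiv> full_subcat A (fob E ` simplices m n)"

lemma hom_cases:
  assumes "\<sigma> \<in> simplices m n" "\<tau> \<in> simplices m n" "f \<in> Mor A (fob E \<sigma>) (fob E \<tau>)"
  obtains (zero) "f = zero_mor A (fob E \<sigma>) (fob E \<tau>)"
    | (multiple) c where "interlaced m \<sigma> \<tau>" "c \<in> carrier K" "c \<noteq> \<zero>\<^bsub>K\<^esub>"
      "f = c \<odot>\<^bsub>lin A (fob E \<sigma>) (fob E \<tau>)\<^esub> edge E \<sigma> \<tau>"
proof (cases "f = zero_mor A (fob E \<sigma>) (fob E \<tau>)")
  case False
  then obtain c where c: "interlaced m \<sigma> \<tau>" "c \<in> carrier K"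
      "f = c \<odot>\<^bsub>lin A (fob E \<sigma>) (fob E \<tau>)\<^esub> edge E \<sigma> \<tau>"
    using hom_multiple assms by blast
  moreover have "c \<noteq> \<zero>\<^bsub>K\<^esub>"
    using c False assms zero_smult_mor[OF E_ob E_ob E_edge] interlaced_le by blast
  ultimately show ?thesis using multiple by blast
qed (rule zero)

lemma edge_smult_inj:
  assumes st: "\<sigma> \<in> simplices m n" "\<tau> \<in> simplices m n" "interlaced m \<sigma> \<tau>"
    and c: "c \<in> carrier K" and d: "d \<in> carrier K"
    and eq: "c \<odot>\<^bsub>lin A (fob E \<sigma>) (fob E \<tau>)\<^esub> edge E \<sigma> \<tau> = d \<odot>\<^bsub>lin A (fob E \<sigma>) (fob E \<tau>)\<^esub> edge E \<sigma> \<tau>"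
  shows "c = d"
proof -
  let ?V = "lin A (fob E \<sigma>) (fob E \<tau>)"
  interpret K: field K by (rule field)
  interpret V: module K ?V using st by (intro lin_module E_ob)
  have e: "edge E \<sigma> \<tau> \<in> carrier ?V"
    using st by (simp add: lin_carrier E_ob E_edge interlaced_le)
  have "(c \<ominus>\<^bsub>K\<^esub> d) \<odot>\<^bsub>?V\<^esub> edge E \<sigma> \<tau> = \<zero>\<^bsub>?V\<^esub>"
    using c d e by (simp add: a_minus_def V.smult_l_distr V.smult_l_minus eq V.r_neg)
  then have "c \<ominus>\<^bsub>K\<^esub> d = \<zero>\<^bsub>K\<^esub>"
    using smult_eq_zero_iff[OF field V.module_axioms _ e, of "c \<ominus>\<^bsub>K\<^esub> d"] c d
      edge_nonzero[OF st] by simp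
  then have "\<ominus>\<^bsub>K\<^esub> (\<ominus>\<^bsub>K\<^esub> d) = c"
    using c d by (intro K.minus_equality) (simp_all add: a_minus_def)
  then show ?thesis using d by simp
qed

end

locale interlacing_extension =
  interlacing_functor K A m n E + B: abelian_linear_category K B
  for K :: "('k, 'r) ring_scheme" and A :: "('k, 'o, 'a) lcat" and m n E
    and B :: "('k, 'p, 'b) lcat" +
  fixes X :: "(simplex, simplex \<times> simplex, 'p, 'b) func"
  assumes X: "is_functor (Delta m n) B X"
    and X_degenerate: "\<kappa> \<in> degenerate m n \<Longrightarrow> zero_object B (fob X \<kappa>)"
    and X_faces: "\<zeta> \<in> nondegenerate (Suc m) n \<Longrightarrow> exact_sequence B (Suc m)
      (\<lambda>i. fob X (face m \<zeta> i)) (\<lambda>i. edge X (face m \<zeta> (Suc i)) (face m \<zeta> i))"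
begin

lemmas X_ob = simplex_ob[OF X]
lemmas X_edge = edge_closed[OF X]

text \<open>The linear extension of \<open>edge E \<sigma> \<tau> \<mapsto> edge X \<sigma> \<tau>\<close>. The case distinction keeps it well defined when
  \<open>edge E \<sigma> \<tau>\<close> is zero or does not exist, where the coefficient is not unique.\<close>

definition lift :: "simplex \<Rightarrow> simplex \<Rightarrow> 'a \<Rightarrow> 'b" where
  "lift \<sigma> \<tau> f = (if f = zero_mor A (fob E \<sigma>) (fob E \<tau>) then zero_mor B (fob X \<sigma>) (fob X \<tau>)
    else (THE c. c \<in> carrier K \<and> f = c \<odot>\<^bsub>lin A (fob E \<sigma>) (fob E \<tau>)\<^esub> edge E \<sigma> \<tau>)
      \<odot>\<^bsub>lin B (fob X \<sigma>) (fob X \<tau>)\<^esub> edge X \<sigma> \<tau>)"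

lemma lift_zero: "lift \<sigma> \<tau> (zero_mor A (fob E \<sigma>) (fob E \<tau>)) = zero_mor B (fob X \<sigma>) (fob X \<tau>)"
  by (simp add: lift_def)

text \<open>Outside the interlacing case both edges vanish, so the formula holds for all \<open>\<sigma> \<le> \<tau>\<close>.\<close>

lemma lift_smult:
  assumes st: "\<sigma> \<in> simplices m n" "\<tau> \<in> simplices m n" "\<forall>i\<le>m. \<sigma> i \<le> \<tau> i" and c: "c \<in> carrier K"
  shows "lift \<sigma> \<tau> (c \<odot>\<^bsub>lin A (fob E \<sigma>) (fob E \<tau>)\<^esub> edge E \<sigma> \<tau>)
    = c \<odot>\<^bsub>lin B (fob X \<sigma>) (fob X \<tau>)\<^esub> edge X \<sigma> \<tau>"
proof (cases "interlaced m \<sigma> \<tau>")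
  case False
  then have "edge X \<sigma> \<tau> = zero_mor B (fob X \<sigma>) (fob X \<tau>)"
    using B.edge_eq_zero[OF X X_degenerate st] by simp
  moreover have "edge E \<sigma> \<tau> = zero_mor A (fob E \<sigma>) (fob E \<tau>)"
    using False edge_eq_zero[OF E E_degenerate st] by simp
  ultimately show ?thesis
    using st c by (simp add: lift_zero smult_zero_mor B.smult_zero_mor E_ob X_ob)
next
  case True
  show ?thesis
  proof (cases "c = \<zero>\<^bsub>K\<^esub>")
    case True
    then show ?thesis
      using st by (simp add: zero_smult_mor B.zero_smult_mor E_ob X_ob E_edge X_edge lift_zero)
  next
    case False
    then have "c \<odot>\<^bsub>lin A (fob E \<sigma>) (fob E \<tau>)\<^esub> edge E \<sigma> \<tau> \<noteq> zero_mor A (fob E \<sigma>) (fob E \<tau>)"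
      using st c edge_nonzero[OF st(1,2) True] by (simp add: smult_mor_eq_zero_iff field E_ob E_edge)
    moreover have "(THE c'. c' \<in> carrier K \<and> c \<odot>\<^bsub>lin A (fob E \<sigma>) (fob E \<tau>)\<^esub> edge E \<sigma> \<tau>
        = c' \<odot>\<^bsub>lin A (fob E \<sigma>) (fob E \<tau>)\<^esub> edge E \<sigma> \<tau>) = c"
      using c edge_smult_inj[OF st(1,2) True] by (intro the_equality) auto
    ultimately show ?thesis by (simp add: lift_def)
  qed
qed

lemma lift_edge:
  assumes "\<sigma> \<in> simplices m n" "\<tau> \<in> simplices m n" "\<forall>i\<le>m. \<sigma> i \<le> \<tau> i"
  shows "lift \<sigma> \<tau> (edge E \<sigma> \<tau>) = edge X \<sigma> \<tau>"
proof -
  interpret K: field K by (rule field)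
  show ?thesis
    using lift_smult[OF assms K.one_closed] assms
    by (simp add: one_smult_mor B.one_smult_mor E_ob X_ob E_edge X_edge)
qed

lemma lift_closed:
  assumes "\<sigma> \<in> simplices m n" "\<tau> \<in> simplices m n" "f \<in> Mor A (fob E \<sigma>) (fob E \<tau>)"
  shows "lift \<sigma> \<tau> f \<in> Mor B (fob X \<sigma>) (fob X \<tau>)"
  using assms
proof (cases rule: hom_cases)
  case zero
  then show ?thesis using assms by (simp add: lift_zero B.zero_mor_closed X_ob)
next
  case (multiple c)
  then show ?thesis
    using assms by (simp add: lift_smult interlaced_le B.smult_mor_closed X_ob X_edge)
qed

lemma lift_cmp:
  assumes \<rho>: "\<rho> \<in> simplices m n" and \<sigma>: "\<sigma> \<in> simplices m n" and \<tau>: "\<tau> \<in> simplices m n"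
    and f: "f \<in> Mor A (fob E \<rho>) (fob E \<sigma>)" and g: "g \<in> Mor A (fob E \<sigma>) (fob E \<tau>)"
  shows "lift \<rho> \<tau> (cmp A (fob E \<rho>) (fob E \<sigma>) (fob E \<tau>) g f)
    = cmp B (fob X \<rho>) (fob X \<sigma>) (fob X \<tau>) (lift \<sigma> \<tau> g) (lift \<rho> \<sigma> f)"
  using \<rho> \<sigma> f
proof (cases rule: hom_cases)
  case zero
  then show ?thesis
    using \<rho> \<sigma> \<tau> g by (simp add: lift_zero cmp_zero_right B.cmp_zero_right E_ob X_ob lift_closed)
next
  case f: (multiple c)
  from \<sigma> \<tau> g show ?thesis
  proof (cases rule: hom_cases)
    case zero
    then show ?thesis
      using \<rho> \<sigma> \<tau> assms(4)
      by (simp add: lift_zero cmp_zero_left B.cmp_zero_left E_ob X_ob lift_closed)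
  next
    case g: (multiple d)
    interpret K: field K by (rule field)
    note le = interlaced_le[OF f(1)] interlaced_le[OF g(1)]
    have le': "\<forall>i\<le>m. \<rho> i \<le> \<tau> i" using le by (auto intro: le_trans)
    have "cmp A (fob E \<rho>) (fob E \<sigma>) (fob E \<tau>) g f
        = (c \<otimes>\<^bsub>K\<^esub> d) \<odot>\<^bsub>lin A (fob E \<rho>) (fob E \<tau>)\<^esub> edge E \<rho> \<tau>"
      using \<rho> \<sigma> \<tau> f g le le' edge_cmp[OF E \<rho> \<sigma> \<tau> le]
      by (simp add: cmp_smult_left cmp_smult_right E_ob E_edge smult_mor_closed smult_smult_mor)
    moreover have "cmp B (fob X \<rho>) (fob X \<sigma>) (fob X \<tau>) (lift \<sigma> \<tau> g) (lift \<rho> \<sigma> f)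
        = (c \<otimes>\<^bsub>K\<^esub> d) \<odot>\<^bsub>lin B (fob X \<rho>) (fob X \<tau>)\<^esub> edge X \<rho> \<tau>"
      using \<rho> \<sigma> \<tau> f g le le' edge_cmp[OF X \<rho> \<sigma> \<tau> le]
      by (simp add: lift_smult B.cmp_smult_left B.cmp_smult_right X_ob X_edge
          B.smult_mor_closed B.smult_smult_mor)
    ultimately show ?thesis
      using \<rho> \<tau> le' f g by (simp add: lift_smult)
  qed
qed

lemma lift_linear:
  assumes st: "\<sigma> \<in> simplices m n" "\<tau> \<in> simplices m n"
  shows "linear_map K (lin A (fob E \<sigma>) (fob E \<tau>)) (lin B (fob X \<sigma>) (fob X \<tau>)) (lift \<sigma> \<tau>)"
proof -
  let ?V = "lin A (fob E \<sigma>) (fob E \<tau>)" and ?W = "lin B (fob X \<sigma>) (fob X \<tau>)"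
  interpret K: field K by (rule field)
  interpret V: module K ?V using st by (intro lin_module E_ob)
  interpret W: module K ?W using st by (intro B.lin_module X_ob)
  have V: "carrier ?V = Mor A (fob E \<sigma>) (fob E \<tau>)" and W: "carrier ?W = Mor B (fob X \<sigma>) (fob X \<tau>)"
    using st by (simp_all add: lin_carrier B.lin_carrier E_ob X_ob)
  show ?thesis
  proof (cases "interlaced m \<sigma> \<tau>")
    case True
    note le = interlaced_le[OF True]
    have e: "edge E \<sigma> \<tau> \<in> carrier ?V" "edge X \<sigma> \<tau> \<in> carrier ?W"
      using st le by (simp_all add: V W E_edge X_edge)
    have multiple: "\<exists>c \<in> carrier K. f = c \<odot>\<^bsub>?V\<^esub> edge E \<sigma> \<tau>" if "f \<in> carrier ?V" for f
      using st that[unfolded V]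
    proof (cases rule: hom_cases)
      case zero
      then show ?thesis using e by (intro bexI[of _ "\<zero>\<^bsub>K\<^esub>"]) (simp_all add: V.smult_l_null)
    qed auto
    show ?thesis
      unfolding linear_map_def
    proof (intro conjI ballI funcsetI)
      fix f g assume "f \<in> carrier ?V" "g \<in> carrier ?V"
      then obtain c d where cd: "c \<in> carrier K" "d \<in> carrier K"
        "f = c \<odot>\<^bsub>?V\<^esub> edge E \<sigma> \<tau>" "g = d \<odot>\<^bsub>?V\<^esub> edge E \<sigma> \<tau>" using multiple by metis
      then have "f \<oplus>\<^bsub>?V\<^esub> g = (c \<oplus>\<^bsub>K\<^esub> d) \<odot>\<^bsub>?V\<^esub> edge E \<sigma> \<tau>"
        using e by (simp add: V.smult_l_distr)
      then show "lift \<sigma> \<tau> (f \<oplus>\<^bsub>?V\<^esub> g) = lift \<sigma> \<tau> f \<oplus>\<^bsub>?W\<^esub> lift \<sigma> \<tau> g"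
        using cd st le e by (simp add: lift_smult W.smult_l_distr)
    next
      fix a f assume a: "a \<in> carrier K" and "f \<in> carrier ?V"
      then obtain c where c: "c \<in> carrier K" "f = c \<odot>\<^bsub>?V\<^esub> edge E \<sigma> \<tau>" using multiple by metis
      then have "a \<odot>\<^bsub>?V\<^esub> f = (a \<otimes>\<^bsub>K\<^esub> c) \<odot>\<^bsub>?V\<^esub> edge E \<sigma> \<tau>"
        using e a by (simp add: V.smult_assoc1)
      then show "lift \<sigma> \<tau> (a \<odot>\<^bsub>?V\<^esub> f) = a \<odot>\<^bsub>?W\<^esub> lift \<sigma> \<tau> f"
        using c a st le e by (simp add: lift_smult W.smult_assoc1)
    qed (use st in \<open>simp add: V W lift_closed\<close>)
  next
    case False
    then have "f = \<zero>\<^bsub>?V\<^esub>" if "f \<in> carrier ?V" for f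
      using hom_multiple[OF st that[unfolded V]] by blast
    then have "lift \<sigma> \<tau> f = \<zero>\<^bsub>?W\<^esub>" if "f \<in> carrier ?V" for f
      using that lift_zero by metis
    then show ?thesis
      unfolding linear_map_def by (auto simp: W.smult_r_null)
  qed
qed

definition rep :: "'o \<Rightarrow> simplex" where
  "rep M = (SOME \<sigma>. \<sigma> \<in> simplices m n \<and> fob E \<sigma> = M)"

lemma rep:
  assumes "M \<in> fob E ` simplices m n"
  shows "rep M \<in> simplices m n" "fob E (rep M) = M"
proof -
  have "rep M \<in> simplices m n \<and> fob E (rep M) = M"
    unfolding rep_def using assms someI_ex[of "\<lambda>\<sigma>. \<sigma> \<in> simplices m n \<and> fob E \<sigma> = M"] by blast
  then show "rep M \<in> simplices m n" "fob E (rep M) = M" by auto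
qed

lemma rep_E:
  assumes "\<sigma> \<in> simplices m n"
  shows "rep (fob E \<sigma>) = \<sigma> \<or> \<sigma> \<in> degenerate m n \<and> rep (fob E \<sigma>) \<in> degenerate m n"
  using E_eq_cases[OF rep(1) assms] rep(2) assms by blast

definition extension :: "('o, 'a, 'p, 'b) func" where
  "extension = mk_func image_cat (\<lambda>M. fob X (rep M)) (\<lambda>M N. lift (rep M) (rep N))"

lemma extension_functor: "is_functor image_cat B extension"
  unfolding extension_def
proof (rule is_functor_mk_func)
  show "category image_cat" by (intro category_full_subcat category_axioms)
  fix M assume "M \<in> Ob image_cat"
  then have M: "rep M \<in> simplices m n" "fob E (rep M) = M" using rep by auto
  then show "lift (rep M) (rep M) (idm image_cat M) = idm B (fob X (rep M))"
    using lift_edge[OF M(1) M(1)] by (simp add: edge_refl[OF E] edge_refl[OF X])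
next
  fix M N P f g
  assume "M \<in> Ob image_cat" "N \<in> Ob image_cat" "P \<in> Ob image_cat"
    and fg: "f \<in> Mor image_cat M N" "g \<in> Mor image_cat N P"
  then have *: "rep M \<in> simplices m n" "fob E (rep M) = M" "rep N \<in> simplices m n"
    "fob E (rep N) = N" "rep P \<in> simplices m n" "fob E (rep P) = P" using rep by auto
  show "lift (rep M) (rep P) (cmp image_cat M N P g f)
    = cmp B (fob X (rep M)) (fob X (rep N)) (fob X (rep P)) (lift (rep N) (rep P) g) (lift (rep M)
        (rep N) f)"
    using lift_cmp[OF *(1,3,5), of f g] fg by (simp add: *(2,4,6))
next
  fix M N f assume "M \<in> Ob image_cat" "N \<in> Ob image_cat" and f: "f \<in> Mor image_cat M N"
  then have *: "rep M \<in> simplices m n" "fob E (rep M) = M" "rep N \<in> simplices m n"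
    "fob E (rep N) = N" using rep by auto
  show "lift (rep M) (rep N) f \<in> Mor B (fob X (rep M)) (fob X (rep N))"
    using lift_closed[OF *(1,3), of f] f by (simp add: *(2,4))
next
  fix M assume "M \<in> Ob image_cat"
  then have M: "M \<in> fob E ` simplices m n" unfolding full_subcat_simps by (rule IntD2)
  show "fob X (rep M) \<in> Ob B" by (rule X_ob[OF rep(1)[OF M]])
qed

lemma extension_linear: "is_linear_functor K image_cat B extension"
  unfolding is_linear_functor_def
proof (rule conjI[OF extension_functor], intro ballI)
  fix M N assume MN: "M \<in> Ob image_cat" "N \<in> Ob image_cat"
  then have *: "rep M \<in> simplices m n" "fob E (rep M) = M" "rep N \<in> simplices m n"
    "fob E (rep N) = N"
    using rep[of M] rep[of N] by simp_all
  have V: "carrier (lin A M N) = Mor A M N" using MN by (simp add: lin_carrier)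
  interpret V: module K "lin A M N" using MN by (intro lin_module) auto
  have "linear_map K (lin A M N) (lin B (fob X (rep M)) (fob X (rep N))) (lift (rep M) (rep N))"
    using lift_linear[OF *(1,3)] by (simp add: *(2,4))
  moreover have "farr extension M N f = lift (rep M) (rep N) f" if "f \<in> carrier (lin A M N)" for f
    using that MN by (simp add: extension_def V)
  ultimately show "linear_map K (lin image_cat M N) (lin B (fob extension M) (fob extension N))
      (farr extension M N)"
    using MN unfolding linear_map_def by (simp add: extension_def Pi_iff)
qed

text \<open>By the classification of exact sequences of boxes, an exact sequence in the image either comes
  from the faces of a simplex, up to nonzero scalars, or is made of zero objects and of pairs of
  neighbouring terms joined by a multiple of an identity. The former are preserved because \<open>X\<close> is
  exact on faces, and the latter because a multiple of an identity by a nonzero scalar is both monic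
  and epic.\<close>

lemma extension_exact:
  assumes Y: "\<And>i. i \<le> Suc m \<Longrightarrow> Y i \<in> fob E ` simplices m n"
    and ex: "exact_sequence A (Suc m) Y f"
  shows "exact_sequence B (Suc m) (\<lambda>i. fob extension (Y i)) (\<lambda>i. farr extension (Y (Suc i)) (Y i)
      (f i))"
proof -
  interpret K: field K by (rule field)
  define s where "s i = rep (Y i)" for i
  have s: "s i \<in> simplices m n" and Es: "fob E (s i) = Y i" if "i \<le> Suc m" for i
    using rep[OF Y[OF that]] by (simp_all add: s_def)
  have f: "f i \<in> Mor A (fob E (s (Suc i))) (fob E (s i))" if "i \<le> m" for i
    using ex that by (simp add: exact_sequence_def Es)
  let ?e = "\<lambda>i. f i \<noteq> zero_mor A (fob E (s (Suc i))) (fob E (s i))"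
  have "exact_sequence A (Suc m) (\<lambda>i. fob E (s i)) f"
    using ex exact_sequence_cong[of "Suc m" "\<lambda>i. fob E (s i)" Y f f] by (simp add: Es)
  then have box: "box_exact m (Suc m) s ?e"
    using exact_sequence_box_exact[of s f] s by blast
  have scalar: "\<exists>c. c \<in> carrier K \<and> c \<noteq> \<zero>\<^bsub>K\<^esub> \<and> interlaced m (s (Suc i)) (s i) \<and>
      f i = c \<odot>\<^bsub>lin A (fob E (s (Suc i))) (fob E (s i))\<^esub> edge E (s (Suc i)) (s i)"
    if "i \<le> m" "?e i" for i
    using s[of "Suc i"] s[of i] f[OF that(1)] that by (cases rule: hom_cases) auto
  define c where "c i = (SOME c. c \<in> carrier K \<and> c \<noteq> \<zero>\<^bsub>K\<^esub> \<and> interlaced m (s (Suc i)) (s i) \<and>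
      f i = c \<odot>\<^bsub>lin A (fob E (s (Suc i))) (fob E (s i))\<^esub> edge E (s (Suc i)) (s i))" for i
  have c: "c i \<in> carrier K" "c i \<noteq> \<zero>\<^bsub>K\<^esub>" "interlaced m (s (Suc i)) (s i)"
    "f i = c i \<odot>\<^bsub>lin A (fob E (s (Suc i))) (fob E (s i))\<^esub> edge E (s (Suc i)) (s i)"
    if "i \<le> m" "?e i" for i
    using someI_ex[OF scalar[OF that]] unfolding c_def by blast+
  let ?X = "\<lambda>i. fob X (s i)" and ?f = "\<lambda>i. lift (s (Suc i)) (s i) (f i)"
  have X_s: "?X i \<in> Ob B" if "i \<le> Suc m" for i using s[OF that] by (rule X_ob)
  have fB: "?f i \<in> Mor B (?X (Suc i)) (?X i)" if "i \<le> m" for i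
    using that s f by (intro lift_closed) auto
  have fc: "?f i = c i \<odot>\<^bsub>lin B (?X (Suc i)) (?X i)\<^esub> edge X (s (Suc i)) (s i)" if "i \<le> m" "?e i" for i
    using c[OF that] that s by (simp add: lift_smult interlaced_le)
  have "exact_sequence B (Suc m) ?X ?f"
  proof (rule box_exact_cases[OF m_pos _ _ box, of n])
    show "s i \<in> simplices m n" if "i \<le> Suc m" for i using that by (rule s)
    show "interlaced m (s (Suc i)) (s i)" if "i \<le> m" "?e i" for i using that by (rule c(3))
  next
    fix \<zeta>
    assume faces: "\<zeta> \<in> nondegenerate (Suc m) n" "\<And>i. i \<le> Suc m \<Longrightarrow> s i = face m \<zeta> i"
      "\<And>i. i \<le> m \<Longrightarrow> ?e i"
    have "exact_sequence B (Suc m) (\<lambda>i. fob X (face m \<zeta> i))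
      (\<lambda>i. c i \<odot>\<^bsub>lin B (fob X (face m \<zeta> (Suc i))) (fob X (face m \<zeta> i))\<^esub> edge X (face m \<zeta> (Suc i))
          (face m \<zeta> i))" (is ?faces)
      using c faces by (intro B.exact_sequence_smult[OF field _ X_faces]) (auto simp: less_Suc_eq_le)
    moreover have "exact_sequence B (Suc m) ?X ?f \<longleftrightarrow> ?faces"
      using faces fc by (intro B.exact_sequence_cong) (auto simp: less_Suc_eq_le)
    ultimately show ?thesis by simp
  next
    assume identities: "\<And>i. \<lbrakk>i \<le> m; ?e i\<rbrakk> \<Longrightarrow> s (Suc i) = s i"
    obtain z where z: "zero_object B z" using B.has_zero by blast
    note z_ob = B.zero_object_Ob[OF z]
    have ex_at: "exact_at B (if i < Suc m then ?X (Suc i) else z) (?X i) (if 0 < i then ?X (i - 1)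
        else z)
        (if i < Suc m then ?f i else zero_mor B z (?X i))
        (if 0 < i then ?f (i - 1) else zero_mor B (?X i) z)" (is "exact_at B ?L _ ?R ?g ?h")
      if i: "i \<le> Suc m" for i
    proof -
      have L: "?L \<in> Ob B" and R: "?R \<in> Ob B" using X_s i z_ob by auto
      have g: "?g \<in> Mor B ?L (?X i)" using fB i X_s z_ob by (auto simp: B.zero_mor_closed)
      have h: "?h \<in> Mor B (?X i) ?R" using fB[of "i - 1"] i X_s z_ob by (auto simp: B.zero_mor_closed)
      show ?thesis
      proof (cases "s i \<in> degenerate m n")
        case True
        note zi = X_degenerate[OF True]
        have "?g = zero_mor B ?L (?X i)" by (rule B.to_zero_object[OF zi L g])
        moreover have "exact_at B ?L (?X i) ?R (zero_mor B ?L (?X i)) ?h"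
          using L R h X_s[OF i] by (intro B.exact_at_zero_mono[OF _ _ _ z]) (auto intro:
              B.to_zero_object[OF zi])
        ultimately show ?thesis by simp
      next
        case False
        then have nd: "s i \<in> nondegenerate m n" using s[OF i] by (simp add: degenerate_def)
        note si = nondegenerate_in_box[OF nd]
        have one: "(i < Suc m \<and> ?e i \<and> s i \<in> box m (s (Suc i))) \<noteq> (0 < i \<and> ?e (i - 1) \<and> s i \<in> box
            m (s (i - 1)))"
          using box si i unfolding box_exact_def by blast
        have left: "s (Suc i) = s i" if "i < Suc m" "?e i" using identities that by simp
        have right: "s (i - 1) = s i" if "0 < i" "?e (i - 1)" using identities[of "i - 1"] that i
            by simp
        show ?thesis
        proof (cases "i < Suc m \<and> ?e i")
          case True
          have "\<not> (0 < i \<and> ?e (i - 1))"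
          proof
            assume r: "0 < i \<and> ?e (i - 1)"
            have "s i \<in> box m (s (Suc i))" "s i \<in> box m (s (i - 1))"
              using si left right True r by (metis, metis)
            with one True r show False by blast
          qed
          then have h0: "?h = zero_mor B (?X i) ?R"
            using lift_zero[of "s (Suc (i - 1))" "s (i - 1)"] by auto
          have ge: "?g = c i \<odot>\<^bsub>lin B (?X i) (?X i)\<^esub> idm B (?X i)"
            using True left fc[of i] s[OF i] by (simp add: edge_refl[OF X])
          have Le: "?L = ?X i" using True left by simp
          have "exact_at B ?L (?X i) ?R ?g (zero_mor B (?X i) ?R)"
          proof (rule B.exact_at_epi_zero[OF L X_s[OF i] R z g])
            fix w k assume wk: "w \<in> Ob B" "k \<in> Mor B (?X i) w" "cmp B ?L (?X i) w k ?g = zero_mor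
                B ?L w"
            have "cmp B (?X i) (?X i) w k ?g = c i \<odot>\<^bsub>lin B (?X i) w\<^esub> k"
              unfolding ge using wk X_s[OF i] c(1)[of i] True
              by (simp add: B.cmp_smult_right B.idm_closed B.cmp_idm_right)
            with wk(3) have "c i \<odot>\<^bsub>lin B (?X i) w\<^esub> k = zero_mor B (?X i) w" unfolding Le by simp
            then show "k = zero_mor B (?X i) w"
              using wk X_s[OF i] c(1,2)[of i] True by (simp add: B.smult_mor_eq_zero_iff[OF field])
          qed
          then show ?thesis using h0 by simp
        next
          case False
          then have e1: "0 < i \<and> ?e (i - 1)" using one by blast
          have g0: "?g = zero_mor B ?L (?X i)"
            using False lift_zero[of "s (Suc i)" "s i"] by auto
          obtain j where j: "i = Suc j" using e1 by (cases i) auto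
          have he: "?h = c (i - 1) \<odot>\<^bsub>lin B (?X i) (?X i)\<^esub> idm B (?X i)"
            using e1 right fc[of j] s[OF i] i by (simp add: j edge_refl[OF X])
          have "s (i - 1) = s i" using e1 right by blast
          then have Re: "?R = ?X i" using e1 by simp
          have "exact_at B ?L (?X i) ?R (zero_mor B ?L (?X i)) ?h"
          proof (rule B.exact_at_zero_mono[OF L X_s[OF i] R z h])
            fix w k assume wk: "w \<in> Ob B" "k \<in> Mor B w (?X i)" "cmp B w (?X i) ?R ?h k = zero_mor
                B w ?R"
            have "cmp B w (?X i) (?X i) ?h k = c (i - 1) \<odot>\<^bsub>lin B w (?X i)\<^esub> k"
              unfolding he using wk X_s[OF i] c(1)[of j] e1 i
              by (simp add: j B.cmp_smult_left B.idm_closed B.cmp_idm_left)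
            with wk(3) have "c (i - 1) \<odot>\<^bsub>lin B w (?X i)\<^esub> k = zero_mor B w (?X i)" unfolding Re by simp
            then show "k = zero_mor B w (?X i)"
              using wk X_s[OF i] c(1,2)[of j] e1 i by (simp add: j B.smult_mor_eq_zero_iff[OF field])
          qed
          then show ?thesis using g0 by simp
        qed
      qed
    qed
    show ?thesis
      unfolding B.exact_sequence_iff[OF zero_less_Suc]
      by (intro conjI exI[of _ z] allI impI z ex_at) (simp_all add: X_s fB less_Suc_eq_le)
  qed
  moreover have Y_ob: "Y i \<in> Ob image_cat" if "i \<le> Suc m" for i
    using Y[OF that] E_ob[OF s[OF that]] by (simp add: Es[OF that])
  moreover have "fob extension (Y i) = ?X i" if "i \<le> Suc m" for i
    using Y_ob[OF that] unfolding extension_def by (simp only: fob_mk_func s_def)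
  moreover have "farr extension (Y (Suc i)) (Y i) (f i) = ?f i" if "i < Suc m" for i
    using Y_ob[of i] Y_ob[of "Suc i"] that f[of i] Es[of i] Es[of "Suc i"]
    unfolding extension_def by (simp add: s_def)
  ultimately show ?thesis
    using B.exact_sequence_cong[of "Suc m" "\<lambda>i. fob extension (Y i)" ?X
        "\<lambda>i. farr extension (Y (Suc i)) (Y i) (f i)" ?f] by simp
qed

text \<open>Off the degenerate simplices the two functors agree, and on them both take zero objects; so the
  comparison is given by identities and zero morphisms.\<close>

lemma extension_restricts: "isomorphic (fun_cat (Delta m n) B) (comp_func (Delta m n) extension E) X"
proof -
  let ?FE = "comp_func (Delta m n) extension E"
  have E': "is_functor (Delta m n) image_cat E"
    using E by (rule is_functor_into_full_subcat) simp
  note FE = is_functor_comp_func[OF category_Delta E' extension_functor]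
  have ob: "fob ?FE \<sigma> = fob X (rep (fob E \<sigma>))" if "\<sigma> \<in> simplices m n" for \<sigma>
    using that by (simp add: comp_func_def extension_def E_ob)
  have arr: "edge ?FE \<sigma> \<tau> = lift (rep (fob E \<sigma>)) (rep (fob E \<tau>)) (edge E \<sigma> \<tau>)"
    if "\<sigma> \<in> simplices m n" "\<tau> \<in> simplices m n" "\<forall>i\<le>m. \<sigma> i \<le> \<tau> i" for \<sigma> \<tau>
    using that by (simp add: comp_func_def extension_def E_ob E_edge)
  have cases: "fob ?FE \<sigma> = fob X \<sigma> \<and> rep (fob E \<sigma>) = \<sigma> \<or>
      \<sigma> \<in> degenerate m n \<and> zero_object B (fob ?FE \<sigma>) \<and> zero_object B (fob X \<sigma>)"
    if "\<sigma> \<in> simplices m n" for \<sigma>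
    using rep_E[OF that] ob[OF that] X_degenerate by auto
  note mem = X_ob functor_ob[OF FE] B.idm_closed B.zero_mor_closed
  define \<alpha> where "\<alpha> \<sigma> = (if \<sigma> \<in> degenerate m n then zero_mor B (fob ?FE \<sigma>) (fob X \<sigma>) else idm B
      (fob X \<sigma>))" for \<sigma>
  define \<beta> where "\<beta> \<sigma> = (if \<sigma> \<in> degenerate m n then zero_mor B (fob X \<sigma>) (fob ?FE \<sigma>) else idm B
      (fob X \<sigma>))" for \<sigma>
  have nd: "fob ?FE \<sigma> = fob X \<sigma>" "rep (fob E \<sigma>) = \<sigma>" if "\<sigma> \<in> simplices m n" "\<sigma> \<notin> degenerate m n" for \<sigma>
    using cases[OF that(1)] that(2) by auto
  have dz: "zero_object B (fob ?FE \<sigma>)" "zero_object B (fob X \<sigma>)" if "\<sigma> \<in> simplices m n" "\<sigma> \<in>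
      degenerate m n" for \<sigma>
    using rep_E[OF that(1)] ob[OF that(1)] that X_degenerate by auto
  have \<alpha>: "\<alpha> \<sigma> \<in> Mor B (fob ?FE \<sigma>) (fob X \<sigma>)" and \<beta>: "\<beta> \<sigma> \<in> Mor B (fob X \<sigma>) (fob ?FE \<sigma>)"
    if "\<sigma> \<in> simplices m n" for \<sigma>
    using that nd[OF that] by (auto simp: \<alpha>_def \<beta>_def mem)
  show ?thesis
  proof (rule isomorphic_fun_catI[where \<alpha> = \<alpha> and \<beta> = \<beta>])
    fix \<sigma> assume "\<sigma> \<in> Ob (Delta m n)"
    then have \<sigma>: "\<sigma> \<in> simplices m n" by simp
    note c = \<alpha>[OF \<sigma>] \<beta>[OF \<sigma>]
    have ob': "fob ?FE \<sigma> \<in> Ob B" "fob X \<sigma> \<in> Ob B" using \<sigma> by (auto simp: mem)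
    show "cmp B (fob ?FE \<sigma>) (fob X \<sigma>) (fob ?FE \<sigma>) (\<beta> \<sigma>) (\<alpha> \<sigma>) = idm B (fob ?FE \<sigma>)"
    proof (cases "\<sigma> \<in> degenerate m n")
      case True
      show ?thesis
        using B.from_zero_object[OF dz(1)[OF \<sigma> True] ob'(1)] c ob' by (metis B.cmp_closed B.idm_closed)
    qed (use nd[OF \<sigma>] ob' in \<open>simp add: \<alpha>_def \<beta>_def B.cmp_idm_left B.idm_closed\<close>)
    show "cmp B (fob X \<sigma>) (fob ?FE \<sigma>) (fob X \<sigma>) (\<alpha> \<sigma>) (\<beta> \<sigma>) = idm B (fob X \<sigma>)"
    proof (cases "\<sigma> \<in> degenerate m n")
      case True
      show ?thesis
        using B.from_zero_object[OF dz(2)[OF \<sigma> True] ob'(2)] c ob' by (metis B.cmp_closed B.idm_closed)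
    qed (use nd[OF \<sigma>] ob' in \<open>simp add: \<alpha>_def \<beta>_def B.cmp_idm_left B.idm_closed\<close>)
  next
    fix \<sigma> \<tau> u assume "\<sigma> \<in> Ob (Delta m n)" "\<tau> \<in> Ob (Delta m n)" "u \<in> Mor (Delta m n) \<sigma> \<tau>"
    then have \<sigma>: "\<sigma> \<in> simplices m n" and \<tau>: "\<tau> \<in> simplices m n" and le: "\<forall>i\<le>m. \<sigma> i \<le> \<tau> i"
      and u: "u = (\<sigma>, \<tau>)" by auto
    have ob': "fob ?FE \<sigma> \<in> Ob B" "fob X \<sigma> \<in> Ob B" "fob ?FE \<tau> \<in> Ob B" "fob X \<tau> \<in> Ob B"
      using \<sigma> \<tau> by (auto simp: mem)
    note e = edge_closed[OF FE \<sigma> \<tau> le] X_edge[OF \<sigma> \<tau> le]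
    have l: "cmp B (fob ?FE \<sigma>) (fob X \<sigma>) (fob X \<tau>) (edge X \<sigma> \<tau>) (\<alpha> \<sigma>) \<in> Mor B (fob ?FE \<sigma>) (fob X \<tau>)"
      and r: "cmp B (fob ?FE \<sigma>) (fob ?FE \<tau>) (fob X \<tau>) (\<alpha> \<tau>) (edge ?FE \<sigma> \<tau>) \<in> Mor B (fob ?FE \<sigma>)
          (fob X \<tau>)"
      using ob' e \<alpha> \<sigma> \<tau> by (auto intro: B.cmp_closed)
    have "cmp B (fob ?FE \<sigma>) (fob X \<sigma>) (fob X \<tau>) (edge X \<sigma> \<tau>) (\<alpha> \<sigma>)
      = cmp B (fob ?FE \<sigma>) (fob ?FE \<tau>) (fob X \<tau>) (\<alpha> \<tau>) (edge ?FE \<sigma> \<tau>)"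
    proof (cases "\<sigma> \<in> degenerate m n \<or> \<tau> \<in> degenerate m n")
      case True
      then show ?thesis
        using l r ob' B.from_zero_object[OF dz(1)[OF \<sigma>]] B.to_zero_object[OF dz(2)[OF \<tau>]] by metis
    next
      case False
      then show ?thesis
        using nd[OF \<sigma>] nd[OF \<tau>] arr[OF \<sigma> \<tau> le] lift_edge[OF \<sigma> \<tau> le] ob' e
        by (simp add: \<alpha>_def B.cmp_idm_left B.cmp_idm_right)
    qed
    then show "cmp B (fob ?FE \<sigma>) (fob X \<sigma>) (fob X \<tau>) (farr X \<sigma> \<tau> u) (\<alpha> \<sigma>)
      = cmp B (fob ?FE \<sigma>) (fob ?FE \<tau>) (fob X \<tau>) (\<alpha> \<tau>) (farr ?FE \<sigma> \<tau> u)" by (simp add: u)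
  qed (use FE X \<alpha> \<beta> B.category_axioms in auto)
qed

end

text \<open>A family of morphisms that is natural over the poset is natural over the whole image, because
  morphisms there are zero or multiples of edges; this makes pullback full. It is faithful because
  \<open>E\<close> is surjective on objects of the image.\<close>

lemma (in interlacing_functor) pullback_is_equivalence:
  fixes B :: "('k, 'p, 'b) lcat"
  assumes "abelian_linear_category K B"
  shows "is_equivalence (exact_lin_fun_cat K (Suc m) A (fob E ` simplices m n) B) (S_cat m n B)
    (pullback (exact_lin_fun_cat K (Suc m) A (fob E ` simplices m n) B) (Delta m n) E)"
    (is "is_equivalence ?F ?S ?P")
proof -
  interpret B: abelian_linear_category K B by fact
  interpret I: category image_cat by (intro category_full_subcat category_axioms)
  have E': "is_functor (Delta m n) image_cat E"
    using E by (rule is_functor_into_full_subcat) simp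
  have cat_F: "category ?F" and cat_S: "category ?S"
    unfolding exact_lin_fun_cat_def S_cat_def
    by (intro category_full_subcat category_fun_cat B.category_axioms)+
  have F_simps: "Mor ?F = nat_trans image_cat B" "idm ?F = idm (fun_cat image_cat B)"
    "cmp ?F = cmp (fun_cat image_cat B)"
    by (simp_all add: exact_lin_fun_cat_def)
  have S_simps: "Mor ?S = nat_trans (Delta m n) B" "idm ?S = idm (fun_cat (Delta m n) B)"
    "cmp ?S = cmp (fun_cat (Delta m n) B)"
    by (simp_all add: S_cat_def)
  have F_iff: "F \<in> Ob ?F \<longleftrightarrow> is_linear_functor K image_cat B F \<and>
      (\<forall>Y f. (\<forall>i\<le>Suc m. Y i \<in> fob E ` simplices m n) \<and> exact_sequence A (Suc m) Y f \<longrightarrow>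
        exact_sequence B (Suc m) (\<lambda>i. fob F (Y i)) (\<lambda>i. farr F (Y (Suc i)) (Y i) (f i)))" for F
    by (auto simp: exact_lin_fun_cat_def is_linear_functor_def)
  have S_iff: "X \<in> Ob ?S \<longleftrightarrow> is_functor (Delta m n) B X \<and>
      (\<forall>\<kappa> \<in> degenerate m n. zero_object B (fob X \<kappa>)) \<and>
      (\<forall>\<zeta> \<in> nondegenerate (Suc m) n. exact_sequence B (Suc m)
        (\<lambda>i. fob X (face m \<zeta> i)) (\<lambda>i. edge X (face m \<zeta> (Suc i)) (face m \<zeta> i)))" for X
    by (auto simp: S_cat_def)
  have F_functor: "is_functor image_cat B F" if "F \<in> Ob ?F" for F
    using that by (simp add: F_iff is_linear_functor_def)
  have F_linear: "linear_map K (lin A M N) (lin B (fob F M) (fob F N)) (farr F M N)"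
    if "F \<in> Ob ?F" "M \<in> Ob image_cat" "N \<in> Ob image_cat" for F M N
    using that by (simp add: F_iff is_linear_functor_def)
  have E_image: "fob E \<sigma> \<in> Ob image_cat" if "\<sigma> \<in> simplices m n" for \<sigma>
    using that by (simp add: E_ob)
  have FE_functor: "is_functor (Delta m n) B (comp_func (Delta m n) F E)" if "F \<in> Ob ?F" for F
    using is_functor_comp_func[OF category_Delta E' F_functor[OF that]] .
  have FE_ob: "fob (comp_func (Delta m n) F E) \<sigma> = fob F (fob E \<sigma>)" if "\<sigma> \<in> simplices m n" for \<sigma> F
    using that by (simp add: comp_func_def)
  have FE_edge: "edge (comp_func (Delta m n) F E) \<sigma> \<tau> = farr F (fob E \<sigma>) (fob E \<tau>) (edge E \<sigma> \<tau>)"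
    if "\<sigma> \<in> simplices m n" "\<tau> \<in> simplices m n" "\<forall>i\<le>m. \<sigma> i \<le> \<tau> i" for \<sigma> \<tau> F
    using that by (simp add: comp_func_def)
  have F_zero: "farr F M N (zero_mor A M N) = zero_mor B (fob F M) (fob F N)"
    if "F \<in> Ob ?F" "M \<in> Ob image_cat" "N \<in> Ob image_cat" for F M N
    using that functor_ob[OF F_functor[OF that(1)]]
    by (intro linear_map_zero[OF lin_module B.lin_module F_linear]) auto
  have F_degenerate: "zero_object B (fob F (fob E \<kappa>))" if F: "F \<in> Ob ?F" and \<kappa>: "\<kappa> \<in> degenerate m
      n" for F \<kappa>
  proof (rule B.zero_objectI)
    have k: "fob E \<kappa> \<in> Ob image_cat" using E_image degenerate_simplices[OF \<kappa>] .
    then show "fob F (fob E \<kappa>) \<in> Ob B" by (rule functor_ob[OF F_functor[OF F]])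
    have "idm A (fob E \<kappa>) = zero_mor A (fob E \<kappa>) (fob E \<kappa>)"
      using k idm_closed by (intro from_zero_object[OF E_degenerate[OF \<kappa>]]) auto
    then show "idm B (fob F (fob E \<kappa>)) = zero_mor B (fob F (fob E \<kappa>)) (fob F (fob E \<kappa>))"
      using functor_id[OF F_functor[OF F] k] F_zero[OF F k k] by simp
  qed
  have FE_S: "comp_func (Delta m n) F E \<in> Ob ?S" if F: "F \<in> Ob ?F" for F
    unfolding S_iff
  proof (intro conjI ballI)
    fix \<kappa> assume "\<kappa> \<in> degenerate m n"
    then show "zero_object B (fob (comp_func (Delta m n) F E) \<kappa>)"
      using F_degenerate[OF F] by (simp add: FE_ob degenerate_simplices)
  next
    fix \<zeta> assume \<zeta>: "\<zeta> \<in> nondegenerate (Suc m) n"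
    have face: "face m \<zeta> i \<in> simplices m n" for i
      by (intro face_simplices nondegenerate_simplices \<zeta>)
    have "exact_sequence B (Suc m) (\<lambda>i. fob F (fob E (face m \<zeta> i)))
        (\<lambda>i. farr F (fob E (face m \<zeta> (Suc i))) (fob E (face m \<zeta> i)) (edge E (face m \<zeta> (Suc i))
            (face m \<zeta> i)))"
      using F[unfolded F_iff, THEN conjunct2, THEN spec, THEN spec,
          of "\<lambda>i. fob E (face m \<zeta> i)" "\<lambda>i. edge E (face m \<zeta> (Suc i)) (face m \<zeta> i)"]
        faces_exact[OF \<zeta>] face by simp
    then show "exact_sequence B (Suc m) (\<lambda>i. fob (comp_func (Delta m n) F E) (face m \<zeta> i))
        (\<lambda>i. edge (comp_func (Delta m n) F E) (face m \<zeta> (Suc i)) (face m \<zeta> i))"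
      by (simp add: FE_ob FE_edge face interlaced_le[OF face_interlaced[OF \<zeta>]])
  qed (rule FE_functor[OF F])
  have P_ob: "fob ?P F = comp_func (Delta m n) F E" if "F \<in> Ob ?F" for F
    using that by (simp add: pullback_def)
  have P_arr: "farr ?P F G \<eta> = (\<lambda>\<sigma> \<in> simplices m n. \<eta> (fob E \<sigma>))"
    if "F \<in> Ob ?F" "G \<in> Ob ?F" "\<eta> \<in> nat_trans image_cat B F G" for F G \<eta>
    using that by (simp add: pullback_def F_simps)
  have P: "is_functor ?F ?S ?P"
    unfolding pullback_def
  proof (rule is_functor_mk_func[OF FE_S _ _ _ cat_F])
    fix F G \<eta> assume FG: "F \<in> Ob ?F" "G \<in> Ob ?F" and "\<eta> \<in> Mor ?F F G"
    then have \<eta>: "\<eta> \<in> nat_trans image_cat B F G" by (simp add: F_simps)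
    have "restrict (\<lambda>\<sigma>. \<eta> (fob E \<sigma>)) (Ob (Delta m n))
        \<in> nat_trans (Delta m n) B (comp_func (Delta m n) F E) (comp_func (Delta m n) G E)"
    proof (rule nat_transI)
      fix \<sigma> assume "\<sigma> \<in> Ob (Delta m n)"
      then show "\<eta> (fob E \<sigma>) \<in> Mor B (fob (comp_func (Delta m n) F E) \<sigma>) (fob (comp_func (Delta m
          n) G E) \<sigma>)"
        using nat_trans_arr[OF \<eta> E_image] by (simp add: FE_ob)
    next
      fix \<sigma> \<tau> u assume "\<sigma> \<in> Ob (Delta m n)" "\<tau> \<in> Ob (Delta m n)" "u \<in> Mor (Delta m n) \<sigma> \<tau>"
      then have st: "\<sigma> \<in> simplices m n" "\<tau> \<in> simplices m n" "\<forall>i\<le>m. \<sigma> i \<le> \<tau> i" "u = (\<sigma>, \<tau>)" by auto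
      then show "cmp B (fob (comp_func (Delta m n) F E) \<sigma>) (fob (comp_func (Delta m n) G E) \<sigma>)
          (fob (comp_func (Delta m n) G E) \<tau>) (farr (comp_func (Delta m n) G E) \<sigma> \<tau> u) (\<eta> (fob E \<sigma>))
        = cmp B (fob (comp_func (Delta m n) F E) \<sigma>) (fob (comp_func (Delta m n) F E) \<tau>)
          (fob (comp_func (Delta m n) G E) \<tau>) (\<eta> (fob E \<tau>)) (farr (comp_func (Delta m n) F E) \<sigma> \<tau> u)"
        using nat_trans_natural[OF \<eta> E_image E_image, of \<sigma> \<tau> "edge E \<sigma> \<tau>"] E_edge[OF st(1-3)]
        by (simp add: FE_ob FE_edge)
    qed
    then show "(\<lambda>\<sigma> \<in> Ob (Delta m n). \<eta> (fob E \<sigma>))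
        \<in> Mor ?S (comp_func (Delta m n) F E) (comp_func (Delta m n) G E)"
      by (simp add: S_simps)
  next
    fix F assume "F \<in> Ob ?F"
    then show "(\<lambda>\<sigma> \<in> Ob (Delta m n). idm ?F F (fob E \<sigma>)) = idm ?S (comp_func (Delta m n) F E)"
      by (auto simp: F_simps S_simps FE_ob E_ob intro!: restrict_ext)
  next
    fix F G H \<eta> \<theta>
    assume "F \<in> Ob ?F" "G \<in> Ob ?F" "H \<in> Ob ?F" "\<eta> \<in> Mor ?F F G" "\<theta> \<in> Mor ?F G H"
    then show "(\<lambda>\<sigma> \<in> Ob (Delta m n). cmp ?F F G H \<theta> \<eta> (fob E \<sigma>))
      = cmp ?S (comp_func (Delta m n) F E) (comp_func (Delta m n) G E) (comp_func (Delta m n) H E)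
        (\<lambda>\<sigma> \<in> Ob (Delta m n). \<theta> (fob E \<sigma>)) (\<lambda>\<sigma> \<in> Ob (Delta m n). \<eta> (fob E \<sigma>))"
      by (auto simp: F_simps S_simps FE_ob E_ob intro!: restrict_ext)
  qed
  show ?thesis
  proof (rule is_equivalenceI[OF cat_F cat_S P])
    fix F G \<eta> \<theta>
    assume FG: "F \<in> Ob ?F" "G \<in> Ob ?F" and "\<eta> \<in> Mor ?F F G" "\<theta> \<in> Mor ?F F G"
      and eq: "farr ?P F G \<eta> = farr ?P F G \<theta>"
    then have nt: "\<eta> \<in> nat_trans image_cat B F G" "\<theta> \<in> nat_trans image_cat B F G"
      by (simp_all add: F_simps)
    have "\<eta> (fob E \<sigma>) = \<theta> (fob E \<sigma>)" if "\<sigma> \<in> simplices m n" for \<sigma>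
      using fun_cong[OF eq, of \<sigma>] P_arr[OF FG nt(1)] P_arr[OF FG nt(2)] that by simp
    then show "\<eta> = \<theta>" by (intro nat_trans_eqI[OF nt]) auto
  next
    fix F G \<theta> assume FG: "F \<in> Ob ?F" "G \<in> Ob ?F" and "\<theta> \<in> Mor ?S (fob ?P F) (fob ?P G)"
    then have \<theta>: "\<theta> \<in> nat_trans (Delta m n) B (comp_func (Delta m n) F E) (comp_func (Delta m n) G E)"
      by (simp add: S_simps P_ob)
    have \<theta>_arr: "\<theta> \<sigma> \<in> Mor B (fob F (fob E \<sigma>)) (fob G (fob E \<sigma>))" if "\<sigma> \<in> simplices m n" for \<sigma>
      using nat_trans_arr[OF \<theta>, of \<sigma>] that by (simp add: FE_ob)
    note Fob = functor_ob[OF F_functor[OF FG(1)]] and Gob = functor_ob[OF F_functor[OF FG(2)]]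
    have \<theta>_eq: "\<theta> \<sigma> = \<theta> \<tau>" if st: "\<sigma> \<in> simplices m n" "\<tau> \<in> simplices m n" "fob E \<sigma> = fob E \<tau>" for \<sigma> \<tau>
      using E_eq_cases[OF st]
    proof
      assume "\<sigma> \<in> degenerate m n \<and> \<tau> \<in> degenerate m n"
      then show ?thesis
        using B.from_zero_object[OF F_degenerate[OF FG(1)] Gob[OF E_image]] \<theta>_arr st by metis
    qed simp
    define r where "r M = (SOME \<sigma>. \<sigma> \<in> simplices m n \<and> fob E \<sigma> = M)" for M
    have r: "r (fob E \<sigma>) \<in> simplices m n \<and> fob E (r (fob E \<sigma>)) = fob E \<sigma>" if "\<sigma> \<in> simplices m n" for \<sigma>
      unfolding r_def using someI[of "\<lambda>\<tau>. \<tau> \<in> simplices m n \<and> fob E \<tau> = fob E \<sigma>" \<sigma>] that by blast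
    define \<eta> where "\<eta> = (\<lambda>M \<in> Ob image_cat. \<theta> (r M))"
    have \<eta>_E: "\<eta> (fob E \<sigma>) = \<theta> \<sigma>" if "\<sigma> \<in> simplices m n" for \<sigma>
      using that r[OF that] \<theta>_eq[of "r (fob E \<sigma>)" \<sigma>] by (simp add: \<eta>_def E_ob)
    have "restrict \<eta> (Ob image_cat) \<in> nat_trans image_cat B F G"
    proof (rule nat_transI)
      fix M assume "M \<in> Ob image_cat"
      then show "\<eta> M \<in> Mor B (fob F M) (fob G M)" using \<eta>_E \<theta>_arr by auto
    next
      fix M N f assume "M \<in> Ob image_cat" "N \<in> Ob image_cat" and f: "f \<in> Mor image_cat M N"
      then obtain \<sigma> \<tau> where \<sigma>: "\<sigma> \<in> simplices m n" "M = fob E \<sigma>" and \<tau>: "\<tau> \<in> simplices m n" "N =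
          fob E \<tau>"
        by auto
      note im = E_image[OF \<sigma>(1)] E_image[OF \<tau>(1)]
      note ob = Fob[OF im(1)] Fob[OF im(2)] Gob[OF im(1)] Gob[OF im(2)]
      note ar = \<theta>_arr[OF \<sigma>(1)] \<theta>_arr[OF \<tau>(1)]
      have "f \<in> Mor A (fob E \<sigma>) (fob E \<tau>)" using f \<sigma> \<tau> by simp
      with \<sigma>(1) \<tau>(1) have "cmp B (fob F M) (fob G M) (fob G N) (farr G M N f) (\<theta> \<sigma>)
        = cmp B (fob F M) (fob F N) (fob G N) (\<theta> \<tau>) (farr F M N f)"
      proof (cases rule: hom_cases)
        case zero
        then show ?thesis
          using F_zero[OF FG(1) im] F_zero[OF FG(2) im] ob ar
          by (simp add: \<sigma>(2) \<tau>(2) B.cmp_zero_left B.cmp_zero_right)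
      next
        case (multiple c)
        note le = interlaced_le[OF multiple(1)]
        note e = E_edge[OF \<sigma>(1) \<tau>(1) le]
        have V: "edge E \<sigma> \<tau> \<in> carrier (lin A (fob E \<sigma>) (fob E \<tau>))"
          using im e by (simp add: lin_carrier)
        have Ff: "farr F M N f = c \<odot>\<^bsub>lin B (fob F M) (fob F N)\<^esub> farr F M N (edge E \<sigma> \<tau>)"
          and Gf: "farr G M N f = c \<odot>\<^bsub>lin B (fob G M) (fob G N)\<^esub> farr G M N (edge E \<sigma> \<tau>)"
          using F_linear[OF FG(1) im] F_linear[OF FG(2) im] V multiple
          unfolding linear_map_def \<sigma>(2) \<tau>(2) by auto
        have ar': "farr F M N (edge E \<sigma> \<tau>) \<in> Mor B (fob F M) (fob F N)"
          "farr G M N (edge E \<sigma> \<tau>) \<in> Mor B (fob G M) (fob G N)"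
          using functor_arr[OF F_functor[OF FG(1)], of "edge E \<sigma> \<tau>" M N]
            functor_arr[OF F_functor[OF FG(2)], of "edge E \<sigma> \<tau>" M N] im e
          by (simp_all add: \<sigma>(2) \<tau>(2))
        have "cmp B (fob F M) (fob G M) (fob G N) (farr G M N (edge E \<sigma> \<tau>)) (\<theta> \<sigma>)
          = cmp B (fob F M) (fob F N) (fob G N) (\<theta> \<tau>) (farr F M N (edge E \<sigma> \<tau>))"
          using nat_trans_natural[OF \<theta>, of \<sigma> \<tau> "(\<sigma>, \<tau>)"] \<sigma>(1) \<tau>(1) le
          by (simp add: FE_ob FE_edge \<sigma>(2) \<tau>(2))
        then show ?thesis
          unfolding Ff Gf
          using ob[folded \<sigma>(2) \<tau>(2)] ar[folded \<sigma>(2) \<tau>(2)] ar' multiple(2)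
          by (simp add: B.cmp_smult_left B.cmp_smult_right)
      qed
      then show "cmp B (fob F M) (fob G M) (fob G N) (farr G M N f) (\<eta> M)
        = cmp B (fob F M) (fob F N) (fob G N) (\<eta> N) (farr F M N f)"
        by (simp add: \<sigma> \<tau> \<eta>_E)
    qed
    then have \<eta>: "\<eta> \<in> nat_trans image_cat B F G" by (simp add: \<eta>_def)
    have "farr ?P F G \<eta> = \<theta>"
      unfolding P_arr[OF FG \<eta>] using nat_trans_extensional[OF \<theta>]
      by (intro extensionalityI[of _ "simplices m n"]) (auto simp: \<eta>_E)
    with \<eta> show "\<exists>\<eta> \<in> Mor ?F F G. farr ?P F G \<eta> = \<theta>" by (auto simp: F_simps)
  next
    fix X assume "X \<in> Ob ?S"
    then interpret X: interlacing_extension K A m n E B X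
      by unfold_locales (auto simp: S_iff)
    have ext: "X.extension \<in> Ob ?F"
      unfolding F_iff using X.extension_linear X.extension_exact by blast
    moreover have "isomorphic ?S (fob ?P X.extension) X"
      using X.extension_restricts unfolding P_ob[OF ext] by (simp add: S_cat_def)
    ultimately show "\<exists>F \<in> Ob ?F. isomorphic ?S (fob ?P F) X" by blast
  qed
qed


section \<open>Modules\<close>

lemma mk_module_simps [simp]:
  "carrier (mk_module V z a s) = V" "\<zero>\<^bsub>mk_module V z a s\<^esub> = z"
  "u \<oplus>\<^bsub>mk_module V z a s\<^esub> v = a u v" "c \<odot>\<^bsub>mk_module V z a s\<^esub> v = s c v"
  by (simp_all add: mk_module_def)

text \<open>The module axioms pass to the image of a map that respects the operations.\<close>

lemma module_surj_image:
  assumes "module K M"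
    and surj: "carrier N = f ` carrier M"
    and zero: "\<zero>\<^bsub>N\<^esub> = f \<zero>\<^bsub>M\<^esub>"
    and add: "\<And>u v. \<lbrakk>u \<in> carrier M; v \<in> carrier M\<rbrakk> \<Longrightarrow> f u \<oplus>\<^bsub>N\<^esub> f v = f (u \<oplus>\<^bsub>M\<^esub> v)"
    and smult: "\<And>c v. \<lbrakk>c \<in> carrier K; v \<in> carrier M\<rbrakk> \<Longrightarrow> c \<odot>\<^bsub>N\<^esub> f v = f (c \<odot>\<^bsub>M\<^esub> v)"
  shows "module K N"
proof -
  interpret M: module K M by fact
  show ?thesis
  proof (rule moduleI)
    show "abelian_group N"
    proof (rule abelian_groupI)
      fix x y z assume "x \<in> carrier N" "y \<in> carrier N" "z \<in> carrier N"
      then show "(x \<oplus>\<^bsub>N\<^esub> y) \<oplus>\<^bsub>N\<^esub> z = x \<oplus>\<^bsub>N\<^esub> (y \<oplus>\<^bsub>N\<^esub> z)"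
        by (auto simp: surj add M.a_assoc)
    next
      fix x y assume "x \<in> carrier N" "y \<in> carrier N"
      then show "x \<oplus>\<^bsub>N\<^esub> y = y \<oplus>\<^bsub>N\<^esub> x"
        by (auto simp: surj add M.M.a_comm)
    next
      fix x assume "x \<in> carrier N"
      then obtain u where u: "u \<in> carrier M" "x = f u" by (auto simp: surj)
      then have "f (\<ominus>\<^bsub>M\<^esub> u) \<oplus>\<^bsub>N\<^esub> x = \<zero>\<^bsub>N\<^esub>" by (simp add: add zero M.M.l_neg)
      then show "\<exists>y\<in>carrier N. y \<oplus>\<^bsub>N\<^esub> x = \<zero>\<^bsub>N\<^esub>" using u by (auto simp: surj)
    qed (auto simp: surj zero add)
  qed (auto simp: surj smult add M.smult_l_distr M.smult_r_distr M.smult_assoc1 M.R.cring_axioms)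
qed

text \<open>Pointwise operations on a set of dependent functions that is closed under them.\<close>

lemma module_pointwise:
  assumes "cring K" and V: "\<And>x. x \<in> I \<Longrightarrow> module K (V x)"
    and P: "P \<subseteq> (\<Pi>\<^sub>E x\<in>I. carrier (V x))"
    and zero: "(\<lambda>x\<in>I. \<zero>\<^bsub>V x\<^esub>) \<in> P"
    and add: "\<And>\<alpha> \<beta>. \<lbrakk>\<alpha> \<in> P; \<beta> \<in> P\<rbrakk> \<Longrightarrow> (\<lambda>x\<in>I. \<alpha> x \<oplus>\<^bsub>V x\<^esub> \<beta> x) \<in> P"
    and smult: "\<And>c \<alpha>. \<lbrakk>c \<in> carrier K; \<alpha> \<in> P\<rbrakk> \<Longrightarrow> (\<lambda>x\<in>I. c \<odot>\<^bsub>V x\<^esub> \<alpha> x) \<in> P"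
  shows "module K (mk_module P (\<lambda>x\<in>I. \<zero>\<^bsub>V x\<^esub>) (\<lambda>\<alpha> \<beta>. \<lambda>x\<in>I. \<alpha> x \<oplus>\<^bsub>V x\<^esub> \<beta> x)
    (\<lambda>c \<alpha>. \<lambda>x\<in>I. c \<odot>\<^bsub>V x\<^esub> \<alpha> x))" (is "module K ?M")
proof -
  interpret K: cring K by fact
  have val: "\<alpha> x \<in> carrier (V x)" if "\<alpha> \<in> P" "x \<in> I" for \<alpha> x using P that by auto
  have ext: "\<alpha> \<in> extensional I" if "\<alpha> \<in> P" for \<alpha> using P that by (auto simp: PiE_def)
  note closed = module.axioms(2)[OF V, THEN abelian_group.axioms(1)]
  show ?thesis
  proof (rule moduleI)
    show "abelian_group ?M"
    proof (rule abelian_groupI)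
      fix \<alpha> \<beta> \<gamma> assume "\<alpha> \<in> carrier ?M" "\<beta> \<in> carrier ?M" "\<gamma> \<in> carrier ?M"
      then show "(\<alpha> \<oplus>\<^bsub>?M\<^esub> \<beta>) \<oplus>\<^bsub>?M\<^esub> \<gamma> = \<alpha> \<oplus>\<^bsub>?M\<^esub> (\<beta> \<oplus>\<^bsub>?M\<^esub> \<gamma>)"
        by (auto intro!: restrict_ext simp: val abelian_monoid.a_assoc[OF closed])
    next
      fix \<alpha> \<beta> assume "\<alpha> \<in> carrier ?M" "\<beta> \<in> carrier ?M"
      then show "\<alpha> \<oplus>\<^bsub>?M\<^esub> \<beta> = \<beta> \<oplus>\<^bsub>?M\<^esub> \<alpha>"
        by (auto intro!: restrict_ext simp: val abelian_monoid.a_comm[OF closed])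
    next
      fix \<alpha> assume \<alpha>: "\<alpha> \<in> carrier ?M"
      then show "\<zero>\<^bsub>?M\<^esub> \<oplus>\<^bsub>?M\<^esub> \<alpha> = \<alpha>"
        by (auto intro!: extensionalityI[of _ I] simp: val ext abelian_monoid.l_zero[OF closed])
      have "(\<ominus>\<^bsub>K\<^esub> \<one>\<^bsub>K\<^esub>) \<odot>\<^bsub>V x\<^esub> \<alpha> x \<oplus>\<^bsub>V x\<^esub> \<alpha> x = \<zero>\<^bsub>V x\<^esub>" if x: "x \<in> I" for x
      proof -
        interpret V: module K "V x" by (rule V[OF x])
        show ?thesis using val[of \<alpha> x] x \<alpha> by (simp add: V.smult_l_minus V.M.l_neg)
      qed
      then have "((\<ominus>\<^bsub>K\<^esub> \<one>\<^bsub>K\<^esub>) \<odot>\<^bsub>?M\<^esub> \<alpha>) \<oplus>\<^bsub>?M\<^esub> \<alpha> = \<zero>\<^bsub>?M\<^esub>"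
        by (auto intro!: restrict_ext)
      moreover have "(\<ominus>\<^bsub>K\<^esub> \<one>\<^bsub>K\<^esub>) \<odot>\<^bsub>?M\<^esub> \<alpha> \<in> carrier ?M" using \<alpha> smult by simp
      ultimately show "\<exists>\<beta>\<in>carrier ?M. \<beta> \<oplus>\<^bsub>?M\<^esub> \<alpha> = \<zero>\<^bsub>?M\<^esub>" by blast
    qed (use zero add in auto)
  next
    fix \<alpha> assume "\<alpha> \<in> carrier ?M"
    then show "\<one>\<^bsub>K\<^esub> \<odot>\<^bsub>?M\<^esub> \<alpha> = \<alpha>"
      by (auto intro!: extensionalityI[of _ I] simp: val ext module.smult_one[OF V])
  qed (use \<open>cring K\<close> smult in \<open>auto intro!: restrict_ext
      simp: val module.smult_l_distr[OF V] module.smult_r_distr[OF V] module.smult_assoc1[OF V]\<close>)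
qed

lemma linear_mapI:
  assumes "\<And>v. v \<in> carrier V \<Longrightarrow> f v \<in> carrier W"
    and "\<And>u v. \<lbrakk>u \<in> carrier V; v \<in> carrier V\<rbrakk> \<Longrightarrow> f (u \<oplus>\<^bsub>V\<^esub> v) = f u \<oplus>\<^bsub>W\<^esub> f v"
    and "\<And>c v. \<lbrakk>c \<in> carrier K; v \<in> carrier V\<rbrakk> \<Longrightarrow> f (c \<odot>\<^bsub>V\<^esub> v) = c \<odot>\<^bsub>W\<^esub> f v"
  shows "linear_map K V W f"
  using assms by (auto simp: linear_map_def)

lemma linear_mapD:
  assumes "linear_map K V W f"
  shows linear_map_closed: "v \<in> carrier V \<Longrightarrow> f v \<in> carrier W"
    and linear_map_add: "\<lbrakk>u \<in> carrier V; v \<in> carrier V\<rbrakk> \<Longrightarrow> f (u \<oplus>\<^bsub>V\<^esub> v) = f u \<oplus>\<^bsub>W\<^esub> f v"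
    and linear_map_smult: "\<lbrakk>c \<in> carrier K; v \<in> carrier V\<rbrakk> \<Longrightarrow> f (c \<odot>\<^bsub>V\<^esub> v) = c \<odot>\<^bsub>W\<^esub> f v"
  using assms by (auto simp: linear_map_def)

lemma linear_maps_linear: "f \<in> linear_maps K V W \<Longrightarrow> linear_map K V W f"
  by (simp add: linear_maps_def)

lemma restrict_linear_maps:
  assumes "module K V" "linear_map K V W f"
  shows "restrict f (carrier V) \<in> linear_maps K V W"
proof -
  interpret V: module K V by fact
  show ?thesis
    unfolding linear_maps_def
    by (auto intro!: linear_mapI simp: linear_mapD[OF assms(2)])
qed

lemma linear_maps_eqI:
  assumes "f \<in> linear_maps K V W" "g \<in> linear_maps K V W'" "\<And>v. v \<in> carrier V \<Longrightarrow> f v = g v"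
  shows "f = g"
  using assms by (intro extensionalityI[of f "carrier V" g]) (auto simp: linear_maps_def)

section \<open>The category of finite-dimensional vector spaces\<close>

lemma fd_vec_simps [simp]:
  "Ob (fd_vec K) = {V. module K V \<and> finite_dim K V}" "Mor (fd_vec K) V W = linear_maps K V W"
  "idm (fd_vec K) V = (\<lambda>v \<in> carrier V. v)" "cmp (fd_vec K) U V W g f = compose (carrier U) g f"
  by (simp_all add: fd_vec_def)

lemma lin_fd_vec_simps [simp]:
  "carrier (lin (fd_vec K) V W) = linear_maps K V W"
  "\<zero>\<^bsub>lin (fd_vec K) V W\<^esub> = (\<lambda>v \<in> carrier V. \<zero>\<^bsub>W\<^esub>)"
  "f \<oplus>\<^bsub>lin (fd_vec K) V W\<^esub> g = (\<lambda>v \<in> carrier V. f v \<oplus>\<^bsub>W\<^esub> g v)"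
  "c \<odot>\<^bsub>lin (fd_vec K) V W\<^esub> f = (\<lambda>v \<in> carrier V. c \<odot>\<^bsub>W\<^esub> f v)"
  by (simp_all add: fd_vec_def)

lemma module_lin_fd_vec:
  assumes V: "module K V" and W: "module K W"
  shows "module K (lin (fd_vec K) V W)"
proof -
  interpret V: module K V by fact
  interpret W: module K W by fact
  have "module K (mk_module (linear_maps K V W) (\<lambda>v\<in>carrier V. \<zero>\<^bsub>W\<^esub>)
    (\<lambda>f g. \<lambda>v\<in>carrier V. f v \<oplus>\<^bsub>W\<^esub> g v) (\<lambda>c f. \<lambda>v\<in>carrier V. c \<odot>\<^bsub>W\<^esub> f v))"
  proof (rule module_pointwise[where V = "\<lambda>_. W"])
    show "(\<lambda>v\<in>carrier V. \<zero>\<^bsub>W\<^esub>) \<in> linear_maps K V W"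
      by (rule restrict_linear_maps[OF V]) (auto intro!: linear_mapI)
  next
    fix f g assume "f \<in> linear_maps K V W" "g \<in> linear_maps K V W"
    then have f: "linear_map K V W f" and g: "linear_map K V W g" by (simp_all add: linear_maps_linear)
    show "(\<lambda>v\<in>carrier V. f v \<oplus>\<^bsub>W\<^esub> g v) \<in> linear_maps K V W"
      by (rule restrict_linear_maps[OF V], rule linear_mapI)
        (simp_all add: linear_mapD[OF f] linear_mapD[OF g] W.smult_r_distr W.a_ac)
  next
    fix c f assume c: "c \<in> carrier K" and "f \<in> linear_maps K V W"
    then have f: "linear_map K V W f" by (simp add: linear_maps_linear)
    show "(\<lambda>v\<in>carrier V. c \<odot>\<^bsub>W\<^esub> f v) \<in> linear_maps K V W"
      by (rule restrict_linear_maps[OF V], rule linear_mapI)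
        (use c in \<open>simp_all add: linear_mapD[OF f] W.smult_r_distr W.smult_assoc1[symmetric]
            V.R.m_comm\<close>)
  qed (auto simp: linear_maps_def linear_map_def PiE_def W V.R.cring_axioms)
  then show ?thesis by (simp add: fd_vec_def)
qed

lemma compose_linear_maps:
  assumes "module K U" "f \<in> linear_maps K U V" "g \<in> linear_maps K V W"
  shows "compose (carrier U) g f \<in> linear_maps K U W"
  unfolding compose_def
  using linear_mapD[OF linear_maps_linear[OF assms(2)]] linear_mapD[OF linear_maps_linear[OF assms(3)]]
  by (intro restrict_linear_maps[OF assms(1)] linear_mapI) simp_all

lemma linear_category_fd_vec: "linear_category K (fd_vec K)"
proof (intro linear_category.intro linear_category_axioms.intro category.intro, goal_cases)
  case (1 V)
  then show ?case by (auto intro!: restrict_linear_maps linear_mapI)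
next
  case (2 U V W f g)
  then show ?case by (simp add: compose_linear_maps)
next
  case (3 V W f)
  then show ?case
    by (intro extensionalityI[of _ "carrier V"]) (auto simp: linear_maps_def compose_def)
next
  case (4 V W f)
  then show ?case
    by (intro extensionalityI[of _ "carrier V"]) (auto simp: linear_maps_def linear_map_def compose_def)
next
  case (5 T U V W f g h)
  then have f: "linear_map K T U f" by (simp add: linear_maps_linear)
  show ?case by (auto simp: compose_def linear_mapD[OF f] intro!: restrict_ext)
next
  case (6 V W)
  then show ?case by (simp add: module_lin_fd_vec)
next
  case (7 V W)
  then show ?case by simp
next
  case (8 U V W f)
  then have mU: "module K U" and f: "linear_map K U V f" by (simp_all add: linear_maps_linear)
  show ?case
  proof (rule linear_mapI)
    fix g assume "g \<in> carrier (lin (fd_vec K) V W)"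
    with 8 show "cmp (fd_vec K) U V W g f \<in> carrier (lin (fd_vec K) U W)"
      by (simp add: compose_linear_maps)
  qed (auto simp: compose_def linear_mapD[OF f] intro!: restrict_ext)
next
  case (9 U V W g)
  then have mU: "module K U" and g: "linear_map K V W g" by (simp_all add: linear_maps_linear)
  interpret U: module K U by fact
  show ?case
  proof (rule linear_mapI)
    fix f assume "f \<in> carrier (lin (fd_vec K) U V)"
    with 9 show "cmp (fd_vec K) U V W g f \<in> carrier (lin (fd_vec K) U W)"
      by (simp add: compose_linear_maps)
  next
    fix f f' assume "f \<in> carrier (lin (fd_vec K) U V)" "f' \<in> carrier (lin (fd_vec K) U V)"
    then have "linear_map K U V f" "linear_map K U V f'" by (simp_all add: linear_maps_linear)
    then show "cmp (fd_vec K) U V W g (f \<oplus>\<^bsub>lin (fd_vec K) U V\<^esub> f')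
      = cmp (fd_vec K) U V W g f \<oplus>\<^bsub>lin (fd_vec K) U W\<^esub> cmp (fd_vec K) U V W g f'"
      by (auto simp: compose_def linear_mapD[OF g] linear_map_closed intro!: restrict_ext)
  next
    fix c f assume c: "c \<in> carrier K" and "f \<in> carrier (lin (fd_vec K) U V)"
    then have "linear_map K U V f" by (simp add: linear_maps_linear)
    then show "cmp (fd_vec K) U V W g (c \<odot>\<^bsub>lin (fd_vec K) U V\<^esub> f)
      = c \<odot>\<^bsub>lin (fd_vec K) U W\<^esub> cmp (fd_vec K) U V W g f"
      using c by (auto simp: compose_def linear_mapD[OF g] linear_map_closed intro!: restrict_ext)
  qed
qed

section \<open>Linear categories of linear functors\<close>

lemma lin_fun_cat_simps [simp]:
  "Ob (lin_fun_cat K C D) = {F. is_linear_functor K C D F}"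
  "Mor (lin_fun_cat K C D) = nat_trans C D"
  "idm (lin_fun_cat K C D) F = (\<lambda>x \<in> Ob C. idm D (fob F x))"
  "cmp (lin_fun_cat K C D) F G H \<beta> \<alpha> =
    (\<lambda>x \<in> Ob C. cmp D (fob F x) (fob G x) (fob H x) (\<beta> x) (\<alpha> x))"
  by (simp_all add: lin_fun_cat_def)

lemma lin_lin_fun_cat_simps [simp]:
  "carrier (lin (lin_fun_cat K C D) F G) = nat_trans C D F G"
  "\<zero>\<^bsub>lin (lin_fun_cat K C D) F G\<^esub> = (\<lambda>x \<in> Ob C. zero_mor D (fob F x) (fob G x))"
  "\<alpha> \<oplus>\<^bsub>lin (lin_fun_cat K C D) F G\<^esub> \<beta> = (\<lambda>x \<in> Ob C. \<alpha> x \<oplus>\<^bsub>lin D (fob F x) (fob G x)\<^esub> \<beta> x)"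
  "c \<odot>\<^bsub>lin (lin_fun_cat K C D) F G\<^esub> \<alpha> = (\<lambda>x \<in> Ob C. c \<odot>\<^bsub>lin D (fob F x) (fob G x)\<^esub> \<alpha> x)"
  by (simp_all add: lin_fun_cat_def)

lemma linear_functor_functor: "is_linear_functor K C D F \<Longrightarrow> is_functor C D F"
  by (simp add: is_linear_functor_def)

lemma (in linear_category) add_mor_closed:
  "\<lbrakk>x \<in> Ob C; y \<in> Ob C; f \<in> Mor C x y; g \<in> Mor C x y\<rbrakk> \<Longrightarrow> f \<oplus>\<^bsub>lin C x y\<^esub> g \<in> Mor C x y"
  using abelian_monoid.a_closed[OF abelian_group.axioms(1)[OF module.axioms(2)[OF lin_module]]]
  by (simp add: lin_carrier)

lemma (in linear_category) cmp_add_left: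
  "\<lbrakk>x \<in> Ob C; y \<in> Ob C; z \<in> Ob C; f \<in> Mor C x y; g \<in> Mor C y z; h \<in> Mor C y z\<rbrakk>
    \<Longrightarrow> cmp C x y z (g \<oplus>\<^bsub>lin C y z\<^esub> h) f = cmp C x y z g f \<oplus>\<^bsub>lin C x z\<^esub> cmp C x y z h f"
  using cmp_linear_left[of x y z f] by (simp add: linear_map_def lin_carrier)

lemma (in linear_category) cmp_add_right:
  "\<lbrakk>x \<in> Ob C; y \<in> Ob C; z \<in> Ob C; f \<in> Mor C x y; h \<in> Mor C x y; g \<in> Mor C y z\<rbrakk>
    \<Longrightarrow> cmp C x y z g (f \<oplus>\<^bsub>lin C x y\<^esub> h) = cmp C x y z g f \<oplus>\<^bsub>lin C x z\<^esub> cmp C x y z g h"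
  using cmp_linear_right[of x y z g] by (simp add: linear_map_def lin_carrier)

lemma linear_category_lin_fun_cat:
  assumes "cring K" "linear_category K D"
  shows "linear_category K (lin_fun_cat K C D)"
proof -
  interpret D: linear_category K D by fact
  let ?A = "lin_fun_cat K C D"
  have "category (full_subcat (fun_cat C D) {F. is_linear_functor K C D F})"
    by (intro category_full_subcat category_fun_cat D.category_axioms)
  moreover have "{F. is_functor C D F} \<inter> {F. is_linear_functor K C D F} = {F. is_linear_functor K
      C D F}"
    by (auto simp: linear_functor_functor)
  ultimately have "category ?A"
    unfolding category_def by simp
  then interpret A: category ?A .
  have mod: "module K (lin ?A F G)" if "F \<in> Ob ?A" "G \<in> Ob ?A" for F G
  proof -
    have F: "is_functor C D F" and G: "is_functor C D G"
      using that by (auto simp: linear_functor_functor)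
    note ob = functor_ob[OF F] functor_ob[OF G] and arr = functor_arr[OF F] functor_arr[OF G]
    have "module K (mk_module (nat_trans C D F G)
        (\<lambda>x \<in> Ob C. zero_mor D (fob F x) (fob G x))
        (\<lambda>\<alpha> \<beta>. \<lambda>x \<in> Ob C. \<alpha> x \<oplus>\<^bsub>lin D (fob F x) (fob G x)\<^esub> \<beta> x)
        (\<lambda>c \<alpha>. \<lambda>x \<in> Ob C. c \<odot>\<^bsub>lin D (fob F x) (fob G x)\<^esub> \<alpha> x))"
    proof (rule module_pointwise)
      show "nat_trans C D F G \<subseteq> (\<Pi>\<^sub>E x\<in>Ob C. carrier (lin D (fob F x) (fob G x)))"
        using D.lin_carrier ob by (auto simp: nat_trans_def PiE_def Pi_def)
      show "(\<lambda>x \<in> Ob C. zero_mor D (fob F x) (fob G x)) \<in> nat_trans C D F G"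
        by (rule nat_transI) (auto simp: D.zero_mor_closed D.cmp_zero_left D.cmp_zero_right ob arr)
    next
      fix \<alpha> \<beta> assume a: "\<alpha> \<in> nat_trans C D F G" and b: "\<beta> \<in> nat_trans C D F G"
      show "(\<lambda>x \<in> Ob C. \<alpha> x \<oplus>\<^bsub>lin D (fob F x) (fob G x)\<^esub> \<beta> x) \<in> nat_trans C D F G"
        by (rule nat_transI)
          (simp_all add: D.add_mor_closed D.cmp_add_left D.cmp_add_right ob arr
            nat_trans_arr[OF a] nat_trans_arr[OF b] nat_trans_natural[OF a] nat_trans_natural[OF b])
    next
      fix c \<alpha> assume c: "c \<in> carrier K" and a: "\<alpha> \<in> nat_trans C D F G"
      show "(\<lambda>x \<in> Ob C. c \<odot>\<^bsub>lin D (fob F x) (fob G x)\<^esub> \<alpha> x) \<in> nat_trans C D F G"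
        using c by (intro nat_transI)
          (simp_all add: D.smult_mor_closed D.cmp_smult_left D.cmp_smult_right ob arr
            nat_trans_arr[OF a] nat_trans_natural[OF a])
    qed (auto simp: assms D.lin_module ob)
    then show ?thesis by (simp add: lin_fun_cat_def)
  qed
  show ?thesis
  proof (intro linear_category.intro linear_category_axioms.intro A.category_axioms, goal_cases)
    case (1 F G)
    then show ?case by (rule mod)
  next
    case (2 F G)
    then show ?case by simp
  next
    case (3 F G H \<alpha>)
    then have "is_functor C D F" "is_functor C D G" "is_functor C D H" and a: "\<alpha> \<in> nat_trans C D F G"
      by (auto simp: linear_functor_functor)
    then show ?case
      by (intro linear_mapI) (auto intro!: restrict_ext D.cmp_nat_trans
          simp: D.cmp_add_left D.cmp_smult_left functor_ob nat_trans_arr)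
  next
    case (4 F G H \<beta>)
    then have "is_functor C D F" "is_functor C D G" "is_functor C D H" and b: "\<beta> \<in> nat_trans C D G H"
      by (auto simp: linear_functor_functor)
    then show ?case
      by (intro linear_mapI) (auto intro!: restrict_ext D.cmp_nat_trans
          simp: D.cmp_add_right D.cmp_smult_right functor_ob nat_trans_arr)
  qed
qed


section \<open>Exactness of functors with values in vector spaces\<close>

text \<open>Generators go to generators: the preimage of a submodule containing the images of the generators is
  everything.\<close>

lemma finite_dim_image:
  assumes M: "module K M" and N: "module K N" and f: "linear_map K M N f"
    and surj: "carrier N = f ` carrier M" and fin: "finite_dim K M"
  shows "finite_dim K N"
proof -
  interpret M: module K M by fact
  interpret N: module K N by fact
  obtain S where "finite S \<and> S \<subseteq> carrier M \<and> (\<forall>W. submodule W K M \<and> S \<subseteq> W \<longrightarrow> W = carrier M)"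
    using fin unfolding finite_dim_def by (elim exE)
  then have S: "finite S" "S \<subseteq> carrier M"
    and gen: "submodule W K M \<Longrightarrow> S \<subseteq> W \<Longrightarrow> W = carrier M" for W
    by simp_all
  show ?thesis
    unfolding finite_dim_def
  proof (intro exI[of _ "f ` S"] conjI allI impI)
    show "finite (f ` S)" "f ` S \<subseteq> carrier N" using S surj by auto
    fix W assume "submodule W K N \<and> f ` S \<subseteq> W"
    then have W: "submodule W K N" and SW: "f ` S \<subseteq> W" by auto
    have zero: "\<zero>\<^bsub>N\<^esub> \<in> W"
      using subgroup.one_closed[OF submodule.axioms(1)[OF W]] by simp
    have "submodule {v \<in> carrier M. f v \<in> W} K M"
    proof (rule M.submoduleI)
      show "\<zero>\<^bsub>M\<^esub> \<in> {v \<in> carrier M. f v \<in> W}"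
        using zero by (simp add: linear_map_zero[OF M N f])
    next
      fix v assume v: "v \<in> {v \<in> carrier M. f v \<in> W}"
      then have "f (\<ominus>\<^bsub>M\<^esub> v) = (\<ominus>\<^bsub>K\<^esub> \<one>\<^bsub>K\<^esub>) \<odot>\<^bsub>N\<^esub> f v"
        using linear_map_smult[OF f, of "\<ominus>\<^bsub>K\<^esub> \<one>\<^bsub>K\<^esub>" v] by (simp add: M.smult_l_minus)
      then show "\<ominus>\<^bsub>M\<^esub> v \<in> {v \<in> carrier M. f v \<in> W}"
        using v N.submoduleE(4)[OF W] by simp
    qed (use N.submoduleE(4,5)[OF W] in \<open>auto simp: linear_mapD[OF f]\<close>)
    then have "{v \<in> carrier M. f v \<in> W} = carrier M"
      using gen S SW by auto
    then show "W = carrier N"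
      using N.submoduleE(1)[OF W] surj by auto
  qed
qed

text \<open>For an exact \<open>X \<rightarrow> Y \<rightarrow> Z\<close> the image of \<open>X \<rightarrow> Y\<close> is a kernel, and the image of \<open>Y \<rightarrow> Z\<close> is a cokernel of
  \<open>X \<rightarrow> Y\<close>. Unlike the quotient of \<open>Y\<close>, the latter has its elements in the same type.\<close>

definition image_functor :: "('o, 'a, 'z) cat_scheme \<Rightarrow> ('o \<Rightarrow> 'v \<Rightarrow> 'v)
    \<Rightarrow> ('o, 'a, ('k, 'v) module, 'v \<Rightarrow> 'v) func \<Rightarrow> ('o, 'a, ('k, 'v) module, 'v \<Rightarrow> 'v) func
    \<Rightarrow> ('o, 'a, ('k, 'v) module, 'v \<Rightarrow> 'v) func" where
  "image_functor C g Y Z = mk_func C (\<lambda>x. (fob Z x)\<lparr>carrier := g x ` carrier (fob Y x)\<rparr>)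
     (\<lambda>x y f. restrict (farr Z x y f) (g x ` carrier (fob Y x)))"

locale vector_functors = linear_category K C
  for K :: "('k, 'r) ring_scheme" and C :: "('k, 'o, 'a) lcat" +
  assumes cring: "cring K"
begin

abbreviation Vect_fun :: "('k, ('o, 'a, ('k, 'v) module, 'v \<Rightarrow> 'v) func, 'o \<Rightarrow> 'v \<Rightarrow> 'v) lcat" where
  "Vect_fun \<equiv> lin_fun_cat K C (fd_vec K)"

lemma linear_category_Vect_fun: "linear_category K Vect_fun"
  by (rule linear_category_lin_fun_cat[OF cring linear_category_fd_vec])

lemma is_functorD: "F \<in> Ob Vect_fun \<Longrightarrow> is_functor C (fd_vec K) F"
  by (simp add: linear_functor_functor)

lemma value_module: "\<lbrakk>F \<in> Ob Vect_fun; x \<in> Ob C\<rbrakk> \<Longrightarrow> module K (fob F x)"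
  using functor_ob[OF is_functorD] by auto

lemma value_finite_dim: "\<lbrakk>F \<in> Ob Vect_fun; x \<in> Ob C\<rbrakk> \<Longrightarrow> finite_dim K (fob F x)"
  using functor_ob[OF is_functorD] by auto

lemma value_arr: "\<lbrakk>F \<in> Ob Vect_fun; x \<in> Ob C; y \<in> Ob C; f \<in> Mor C x y\<rbrakk>
    \<Longrightarrow> farr F x y f \<in> linear_maps K (fob F x) (fob F y)"
  using functor_arr[OF is_functorD] by auto

lemmas value_linear = linear_maps_linear[OF value_arr]

lemma component_linear:
  "\<lbrakk>\<eta> \<in> nat_trans C (fd_vec K) F G; x \<in> Ob C\<rbrakk> \<Longrightarrow> linear_map K (fob F x) (fob G x) (\<eta> x)"
  using nat_trans_arr[of \<eta> C "fd_vec K" F G x] by (simp add: linear_maps_linear)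

lemma component_natural:
  assumes "\<eta> \<in> nat_trans C (fd_vec K) F G" "x \<in> Ob C" "y \<in> Ob C" "f \<in> Mor C x y"
    "v \<in> carrier (fob F x)"
  shows "farr G x y f (\<eta> x v) = \<eta> y (farr F x y f v)"
  using fun_cong[OF nat_trans_natural[OF assms(1-4)], of v] assms(5) by (simp add: compose_def)

lemma nat_trans_VectI:
  assumes F: "F \<in> Ob Vect_fun"
    and lin: "\<And>x. x \<in> Ob C \<Longrightarrow> \<eta> x \<in> linear_maps K (fob F x) (fob G x)"
    and nat: "\<And>x y f v. \<lbrakk>x \<in> Ob C; y \<in> Ob C; f \<in> Mor C x y; v \<in> carrier (fob F x)\<rbrakk>
      \<Longrightarrow> farr G x y f (\<eta> x v) = \<eta> y (farr F x y f v)"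
  shows "restrict \<eta> (Ob C) \<in> nat_trans C (fd_vec K) F G"
  by (rule nat_transI) (auto simp: compose_def lin nat intro!: restrict_ext)

lemma nat_trans_Vect_eqI:
  assumes "\<eta> \<in> nat_trans C (fd_vec K) F G" "\<theta> \<in> nat_trans C (fd_vec K) F G'"
    and "\<And>x v. \<lbrakk>x \<in> Ob C; v \<in> carrier (fob F x)\<rbrakk> \<Longrightarrow> \<eta> x v = \<theta> x v"
  shows "\<eta> = \<theta>"
proof (rule nat_trans_eqI[OF assms(1,2)])
  fix x assume x: "x \<in> Ob C"
  show "\<eta> x = \<theta> x"
    using nat_trans_arr[OF assms(1) x] nat_trans_arr[OF assms(2) x] assms(3)[OF x]
    by (intro linear_maps_eqI) auto
qed

context
  fixes Y Z :: "('o, 'a, ('k, 'v) module, 'v \<Rightarrow> 'v) func" and g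
  assumes Y: "Y \<in> Ob Vect_fun" and Z: "Z \<in> Ob Vect_fun" and g: "g \<in> nat_trans C (fd_vec K) Y Z"
begin

lemma image_functor_fob:
  "x \<in> Ob C \<Longrightarrow> fob (image_functor C g Y Z) x = (fob Z x)\<lparr>carrier := g x ` carrier (fob Y x)\<rparr>"
  by (simp add: image_functor_def)

lemma image_functor_farr: "\<lbrakk>x \<in> Ob C; y \<in> Ob C; f \<in> Mor C x y; v \<in> carrier (fob Y x)\<rbrakk>
    \<Longrightarrow> farr (image_functor C g Y Z) x y f (g x v) = g y (farr Y x y f v)"
  by (simp add: image_functor_def component_natural[OF g])

lemma image_functor_Ob: "image_functor C g Y Z \<in> Ob Vect_fun"
proof -
  let ?Q = "image_functor C g Y Z"
  note gl = component_linear[OF g]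
  have mod: "module K ((fob Z x)\<lparr>carrier := g x ` carrier (fob Y x)\<rparr>)" if x: "x \<in> Ob C" for x
    by (rule module_surj_image[OF value_module[OF Y x], where f = "g x"])
      (simp_all add: linear_map_zero[OF value_module[OF Y x] value_module[OF Z x] gl[OF x]]
        linear_map_add[OF gl[OF x]] linear_map_smult[OF gl[OF x]])
  have fin: "finite_dim K ((fob Z x)\<lparr>carrier := g x ` carrier (fob Y x)\<rparr>)" if x: "x \<in> Ob C" for x
    by (rule finite_dim_image[OF value_module[OF Y x] mod[OF x] _ _ value_finite_dim[OF Y x],
        where f = "g x"])
      (auto intro!: linear_mapI simp: linear_map_add[OF gl[OF x]] linear_map_smult[OF gl[OF x]])
  have sub: "g x v \<in> carrier (fob Z x)" if "x \<in> Ob C" "v \<in> carrier (fob Y x)" for x v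
    using linear_map_closed[OF gl] that by blast
  have arr: "restrict (farr Z x y f) (g x ` carrier (fob Y x))
      \<in> linear_maps K ((fob Z x)\<lparr>carrier := g x ` carrier (fob Y x)\<rparr>)
          ((fob Z y)\<lparr>carrier := g y ` carrier (fob Y y)\<rparr>)"
    if xy: "x \<in> Ob C" "y \<in> Ob C" "f \<in> Mor C x y" for x y f
  proof -
    note lY = value_linear[OF Y xy] and lZ = value_linear[OF Z xy]
    have "linear_map K ((fob Z x)\<lparr>carrier := g x ` carrier (fob Y x)\<rparr>)
        ((fob Z y)\<lparr>carrier := g y ` carrier (fob Y y)\<rparr>) (farr Z x y f)"
      by (rule linear_mapI)
        (auto simp: component_natural[OF g xy] linear_map_closed[OF lY] sub xy
          linear_map_add[OF lZ] linear_map_smult[OF lZ])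
    from restrict_linear_maps[OF mod[OF xy(1)] this] show ?thesis by simp
  qed
  have F: "is_functor C (fd_vec K) ?Q"
    unfolding image_functor_def
  proof (rule is_functor_mk_func)
    fix x assume x: "x \<in> Ob C"
    have "farr Z x x (idm C x) = (\<lambda>v\<in>carrier (fob Z x). v)"
      using functor_id[OF is_functorD[OF Z] x] by simp
    moreover have "g x ` carrier (fob Y x) \<subseteq> carrier (fob Z x)" using sub[OF x] by auto
    ultimately show "restrict (farr Z x x (idm C x)) (g x ` carrier (fob Y x))
      = idm (fd_vec K) ((fob Z x)\<lparr>carrier := g x ` carrier (fob Y x)\<rparr>)"
      by (simp add: Int_absorb1)
  next
    fix x y z f h assume xyz: "x \<in> Ob C" "y \<in> Ob C" "z \<in> Ob C" "f \<in> Mor C x y" "h \<in> Mor C y z"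
    have "farr Z x z (cmp C x y z h f) = compose (carrier (fob Z x)) (farr Z y z h) (farr Z x y f)"
      using functor_cmp[OF is_functorD[OF Z] xyz] by (simp only: fd_vec_simps)
    then have "farr Z x z (cmp C x y z h f) (g x v) = farr Z y z h (farr Z x y f (g x v))"
      if "v \<in> carrier (fob Y x)" for v
      using sub[OF xyz(1) that] by (simp add: compose_def)
    moreover have "farr Z x y f (g x v) \<in> g y ` carrier (fob Y y)" if "v \<in> carrier (fob Y x)" for v
      using linear_map_closed[OF value_linear[OF Y xyz(1,2,4)] that] that xyz
      by (simp add: component_natural[OF g])
    ultimately show "restrict (farr Z x z (cmp C x y z h f)) (g x ` carrier (fob Y x))
      = cmp (fd_vec K) ((fob Z x)\<lparr>carrier := g x ` carrier (fob Y x)\<rparr>)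
        ((fob Z y)\<lparr>carrier := g y ` carrier (fob Y y)\<rparr>) ((fob Z z)\<lparr>carrier := g z ` carrier (fob Y z)\<rparr>)
        (restrict (farr Z y z h) (g y ` carrier (fob Y y))) (restrict (farr Z x y f) (g x `
            carrier (fob Y x)))"
      by (intro ext) (auto simp: restrict_def compose_def)
  qed (use mod fin arr category_axioms in auto)
  have "linear_map K (lin C x y) (lin (fd_vec K) (fob ?Q x) (fob ?Q y)) (farr ?Q x y)"
    if xy: "x \<in> Ob C" "y \<in> Ob C" for x y
  proof -
    have Zl: "linear_map K (lin C x y) (lin (fd_vec K) (fob Z x) (fob Z y)) (farr Z x y)"
      using Z xy by (simp add: is_linear_functor_def)
    have Zq: "farr ?Q x y f = restrict (farr Z x y f) (g x ` carrier (fob Y x))" if "f \<in> Mor C x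
        y" for f
      using that xy by (simp add: image_functor_def)
    show ?thesis
    proof (rule linear_mapI)
      fix f assume "f \<in> carrier (lin C x y)"
      then show "farr ?Q x y f \<in> carrier (lin (fd_vec K) (fob ?Q x) (fob ?Q y))"
        using functor_arr[OF F, of f x y] xy by (simp add: lin_carrier)
    next
      fix f h assume "f \<in> carrier (lin C x y)" "h \<in> carrier (lin C x y)"
      then show "farr ?Q x y (f \<oplus>\<^bsub>lin C x y\<^esub> h)
        = farr ?Q x y f \<oplus>\<^bsub>lin (fd_vec K) (fob ?Q x) (fob ?Q y)\<^esub> farr ?Q x y h"
        using linear_map_add[OF Zl, of f h] xy
        by (intro ext) (auto simp: restrict_def Zq lin_carrier add_mor_closed image_functor_fob sub)
    next
      fix c f assume "c \<in> carrier K" "f \<in> carrier (lin C x y)"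
      then show "farr ?Q x y (c \<odot>\<^bsub>lin C x y\<^esub> f)
        = c \<odot>\<^bsub>lin (fd_vec K) (fob ?Q x) (fob ?Q y)\<^esub> farr ?Q x y f"
        using linear_map_smult[OF Zl, of c f] xy
        by (intro ext) (auto simp: restrict_def Zq lin_carrier smult_mor_closed image_functor_fob sub)
    qed
  qed
  with F show ?thesis by (simp add: is_linear_functor_def)
qed

lemma image_functor_corestriction: "g \<in> nat_trans C (fd_vec K) Y (image_functor C g Y Z)"
proof -
  have "restrict g (Ob C) \<in> nat_trans C (fd_vec K) Y (image_functor C g Y Z)"
  proof (rule nat_trans_VectI[OF Y])
    fix x assume x: "x \<in> Ob C"
    show "g x \<in> linear_maps K (fob Y x) (fob (image_functor C g Y Z) x)"
      using nat_trans_arr[OF g x] by (auto simp: linear_maps_def linear_map_def image_functor_fob x)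
  qed (simp add: image_functor_farr)
  then show ?thesis
    using nat_trans_extensional[OF g] by (simp add: extensional_restrict)
qed

lemma image_functor_inclusion:
  "(\<lambda>x\<in>Ob C. \<lambda>v\<in>g x ` carrier (fob Y x). v) \<in> nat_trans C (fd_vec K) (image_functor C g Y Z) Z"
proof (rule nat_trans_VectI[OF image_functor_Ob])
  fix x assume x: "x \<in> Ob C"
  have "linear_map K (fob (image_functor C g Y Z) x) (fob Z x) (\<lambda>v. v)"
    by (rule linear_mapI) (auto simp: image_functor_fob x linear_map_closed[OF component_linear[OF
        g x]])
  from restrict_linear_maps[OF value_module[OF image_functor_Ob x] this]
  show "(\<lambda>v\<in>g x ` carrier (fob Y x). v) \<in> linear_maps K (fob (image_functor C g Y Z) x) (fob Z x)"
    by (simp add: image_functor_fob x)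
next
  fix x y f v
  assume xy: "x \<in> Ob C" "y \<in> Ob C" "f \<in> Mor C x y" and "v \<in> carrier (fob (image_functor C g Y Z) x)"
  then obtain u where u: "u \<in> carrier (fob Y x)" "v = g x u" by (auto simp: image_functor_fob)
  then show "farr Z x y f ((\<lambda>v\<in>g x ` carrier (fob Y x). v) v)
    = (\<lambda>v\<in>g y ` carrier (fob Y y). v) (farr (image_functor C g Y Z) x y f v)"
    using xy linear_map_closed[OF value_linear[OF Y xy] u(1)]
    by (simp add: image_functor_farr component_natural[OF g])
qed

end

lemma image_is_kernel:
  assumes X: "X \<in> Ob Vect_fun" and Y: "Y \<in> Ob Vect_fun" and Z: "Z \<in> Ob Vect_fun"
    and f: "f \<in> nat_trans C (fd_vec K) X Y" and g: "g \<in> nat_trans C (fd_vec K) Y Z"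
    and ker: "\<And>x. x \<in> Ob C \<Longrightarrow> f x ` carrier (fob X x) = {v \<in> carrier (fob Y x). g x v = \<zero>\<^bsub>fob Z x\<^esub>}"
  shows "is_kernel Vect_fun Y Z g (image_functor C f X Y) (\<lambda>x\<in>Ob C. \<lambda>v\<in>f x ` carrier (fob X x). v)"
    (is "is_kernel _ _ _ _ ?k ?i")
  unfolding is_kernel_def
proof (intro conjI ballI impI)
  note k = image_functor_Ob[OF X Y f] and i = image_functor_inclusion[OF X Y f]
  note kob = image_functor_fob[OF X Y f]
  show "?k \<in> Ob Vect_fun" by (rule k)
  show "?i \<in> Mor Vect_fun ?k Y" using i by simp
  have "f x u \<in> carrier (fob Y x) \<and> g x (f x u) = \<zero>\<^bsub>fob Z x\<^esub>" if "x \<in> Ob C" "u \<in> carrier (fob X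
      x)" for x u
    using ker[OF that(1)] that(2) by blast
  then show "cmp Vect_fun ?k Y Z g ?i = zero_mor Vect_fun ?k Z"
    by (auto intro!: restrict_ext simp: compose_def kob)
  fix W s assume W: "W \<in> Ob Vect_fun" and "s \<in> Mor Vect_fun W Y"
    and gs: "cmp Vect_fun W Y Z g s = zero_mor Vect_fun W Z"
  then have s: "s \<in> nat_trans C (fd_vec K) W Y" by simp
  have val: "s x v \<in> f x ` carrier (fob X x)" if x: "x \<in> Ob C" and v: "v \<in> carrier (fob W x)" for x v
  proof -
    have "g x (s x v) = \<zero>\<^bsub>fob Z x\<^esub>"
      using fun_cong[OF fun_cong[OF gs, of x], of v] x v by (simp add: compose_def)
    then show ?thesis
      using linear_map_closed[OF component_linear[OF s x] v] by (simp add: ker[OF x])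
  qed
  have "restrict s (Ob C) \<in> nat_trans C (fd_vec K) W ?k"
  proof (rule nat_trans_VectI[OF W])
    fix x assume x: "x \<in> Ob C"
    show "s x \<in> linear_maps K (fob W x) (fob ?k x)"
      using nat_trans_arr[OF s x] val[OF x] by (auto simp: linear_maps_def linear_map_def kob x)
  next
    fix x y h v assume xy: "x \<in> Ob C" "y \<in> Ob C" "h \<in> Mor C x y" "v \<in> carrier (fob W x)"
    then show "farr ?k x y h (s x v) = s y (farr W x y h v)"
      using val component_natural[OF s xy] by (simp add: image_functor_def)
  qed
  then have s': "s \<in> nat_trans C (fd_vec K) W ?k"
    using nat_trans_extensional[OF s] by (simp add: extensional_restrict)
  have is_s: "cmp Vect_fun W ?k Y ?i t = s \<longleftrightarrow> t = s" if t: "t \<in> nat_trans C (fd_vec K) W ?k" for t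
  proof -
    have tv: "t x v \<in> f x ` carrier (fob X x)" if "x \<in> Ob C" "v \<in> carrier (fob W x)" for x v
      using linear_map_closed[OF component_linear[OF t that(1)] that(2)] that(1) by (simp add: kob)
    have "cmp Vect_fun W ?k Y ?i t = t"
    proof (rule nat_trans_Vect_eqI)
      interpret A: linear_category K Vect_fun by (rule linear_category_Vect_fun)
      show "cmp Vect_fun W ?k Y ?i t \<in> nat_trans C (fd_vec K) W Y"
        using A.cmp_closed[OF W k Y, of t ?i] t i by simp
    qed (use t tv in \<open>auto simp: compose_def\<close>)
    then show ?thesis by simp
  qed
  show "\<exists>!t. t \<in> Mor Vect_fun W ?k \<and> cmp Vect_fun W ?k Y ?i t = s"
    using s' is_s by (intro ex1I[of _ s]) (auto simp del: lin_fun_cat_simps(4))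
qed

text \<open>A morphism \<open>s\<close> that kills \<open>f\<close> is constant on the fibres of \<open>g\<close>, as these are cosets of the image of
  \<open>f\<close>; so it descends to the image of \<open>g\<close>.\<close>

lemma image_is_cokernel:
  assumes X: "X \<in> Ob Vect_fun" and Y: "Y \<in> Ob Vect_fun" and Z: "Z \<in> Ob Vect_fun"
    and f: "f \<in> nat_trans C (fd_vec K) X Y" and g: "g \<in> nat_trans C (fd_vec K) Y Z"
    and ker: "\<And>x. x \<in> Ob C \<Longrightarrow> f x ` carrier (fob X x) = {v \<in> carrier (fob Y x). g x v = \<zero>\<^bsub>fob Z x\<^esub>}"
  shows "is_cokernel Vect_fun X Y f (image_functor C g Y Z) g" (is "is_cokernel _ _ _ _ ?q _")
  unfolding is_cokernel_def
proof (intro conjI ballI impI)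
  note q = image_functor_Ob[OF Y Z g] and p = image_functor_corestriction[OF Y Z g]
  note qob = image_functor_fob[OF Y Z g]
  show "?q \<in> Ob Vect_fun" by (rule q)
  show "g \<in> Mor Vect_fun Y ?q" using p by simp
  have "g x (f x u) = \<zero>\<^bsub>fob Z x\<^esub>" if "x \<in> Ob C" "u \<in> carrier (fob X x)" for x u
    using ker[OF that(1)] that(2) by blast
  then show "cmp Vect_fun X Y ?q g f = zero_mor Vect_fun X ?q"
    by (auto intro!: restrict_ext simp: compose_def qob)
  fix W s assume W: "W \<in> Ob Vect_fun" and "s \<in> Mor Vect_fun Y W"
    and sf: "cmp Vect_fun X Y W s f = zero_mor Vect_fun X W"
  then have s: "s \<in> nat_trans C (fd_vec K) Y W" by simp
  have sf0: "s x (f x u) = \<zero>\<^bsub>fob W x\<^esub>" if "x \<in> Ob C" "u \<in> carrier (fob X x)" for x u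
    using fun_cong[OF fun_cong[OF sf, of x], of u] that by (simp add: compose_def)
  have wd: "s x u = s x v" if x: "x \<in> Ob C" and uv: "u \<in> carrier (fob Y x)" "v \<in> carrier (fob Y x)"
    and eq: "g x u = g x v" for x u v
  proof -
    interpret Y: module K "fob Y x" by (rule value_module[OF Y x])
    interpret Z: module K "fob Z x" by (rule value_module[OF Z x])
    interpret W: module K "fob W x" by (rule value_module[OF W x])
    let ?d = "u \<oplus>\<^bsub>fob Y x\<^esub> (\<ominus>\<^bsub>K\<^esub> \<one>\<^bsub>K\<^esub>) \<odot>\<^bsub>fob Y x\<^esub> v"
    note gl = component_linear[OF g x] and sl = component_linear[OF s x]
    have d: "?d \<in> carrier (fob Y x)" using uv by simp
    have "g x ?d = \<zero>\<^bsub>fob Z x\<^esub>"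
      using uv eq linear_map_closed[OF gl uv(2)]
      by (simp add: linear_map_add[OF gl] linear_map_smult[OF gl] Z.smult_l_minus Z.M.r_neg)
    with d have "?d \<in> f x ` carrier (fob X x)" by (simp add: ker[OF x])
    then have "s x ?d = \<zero>\<^bsub>fob W x\<^esub>" using sf0[OF x] by auto
    then have 0: "s x u \<oplus>\<^bsub>fob W x\<^esub> (\<ominus>\<^bsub>fob W x\<^esub> (s x v)) = \<zero>\<^bsub>fob W x\<^esub>"
      using uv linear_map_closed[OF sl uv(2)]
      by (simp add: linear_map_add[OF sl] linear_map_smult[OF sl] W.smult_l_minus)
    have "\<ominus>\<^bsub>fob W x\<^esub> (\<ominus>\<^bsub>fob W x\<^esub> (s x v)) = s x u"
      using 0 linear_map_closed[OF sl uv(1)] linear_map_closed[OF sl uv(2)]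
      by (intro W.M.minus_equality) auto
    then show ?thesis using linear_map_closed[OF sl uv(2)] by simp
  qed
  define h where "h x = (\<lambda>w\<in>g x ` carrier (fob Y x). s x (SOME v. v \<in> carrier (fob Y x) \<and> g x v =
      w))" for x
  have hg: "h x (g x v) = s x v" if "x \<in> Ob C" "v \<in> carrier (fob Y x)" for x v
  proof -
    let ?v = "SOME u. u \<in> carrier (fob Y x) \<and> g x u = g x v"
    have "?v \<in> carrier (fob Y x) \<and> g x ?v = g x v"
      by (rule someI[of "\<lambda>u. u \<in> carrier (fob Y x) \<and> g x u = g x v" v]) (use that in auto)
    then have "s x ?v = s x v" using that by (intro wd) auto
    then show ?thesis using that by (simp add: h_def)
  qed
  have "restrict h (Ob C) \<in> nat_trans C (fd_vec K) ?q W"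
  proof (rule nat_trans_VectI[OF q])
    fix x assume x: "x \<in> Ob C"
    interpret Y: module K "fob Y x" by (rule value_module[OF Y x])
    note gl = component_linear[OF g x] and sl = component_linear[OF s x]
    have "linear_map K (fob ?q x) (fob W x) (h x)"
    proof (rule linear_mapI)
      fix u v assume "u \<in> carrier (fob ?q x)" "v \<in> carrier (fob ?q x)"
      then obtain u' v' where uv: "u' \<in> carrier (fob Y x)" "u = g x u'" "v' \<in> carrier (fob Y x)"
          "v = g x v'"
        by (auto simp: qob x)
      then have "h x (g x (u' \<oplus>\<^bsub>fob Y x\<^esub> v')) = h x u \<oplus>\<^bsub>fob W x\<^esub> h x v"
        using x by (simp add: hg linear_map_add[OF sl])
      then show "h x (u \<oplus>\<^bsub>fob ?q x\<^esub> v) = h x u \<oplus>\<^bsub>fob W x\<^esub> h x v"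
        using uv by (simp add: qob x linear_map_add[OF gl])
    next
      fix c u assume c: "c \<in> carrier K" and "u \<in> carrier (fob ?q x)"
      then obtain u' where u: "u' \<in> carrier (fob Y x)" "u = g x u'" by (auto simp: qob x)
      then have "h x (g x (c \<odot>\<^bsub>fob Y x\<^esub> u')) = c \<odot>\<^bsub>fob W x\<^esub> h x u"
        using x c by (simp add: hg linear_map_smult[OF sl])
      then show "h x (c \<odot>\<^bsub>fob ?q x\<^esub> u) = c \<odot>\<^bsub>fob W x\<^esub> h x u"
        using u c by (simp add: qob x linear_map_smult[OF gl])
    qed (use x in \<open>auto simp: qob hg linear_map_closed[OF sl]\<close>)
    then show "h x \<in> linear_maps K (fob ?q x) (fob W x)"
      by (simp add: linear_maps_def h_def qob x)
  next
    fix x y a w assume xy: "x \<in> Ob C" "y \<in> Ob C" "a \<in> Mor C x y" and "w \<in> carrier (fob ?q x)"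
    then obtain v where v: "v \<in> carrier (fob Y x)" "w = g x v" by (auto simp: qob)
    then show "farr W x y a (h x w) = h y (farr ?q x y a w)"
      using xy linear_map_closed[OF value_linear[OF Y xy] v(1)]
      by (simp add: hg image_functor_farr[OF Y Z g] component_natural[OF s])
  qed
  then have h: "restrict h (Ob C) \<in> nat_trans C (fd_vec K) ?q W" .
  interpret A: linear_category K Vect_fun by (rule linear_category_Vect_fun)
  show "\<exists>!t. t \<in> Mor Vect_fun ?q W \<and> cmp Vect_fun Y ?q W t g = s"
  proof (rule ex1I[of _ "restrict h (Ob C)"])
    have "cmp Vect_fun Y ?q W (restrict h (Ob C)) g \<in> nat_trans C (fd_vec K) Y W"
      using A.cmp_closed[OF Y q W, of g "restrict h (Ob C)"] p h by simp
    then have "cmp Vect_fun Y ?q W (restrict h (Ob C)) g = s"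
      using s by (rule nat_trans_Vect_eqI) (simp add: compose_def hg)
    with h show "restrict h (Ob C) \<in> Mor Vect_fun ?q W \<and> cmp Vect_fun Y ?q W (restrict h (Ob C)) g = s"
      by simp
  next
    fix t assume "t \<in> Mor Vect_fun ?q W \<and> cmp Vect_fun Y ?q W t g = s"
    then have t: "t \<in> nat_trans C (fd_vec K) ?q W" and tg: "cmp Vect_fun Y ?q W t g = s" by auto
    have "t x (g x v) = s x v" if "x \<in> Ob C" "v \<in> carrier (fob Y x)" for x v
      using fun_cong[OF fun_cong[OF tg, of x], of v] that by (simp add: compose_def)
    then show "t = restrict h (Ob C)"
      by (intro nat_trans_Vect_eqI[OF t h]) (auto simp: qob hg)
  qed
qed

text \<open>Corestricting \<open>g\<close> to its image does not change its kernel, so the image of \<open>f\<close> is a kernel of the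
  cokernel of \<open>f\<close> and of \<open>g\<close> at once.\<close>

lemma exact_at_pointwise:
  assumes X: "X \<in> Ob Vect_fun" and Y: "Y \<in> Ob Vect_fun" and Z: "Z \<in> Ob Vect_fun"
    and f: "f \<in> nat_trans C (fd_vec K) X Y" and g: "g \<in> nat_trans C (fd_vec K) Y Z"
    and ker: "\<And>x. x \<in> Ob C \<Longrightarrow> f x ` carrier (fob X x) = {v \<in> carrier (fob Y x). g x v = \<zero>\<^bsub>fob Z x\<^esub>}"
  shows "exact_at Vect_fun X Y Z f g"
proof -
  have "is_kernel Vect_fun Y (image_functor C g Y Z) g (image_functor C f X Y)
      (\<lambda>x\<in>Ob C. \<lambda>v\<in>f x ` carrier (fob X x). v)"
    using image_is_kernel[OF X Y image_functor_Ob[OF Y Z g] f image_functor_corestriction[OF Y Z g]]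
      ker by (simp add: image_functor_fob[OF Y Z g])
  then show ?thesis
    unfolding exact_at_def
    using image_is_kernel[OF X Y Z f g ker] image_is_cokernel[OF X Y Z f g ker] f g by auto
qed

end


section \<open>Coordinates on the quotient of the linear envelope\<close>

lemma linear_category_op:
  assumes "linear_category K C"
  shows "linear_category K (op_lcat C)"
proof -
  interpret C: linear_category K C by fact
  show ?thesis
    by (intro linear_category.intro linear_category_axioms.intro category.intro)
      (simp_all add: op_lcat_def C.idm_closed C.cmp_closed C.cmp_idm_left C.cmp_idm_right C.cmp_assoc
        C.lin_module C.lin_carrier C.cmp_linear_left C.cmp_linear_right)
qed

definition scalar_module :: "('k, 'r) ring_scheme \<Rightarrow> ('k, 'k) module" where
  "scalar_module K = mk_module (carrier K) \<zero>\<^bsub>K\<^esub> (add K) (monoid.mult K)"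

lemma scalar_module_simps [simp]:
  "carrier (scalar_module K) = carrier K" "\<zero>\<^bsub>scalar_module K\<^esub> = \<zero>\<^bsub>K\<^esub>"
  "u \<oplus>\<^bsub>scalar_module K\<^esub> v = u \<oplus>\<^bsub>K\<^esub> v" "c \<odot>\<^bsub>scalar_module K\<^esub> v = c \<otimes>\<^bsub>K\<^esub> v"
  by (simp_all add: scalar_module_def)

lemma module_scalar_module:
  assumes "cring K"
  shows "module K (scalar_module K)"
proof -
  interpret K: cring K by fact
  show ?thesis
  proof (rule moduleI)
    show "abelian_group (scalar_module K)"
    proof (rule abelian_groupI)
      fix x assume "x \<in> carrier (scalar_module K)"
      then show "\<exists>y\<in>carrier (scalar_module K). y \<oplus>\<^bsub>scalar_module K\<^esub> x = \<zero>\<^bsub>scalar_module K\<^esub>"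
        by (intro bexI[of _ "\<ominus>\<^bsub>K\<^esub> x"]) (simp_all add: K.l_neg)
    qed (simp_all add: K.a_ac)
  qed (simp_all add: K.cring_axioms K.l_distr K.r_distr K.m_assoc)
qed

text \<open>The multiple \<open>c\<close> of the unique morphism \<open>\<sigma> \<rightarrow> \<tau>\<close> in the linear envelope; if \<open>\<sigma> \<le> \<tau>\<close> fails, the
  zero morphism.\<close>

definition multiple :: "('k, 'r) ring_scheme \<Rightarrow> nat \<Rightarrow> simplex \<Rightarrow> simplex \<Rightarrow> 'k \<Rightarrow> simplex \<times> simplex \<Rightarrow> 'k"
  where "multiple K m \<sigma> \<tau> c = (\<lambda>u. if u = (\<sigma>, \<tau>) \<and> (\<forall>i\<le>m. \<sigma> i \<le> \<tau> i) then c else \<zero>\<^bsub>K\<^esub>)"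

text \<open>The residue class of \<open>multiple K m \<sigma> \<tau> c\<close>. If \<open>\<sigma>\<close> and \<open>\<tau>\<close> interlace,
  only zero factors through degenerate simplices; otherwise all morphisms do.\<close>

definition residue :: "('k, 'r) ring_scheme \<Rightarrow> nat \<Rightarrow> simplex \<Rightarrow> simplex \<Rightarrow> 'k
    \<Rightarrow> (simplex \<times> simplex \<Rightarrow> 'k) set"
  where "residue K m \<sigma> \<tau> c =
    (if interlaced m \<sigma> \<tau> then {multiple K m \<sigma> \<tau> c} else multiple K m \<sigma> \<tau> ` carrier K)"

lemma residue_not_interlaced:
  "\<not> interlaced m \<sigma> \<tau> \<Longrightarrow> residue K m \<sigma> \<tau> c = multiple K m \<sigma> \<tau> ` carrier K"
  by (simp add: residue_def)

lemma residue_inj: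
  "\<lbrakk>interlaced m \<sigma> \<tau>; residue K m \<sigma> \<tau> c = residue K m \<sigma> \<tau> d\<rbrakk> \<Longrightarrow> c = d"
  by (auto simp: residue_def multiple_def interlaced_le dest: fun_cong[of _ _ "(\<sigma>, \<tau>)"])

locale scalar_field = field K for K :: "('k, 'r) ring_scheme"
begin

lemma multiple_zero: "multiple K m \<sigma> \<tau> \<zero>\<^bsub>K\<^esub> = (\<lambda>_. \<zero>\<^bsub>K\<^esub>)"
  by (simp add: multiple_def)

lemma basis_elt_multiple: "\<forall>i\<le>m. \<sigma> i \<le> \<tau> i \<Longrightarrow> basis_elt K (\<sigma>, \<tau>) = multiple K m \<sigma> \<tau> \<one>\<^bsub>K\<^esub>"
  by (auto simp: basis_elt_def multiple_def)

lemma formal_sums_Delta: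
  "formal_sums K (Mor (Delta m n) \<sigma> \<tau>) = multiple K m \<sigma> \<tau> ` carrier K"
proof (intro equalityI subsetI)
  fix f assume f: "f \<in> formal_sums K (Mor (Delta m n) \<sigma> \<tau>)"
  have "f = multiple K m \<sigma> \<tau> (f (\<sigma>, \<tau>))"
  proof (rule ext)
    fix u
    have "u \<notin> Mor (Delta m n) \<sigma> \<tau> \<Longrightarrow> f u = \<zero>\<^bsub>K\<^esub>" using f unfolding formal_sums_def by blast
    then show "f u = multiple K m \<sigma> \<tau> (f (\<sigma>, \<tau>)) u"
      by (cases "u \<in> Mor (Delta m n) \<sigma> \<tau>") (auto simp: multiple_def)
  qed
  moreover have "f (\<sigma>, \<tau>) \<in> carrier K" using f unfolding formal_sums_def by blast
  ultimately show "f \<in> multiple K m \<sigma> \<tau> ` carrier K" by blast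
next
  fix f assume "f \<in> multiple K m \<sigma> \<tau> ` carrier K"
  then obtain c where c: "c \<in> carrier K" "f = multiple K m \<sigma> \<tau> c" by blast
  have "finite {a. f a \<noteq> \<zero>\<^bsub>K\<^esub>}"
    by (rule finite_subset[of _ "{(\<sigma>, \<tau>)}"]) (auto simp: c multiple_def)
  with c show "f \<in> formal_sums K (Mor (Delta m n) \<sigma> \<tau>)"
    by (auto simp: formal_sums_def multiple_def)
qed

lemma KDelta_simps:
  "Ob (KDelta K m n) = simplices m n"
  "Mor (KDelta K m n) \<sigma> \<tau> = multiple K m \<sigma> \<tau> ` carrier K"
  "carrier (lin (KDelta K m n) \<sigma> \<tau>) = multiple K m \<sigma> \<tau> ` carrier K"
  "\<zero>\<^bsub>lin (KDelta K m n) \<sigma> \<tau>\<^esub> = multiple K m \<sigma> \<tau> \<zero>\<^bsub>K\<^esub>"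
  using formal_sums_Delta by (simp_all add: KDelta_def lin_envelope_def multiple_zero)

lemma KDelta_idm: "idm (KDelta K m n) \<sigma> = multiple K m \<sigma> \<sigma> \<one>\<^bsub>K\<^esub>"
  by (simp add: KDelta_def lin_envelope_def basis_elt_multiple)

lemma KDelta_add: "\<lbrakk>c \<in> carrier K; d \<in> carrier K\<rbrakk> \<Longrightarrow>
    multiple K m \<sigma> \<tau> c \<oplus>\<^bsub>lin (KDelta K m n) \<sigma> \<tau>\<^esub> multiple K m \<sigma> \<tau> d = multiple K m \<sigma> \<tau> (c \<oplus>\<^bsub>K\<^esub> d)"
  by (rule ext) (auto simp: KDelta_def lin_envelope_def multiple_def)

lemma KDelta_smult: "\<lbrakk>c \<in> carrier K; d \<in> carrier K\<rbrakk> \<Longrightarrow>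
    c \<odot>\<^bsub>lin (KDelta K m n) \<sigma> \<tau>\<^esub> multiple K m \<sigma> \<tau> d = multiple K m \<sigma> \<tau> (c \<otimes>\<^bsub>K\<^esub> d)"
  by (rule ext) (auto simp: KDelta_def lin_envelope_def multiple_def)

lemma KDelta_cmp:
  assumes "c \<in> carrier K" "d \<in> carrier K"
  shows "cmp (KDelta K m n) \<rho> \<sigma> \<tau> (multiple K m \<sigma> \<tau> c) (multiple K m \<rho> \<sigma> d)
    = multiple K m \<rho> \<tau> (if (\<forall>i\<le>m. \<rho> i \<le> \<sigma> i) \<and> (\<forall>i\<le>m. \<sigma> i \<le> \<tau> i) then c \<otimes>\<^bsub>K\<^esub> d else \<zero>\<^bsub>K\<^esub>)"
proof
  fix u
  let ?le = "(\<forall>i\<le>m. \<rho> i \<le> \<sigma> i) \<and> (\<forall>i\<le>m. \<sigma> i \<le> \<tau> i)"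
  let ?S = "{(b, a). b \<in> Mor (Delta m n) \<sigma> \<tau> \<and> a \<in> Mor (Delta m n) \<rho> \<sigma> \<and>
    multiple K m \<sigma> \<tau> c b \<noteq> \<zero>\<^bsub>K\<^esub> \<and> multiple K m \<rho> \<sigma> d a \<noteq> \<zero>\<^bsub>K\<^esub> \<and> cmp (Delta m n) \<rho> \<sigma> \<tau> b a = u}"
  have S: "?S = (if ?le \<and> c \<noteq> \<zero>\<^bsub>K\<^esub> \<and> d \<noteq> \<zero>\<^bsub>K\<^esub> \<and> u = (\<rho>, \<tau>) then {((\<sigma>, \<tau>), (\<rho>, \<sigma>))} else {})"
    by (auto simp: multiple_def)
  have le: "\<forall>i\<le>m. \<rho> i \<le> \<tau> i" if ?le using that by (auto intro: le_trans)
  have "cmp (KDelta K m n) \<rho> \<sigma> \<tau> (multiple K m \<sigma> \<tau> c) (multiple K m \<rho> \<sigma> d) u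
    = (\<Oplus>\<^bsub>K\<^esub>p\<in>?S. multiple K m \<sigma> \<tau> c (fst p) \<otimes>\<^bsub>K\<^esub> multiple K m \<rho> \<sigma> d (snd p))"
    by (simp add: KDelta_def lin_envelope_def)
  also have "\<dots> = (if ?le \<and> c \<noteq> \<zero>\<^bsub>K\<^esub> \<and> d \<noteq> \<zero>\<^bsub>K\<^esub> \<and> u = (\<rho>, \<tau>) then c \<otimes>\<^bsub>K\<^esub> d else \<zero>\<^bsub>K\<^esub>)"
    unfolding S using assms by (auto simp: multiple_def)
  also have "\<dots> = multiple K m \<rho> \<tau> (if ?le then c \<otimes>\<^bsub>K\<^esub> d else \<zero>\<^bsub>K\<^esub>) u"
    using le assms by (auto simp: multiple_def)
  finally show "cmp (KDelta K m n) \<rho> \<sigma> \<tau> (multiple K m \<sigma> \<tau> c) (multiple K m \<rho> \<sigma> d) u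
    = multiple K m \<rho> \<tau> (if ?le then c \<otimes>\<^bsub>K\<^esub> d else \<zero>\<^bsub>K\<^esub>) u" .
qed

lemma module_lin_KDelta: "module K (lin (KDelta K m n) \<sigma> \<tau>)"
  by (rule module_surj_image[OF module_scalar_module[OF cring_axioms], where f = "multiple K m \<sigma> \<tau>"])
    (simp_all add: KDelta_simps KDelta_add KDelta_smult)

text \<open>A single degenerate simplex between \<open>\<sigma>\<close> and \<open>\<tau>\<close> already lets all multiples of \<open>\<sigma> \<rightarrow> \<tau>\<close> factor.\<close>

lemma deg_ideal_eq:
  assumes s: "\<sigma> \<in> simplices m n" and t: "\<tau> \<in> simplices m n"
  shows "deg_ideal K m n \<sigma> \<tau> = residue K m \<sigma> \<tau> \<zero>\<^bsub>K\<^esub>"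
proof -
  let ?L = "lin (KDelta K m n) \<sigma> \<tau>"
  interpret L: module K ?L by (rule module_lin_KDelta)
  let ?gen = "\<lambda>N. \<forall>\<kappa>\<in>degenerate m n. \<forall>g\<in>Mor (KDelta K m n) \<sigma> \<kappa>. \<forall>h\<in>Mor (KDelta K m n) \<kappa> \<tau>.
    cmp (KDelta K m n) \<sigma> \<kappa> \<tau> h g \<in> N"
  have zero: "multiple K m \<sigma> \<tau> \<zero>\<^bsub>K\<^esub> \<in> N" if "submodule N K ?L" for N
    using subgroup.one_closed[OF submodule.axioms(1)[OF that]] by (simp add: KDelta_simps)
  show ?thesis
  proof (cases "interlaced m \<sigma> \<tau>")
    case True
    have "?gen {multiple K m \<sigma> \<tau> \<zero>\<^bsub>K\<^esub>}"
      using interlaced_iff_no_degenerate_between[OF s t] interlaced_le[OF True] True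
      by (auto simp: KDelta_simps KDelta_cmp)
    moreover have "submodule {multiple K m \<sigma> \<tau> \<zero>\<^bsub>K\<^esub>} K ?L"
    proof (rule L.submoduleI)
      show "\<ominus>\<^bsub>?L\<^esub> a \<in> {multiple K m \<sigma> \<tau> \<zero>\<^bsub>K\<^esub>}" if "a \<in> {multiple K m \<sigma> \<tau> \<zero>\<^bsub>K\<^esub>}" for a
        using that L.add.inv_one by (simp add: KDelta_simps a_inv_def)
    qed (auto simp: KDelta_simps KDelta_add KDelta_smult)
    ultimately have "deg_ideal K m n \<sigma> \<tau> = {multiple K m \<sigma> \<tau> \<zero>\<^bsub>K\<^esub>}"
      unfolding deg_ideal_def factor_through_def using zero by blast
    then show ?thesis using True by (simp add: residue_def)
  next
    case False
    have "multiple K m \<sigma> \<tau> c \<in> N" if N: "submodule N K ?L" "?gen N" and c: "c \<in> carrier K" for N c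
    proof (cases "\<forall>i\<le>m. \<sigma> i \<le> \<tau> i")
      case True
      then obtain \<kappa> where \<kappa>: "\<kappa> \<in> degenerate m n" "\<forall>i\<le>m. \<sigma> i \<le> \<kappa> i" "\<forall>i\<le>m. \<kappa> i \<le> \<tau> i"
        using interlaced_iff_no_degenerate_between[OF s t] False by auto
      have "cmp (KDelta K m n) \<sigma> \<kappa> \<tau> (multiple K m \<kappa> \<tau> c) (multiple K m \<sigma> \<kappa> \<one>\<^bsub>K\<^esub>) \<in> N"
        using N(2) \<kappa>(1) c by (auto simp: KDelta_simps)
      then show ?thesis using \<kappa> c by (simp add: KDelta_cmp)
    next
      case False
      then have "multiple K m \<sigma> \<tau> c = multiple K m \<sigma> \<tau> \<zero>\<^bsub>K\<^esub>"
        unfolding multiple_def by (intro ext) (use False in auto)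
      then show ?thesis using zero[OF N(1)] by (simp only:)
    qed
    moreover have "submodule (multiple K m \<sigma> \<tau> ` carrier K) K ?L"
      using L.carrier_is_submodule by (simp add: KDelta_simps)
    moreover have "?gen (multiple K m \<sigma> \<tau> ` carrier K)"
      by (auto simp: KDelta_simps KDelta_cmp)
    ultimately have "deg_ideal K m n \<sigma> \<tau> = multiple K m \<sigma> \<tau> ` carrier K"
      unfolding deg_ideal_def factor_through_def by blast
    then show ?thesis using False by (simp add: residue_def)
  qed
qed

lemma deg_ideal_coset:
  assumes "\<sigma> \<in> simplices m n" "\<tau> \<in> simplices m n" and c: "c \<in> carrier K"
  shows "deg_ideal K m n \<sigma> \<tau> +>\<^bsub>lin (KDelta K m n) \<sigma> \<tau>\<^esub> multiple K m \<sigma> \<tau> c = residue K m \<sigma> \<tau> c"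
proof (cases "interlaced m \<sigma> \<tau>")
  case True
  then show ?thesis
    using c by (simp add: deg_ideal_eq assms residue_def a_r_coset_def' KDelta_add)
next
  case False
  have "multiple K m \<sigma> \<tau> d \<in> (\<Union>a\<in>carrier K. {multiple K m \<sigma> \<tau> (a \<oplus>\<^bsub>K\<^esub> c)})" if "d \<in> carrier K" for d
    using that c by (intro UN_I[of "d \<ominus>\<^bsub>K\<^esub> c"]) (simp_all add: a_minus_def a_assoc l_neg)
  then show ?thesis
    using False c by (auto simp: deg_ideal_eq assms residue_def a_r_coset_def' KDelta_add)
qed

lemma uKDelta_Ob [simp]: "Ob (uKDelta K m n) = simplices m n"
  by (simp add: uKDelta_def quotient_cat_def KDelta_simps)

context
  fixes m n :: nat and \<sigma> \<tau> :: simplex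
  assumes s: "\<sigma> \<in> simplices m n" and t: "\<tau> \<in> simplices m n"
begin

lemma uKDelta_Mor: "Mor (uKDelta K m n) \<sigma> \<tau> = residue K m \<sigma> \<tau> ` carrier K"
  using deg_ideal_coset[OF s t]
  by (auto simp: uKDelta_def quotient_cat_def A_RCOSETS_def' KDelta_simps)

lemma uKDelta_carrier: "carrier (lin (uKDelta K m n) \<sigma> \<tau>) = residue K m \<sigma> \<tau> ` carrier K"
  using uKDelta_Mor by (simp add: uKDelta_def quotient_cat_def)

lemma uKDelta_zero: "\<zero>\<^bsub>lin (uKDelta K m n) \<sigma> \<tau>\<^esub> = residue K m \<sigma> \<tau> \<zero>\<^bsub>K\<^esub>"
  by (simp add: uKDelta_def quotient_cat_def deg_ideal_eq[OF s t])

lemma uKDelta_add: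
  assumes c: "c \<in> carrier K" and d: "d \<in> carrier K"
  shows "residue K m \<sigma> \<tau> c \<oplus>\<^bsub>lin (uKDelta K m n) \<sigma> \<tau>\<^esub> residue K m \<sigma> \<tau> d
    = residue K m \<sigma> \<tau> (c \<oplus>\<^bsub>K\<^esub> d)"
proof (cases "interlaced m \<sigma> \<tau>")
  case True
  then show ?thesis
    using c d by (simp add: uKDelta_def quotient_cat_def residue_def set_add_def' KDelta_add)
next
  case False
  have "multiple K m \<sigma> \<tau> a \<in> (\<Union>b\<in>carrier K. \<Union>d\<in>carrier K. {multiple K m \<sigma> \<tau> (b \<oplus>\<^bsub>K\<^esub> d)})"
    if "a \<in> carrier K" for a
    using that by (intro UN_I[of a] UN_I[of "\<zero>\<^bsub>K\<^esub>"]) simp_all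
  with False show ?thesis
    by (auto simp: uKDelta_def quotient_cat_def residue_def set_add_def' KDelta_add)
qed

lemma uKDelta_smult:
  assumes c: "c \<in> carrier K" and d: "d \<in> carrier K"
  shows "c \<odot>\<^bsub>lin (uKDelta K m n) \<sigma> \<tau>\<^esub> residue K m \<sigma> \<tau> d = residue K m \<sigma> \<tau> (c \<otimes>\<^bsub>K\<^esub> d)"
proof -
  have "c \<odot>\<^bsub>lin (uKDelta K m n) \<sigma> \<tau>\<^esub> residue K m \<sigma> \<tau> d
    = (\<Union>f\<in>residue K m \<sigma> \<tau> d. deg_ideal K m n \<sigma> \<tau> +>\<^bsub>lin (KDelta K m n) \<sigma> \<tau>\<^esub> (c \<odot>\<^bsub>lin (KDelta K m
        n) \<sigma> \<tau>\<^esub> f))"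
    by (simp add: uKDelta_def quotient_cat_def)
  also have "\<dots> = residue K m \<sigma> \<tau> (c \<otimes>\<^bsub>K\<^esub> d)"
  proof (cases "interlaced m \<sigma> \<tau>")
    case True
    then have "residue K m \<sigma> \<tau> d = {multiple K m \<sigma> \<tau> d}" by (simp add: residue_def)
    then show ?thesis using c d by (simp add: KDelta_smult deg_ideal_coset s t)
  next
    case False
    then have "residue K m \<sigma> \<tau> d = multiple K m \<sigma> \<tau> ` carrier K" by (simp add: residue_def)
    then show ?thesis
      using c
      by (auto simp: residue_not_interlaced[OF False] KDelta_smult deg_ideal_coset s t)
  qed
  finally show ?thesis .
qed

end

lemma uKDelta_idm: "\<sigma> \<in> simplices m n \<Longrightarrow> idm (uKDelta K m n) \<sigma> = residue K m \<sigma> \<sigma> \<one>\<^bsub>K\<^esub>"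
  by (simp add: uKDelta_def quotient_cat_def KDelta_idm deg_ideal_coset)

text \<open>If \<open>\<rho>\<close> and \<open>\<tau>\<close> interlace, then so does any simplex between them with both. Hence a composite in
  which one factor is not interlacing is zero, whatever the representatives.\<close>

lemma uKDelta_cmp:
  assumes r: "\<rho> \<in> simplices m n" and s: "\<sigma> \<in> simplices m n" and t: "\<tau> \<in> simplices m n"
    and c: "c \<in> carrier K" and d: "d \<in> carrier K"
  shows "cmp (uKDelta K m n) \<rho> \<sigma> \<tau> (residue K m \<sigma> \<tau> c) (residue K m \<rho> \<sigma> d)
    = residue K m \<rho> \<tau> (if interlaced m \<rho> \<sigma> \<and> interlaced m \<sigma> \<tau> then c \<otimes>\<^bsub>K\<^esub> d else \<zero>\<^bsub>K\<^esub>)"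
proof -
  let ?le = "(\<forall>i\<le>m. \<rho> i \<le> \<sigma> i) \<and> (\<forall>i\<le>m. \<sigma> i \<le> \<tau> i)"
  let ?il = "interlaced m \<rho> \<sigma> \<and> interlaced m \<sigma> \<tau>"
  let ?U = "cmp (uKDelta K m n) \<rho> \<sigma> \<tau> (residue K m \<sigma> \<tau> c) (residue K m \<rho> \<sigma> d)"
  have U: "?U = (\<Union>g\<in>residue K m \<sigma> \<tau> c. \<Union>f\<in>residue K m \<rho> \<sigma> d.
      deg_ideal K m n \<rho> \<tau> +>\<^bsub>lin (KDelta K m n) \<rho> \<tau>\<^esub> cmp (KDelta K m n) \<rho> \<sigma> \<tau> g f)"
    by (simp add: uKDelta_def quotient_cat_def)
  show ?thesis
  proof (cases ?il)
    case True
    then have "residue K m \<sigma> \<tau> c = {multiple K m \<sigma> \<tau> c}" "residue K m \<rho> \<sigma> d = {multiple K m \<rho> \<sigma> d}"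
      by (auto simp: residue_def)
    then show ?thesis
      unfolding U using True c d interlaced_le[of m \<rho> \<sigma>] interlaced_le[of m \<sigma> \<tau>]
      by (simp add: KDelta_cmp deg_ideal_coset r t)
  next
    case False
    have const: "deg_ideal K m n \<rho> \<tau> +>\<^bsub>lin (KDelta K m n) \<rho> \<tau>\<^esub> cmp (KDelta K m n) \<rho> \<sigma> \<tau> g f
        = residue K m \<rho> \<tau> \<zero>\<^bsub>K\<^esub>" if g: "g \<in> residue K m \<sigma> \<tau> c" and f: "f \<in> residue K m \<rho> \<sigma> d" for g f
    proof -
      obtain a b where ab: "a \<in> carrier K" "b \<in> carrier K" "g = multiple K m \<sigma> \<tau> a" "f = multiple
          K m \<rho> \<sigma> b"
        using g f c d unfolding residue_def by (metis imageE singletonD)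
      have "?le \<longrightarrow> \<not> interlaced m \<rho> \<tau>"
        using False interlaced_between[of m \<rho> \<tau> \<sigma>] by blast
      then show ?thesis
        using ab
        by (auto simp: residue_not_interlaced KDelta_cmp deg_ideal_coset r t)
    qed
    have "residue K m \<sigma> \<tau> c \<noteq> {}" "residue K m \<rho> \<sigma> d \<noteq> {}"
      by (auto simp: residue_def)
    then have "?U = residue K m \<rho> \<tau> \<zero>\<^bsub>K\<^esub>" unfolding U using const by auto
    then show ?thesis using False by auto
  qed
qed

lemma linear_category_uKDelta: "linear_category K (uKDelta K m n)"
proof (intro linear_category.intro linear_category_axioms.intro category.intro, goal_cases)
  case (1 x)
  then show ?case by (simp add: uKDelta_idm uKDelta_Mor)
next
  case (2 x y z f g)
  then show ?case by (auto simp: uKDelta_Mor uKDelta_cmp)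
next
  case (3 x y f)
  then obtain c where c: "c \<in> carrier K" "f = residue K m x y c" by (auto simp: uKDelta_Mor)
  have "interlaced m x y \<Longrightarrow> interlaced m x x"
    using interlaced_between(1)[of m x y x] by (simp add: interlaced_le)
  moreover have "cmp (uKDelta K m n) x x y f (idm (uKDelta K m n) x)
      = residue K m x y (if interlaced m x x \<and> interlaced m x y then c \<otimes>\<^bsub>K\<^esub> \<one>\<^bsub>K\<^esub> else \<zero>\<^bsub>K\<^esub>)"
    using 3 c by (simp add: uKDelta_idm uKDelta_cmp)
  ultimately show ?case
    using c by (cases "interlaced m x y") (simp_all add: residue_not_interlaced)
next
  case (4 x y f)
  then obtain c where c: "c \<in> carrier K" "f = residue K m x y c" by (auto simp: uKDelta_Mor)
  have "interlaced m x y \<Longrightarrow> interlaced m y y"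
    using interlaced_between(2)[of m x y y] by (simp add: interlaced_le)
  moreover have "cmp (uKDelta K m n) x y y (idm (uKDelta K m n) y) f
      = residue K m x y (if interlaced m x y \<and> interlaced m y y then \<one>\<^bsub>K\<^esub> \<otimes>\<^bsub>K\<^esub> c else \<zero>\<^bsub>K\<^esub>)"
    using 4 c by (simp add: uKDelta_idm uKDelta_cmp)
  ultimately show ?case
    using c by (cases "interlaced m x y") (simp_all add: residue_not_interlaced)
next
  case (5 w x y z f g h)
  then obtain a b c where abc: "a \<in> carrier K" "f = residue K m w x a" "b \<in> carrier K"
    "g = residue K m x y b" "c \<in> carrier K" "h = residue K m y z c"
    by (auto simp: uKDelta_Mor)
  show ?case
  proof (cases "interlaced m w z")
    case True
    have "interlaced m w y \<and> interlaced m x z" if "interlaced m w x" "interlaced m x y"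
        "interlaced m y z"
    proof -
      have "w i \<le> x i" "x i \<le> y i" "y i \<le> z i" if "i \<le> m" for i
        using \<open>interlaced m w x\<close> \<open>interlaced m x y\<close> \<open>interlaced m y z\<close> that by (auto simp:
            interlaced_def)
      then show ?thesis
        using interlaced_between[OF True, of y] interlaced_between[OF True, of x] by (meson le_trans)
    qed
    then show ?thesis
      using 5 abc by (auto simp: uKDelta_cmp m_assoc)
  next
    case False
    then show ?thesis
      using 5 abc by (simp add: residue_not_interlaced[OF False] uKDelta_cmp)
  qed
next
  case (6 x y)
  then show ?case
    by (intro module_surj_image[OF module_scalar_module[OF cring_axioms], where f = "residue K m x y"])
      (simp_all add: uKDelta_carrier uKDelta_zero uKDelta_add uKDelta_smult)
next
  case (7 x y)
  then show ?case by (simp add: uKDelta_carrier uKDelta_Mor)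
next
  case (8 x y z f)
  then obtain c where c: "c \<in> carrier K" "f = residue K m x y c" by (auto simp: uKDelta_Mor)
  with 8 show ?case
    by (intro linear_mapI)
      (auto simp: uKDelta_carrier uKDelta_cmp uKDelta_add uKDelta_smult l_distr m_assoc)
next
  case (9 x y z g)
  then obtain c where c: "c \<in> carrier K" "g = residue K m y z c" by (auto simp: uKDelta_Mor)
  with 9 show ?case
    by (intro linear_mapI)
      (auto simp: uKDelta_carrier uKDelta_cmp uKDelta_add uKDelta_smult r_distr m_lcomm)
qed

end


section \<open>The universal simplex\<close>

lemma op_lcat_simps [simp]:
  "Ob (op_lcat C) = Ob C" "Mor (op_lcat C) x y = Mor C y x" "idm (op_lcat C) = idm C"
  "cmp (op_lcat C) x y z g f = cmp C z y x f g" "lin (op_lcat C) x y = lin C y x"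
  by (simp_all add: op_lcat_def)

text \<open>The predecessors \<open>m'\<close>, \<open>n'\<close> stand for \<open>m - 1\<close>, \<open>n - 1\<close>, which avoids truncated subtraction.\<close>

locale universal_simplex = scalar_field K for K :: "('k, 'r) ring_scheme" +
  fixes m n m' n' :: nat
  assumes m_eq: "m = Suc m'" and n_eq: "n = Suc n'"
begin

lemma pred_simps [simp]: "m - Suc 0 = m'" "n - Suc 0 = n'"
  by (simp_all add: m_eq n_eq)

lemma m_pos: "1 \<le> m"
  by (simp add: m_eq)

abbreviation U :: "('k, simplex, (simplex \<times> simplex \<Rightarrow> 'k) set) lcat" where
  "U \<equiv> uKDelta K m n"

abbreviation U' :: "('k, simplex, (simplex \<times> simplex \<Rightarrow> 'k) set) lcat" where
  "U' \<equiv> uKDelta K m' n'"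

sublocale U: linear_category K U by (rule linear_category_uKDelta)

sublocale U': linear_category K U' by (rule linear_category_uKDelta)

sublocale vector_functors K "op_lcat U'"
  by (intro vector_functors.intro vector_functors_axioms.intro linear_category_op
      U'.linear_category_axioms cring_axioms)

lemma gamma_simplices:
  assumes "x \<in> simplices m' n'"
  shows "gamma m x \<in> simplices m n"
proof (rule simplicesI)
  show "gamma m x \<in> extensional {..m}" by (simp add: gamma_def)
  show "gamma m x i \<le> gamma m x (Suc i)" if "i < m" for i
    using simplices_mono[OF assms, of "i - 1" i] that by (auto simp: gamma_apply m_eq)
  show "gamma m x m \<le> n"
    using simplices_le[OF assms, of m'] m_eq n_eq by (simp add: gamma_apply)
qed

lemma gamma_le_iff: "(\<forall>i\<le>m. gamma m y i \<le> gamma m x i) \<longleftrightarrow> (\<forall>i\<le>m'. y i \<le> x i)"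
proof
  assume *: "\<forall>i\<le>m. gamma m y i \<le> gamma m x i"
  show "\<forall>i\<le>m'. y i \<le> x i"
  proof (intro allI impI)
    fix i assume "i \<le> m'"
    then have "Suc i \<le> m" by (simp add: m_eq)
    with *[rule_format, of "Suc i"] show "y i \<le> x i" by (simp add: gamma_apply)
  qed
next
  assume *: "\<forall>i\<le>m'. y i \<le> x i"
  show "\<forall>i\<le>m. gamma m y i \<le> gamma m x i"
  proof (intro allI impI)
    fix i assume "i \<le> m"
    then show "gamma m y i \<le> gamma m x i"
      using *[rule_format, of "i - 1"] by (simp add: gamma_apply m_eq)
  qed
qed

lemma gamma_interlaced_iff: "interlaced m (gamma m y) (gamma m x) \<longleftrightarrow> interlaced m' y x"
proof -
  have "(\<forall>i<m. gamma m x i < gamma m y (Suc i)) \<longleftrightarrow> (\<forall>i<m'. x i < y (Suc i))"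
  proof
    assume *: "\<forall>i<m. gamma m x i < gamma m y (Suc i)"
    show "\<forall>i<m'. x i < y (Suc i)"
    proof (intro allI impI)
      fix i assume "i < m'"
      then have "Suc i < m" by (simp add: m_eq)
      with *[rule_format, of "Suc i"] show "x i < y (Suc i)" by (simp add: gamma_apply)
    qed
  next
    assume *: "\<forall>i<m'. x i < y (Suc i)"
    show "\<forall>i<m. gamma m x i < gamma m y (Suc i)"
    proof (intro allI impI)
      fix i assume "i < m"
      then show "gamma m x i < gamma m y (Suc i)"
        using *[rule_format, of "i - 1"] by (cases i) (simp_all add: gamma_apply m_eq)
    qed
  qed
  then show ?thesis unfolding interlaced_def gamma_le_iff by simp
qed

lemma gamma_envelope:
  assumes x: "x \<in> simplices m' n'" and y: "y \<in> simplices m' n'"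
    and c: "c \<in> carrier K"
  shows "farr (lin_envelope_func K (Delta m' n') (gamma_func m n)) y x (multiple K m' y x c)
    = multiple K m (gamma m y) (gamma m x) c"
proof
  fix b
  let ?G = "gamma_func m n" and ?f = "multiple K m' y x c" and ?le = "\<forall>i\<le>m'. y i \<le> x i"
  let ?S = "{a \<in> Mor (Delta m' n') y x. ?f a \<noteq> \<zero>\<^bsub>K\<^esub> \<and> farr ?G y x a = b}"
  have f: "?f \<in> formal_sums K (Mor (Delta m' n') y x)"
    unfolding formal_sums_Delta using c by blast
  have G: "farr ?G y x (y, x) = (gamma m y, gamma m x)" if ?le
    using that x y by (simp add: gamma_func_def)
  have S: "?S = (if ?le \<and> c \<noteq> \<zero>\<^bsub>K\<^esub> \<and> b = (gamma m y, gamma m x) then {(y, x)} else {})"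
    using G by (auto simp: multiple_def)
  have "farr (lin_envelope_func K (Delta m' n') ?G) y x ?f b = (\<Oplus>\<^bsub>K\<^esub>a\<in>?S. ?f a)"
    using f x y by (simp add: lin_envelope_func_def lin_envelope_def)
  also have "\<dots> = multiple K m (gamma m y) (gamma m x) c b"
    unfolding S using c gamma_le_iff[of y x] by (auto simp: multiple_def)
  finally show "farr (lin_envelope_func K (Delta m' n') ?G) y x ?f b
    = multiple K m (gamma m y) (gamma m x) c b" .
qed

lemma gamma_bar_residue:
  assumes x: "x \<in> simplices m' n'" and y: "y \<in> simplices m' n'"
    and c: "c \<in> carrier K"
  shows "farr (gamma_bar K m n) y x (residue K m' y x c) = residue K m (gamma m y) (gamma m x) c"
proof -
  let ?F = "lin_envelope_func K (Delta m' n') (gamma_func m n)"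
  have F: "fob ?F z = gamma m z" if "z \<in> simplices m' n'" for z
    using that by (simp add: lin_envelope_func_def lin_envelope_def gamma_func_def)
  have "residue K m' y x c \<in> Mor U' y x"
    using x y c by (simp add: uKDelta_Mor)
  then have "farr (gamma_bar K m n) y x (residue K m' y x c)
    = (\<Union>f\<in>residue K m' y x c. deg_ideal K m n (gamma m y) (gamma m x)
        +>\<^bsub>lin (KDelta K m n) (gamma m y) (gamma m x)\<^esub> farr ?F y x f)"
    unfolding gamma_bar_def quotient_func_def
    using x y uKDelta_Ob[of m' n'] by (simp add: F uKDelta_def)
  also have "\<dots> = residue K m (gamma m y) (gamma m x) c"
  proof (cases "interlaced m' y x")
    case True
    then have "residue K m' y x c = {multiple K m' y x c}" by (simp add: residue_def)
    then show ?thesis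
      using x y c by (simp add: gamma_envelope deg_ideal_coset gamma_simplices)
  next
    case False
    then have "\<not> interlaced m (gamma m y) (gamma m x)" by (simp add: gamma_interlaced_iff)
    moreover have "residue K m' y x c = multiple K m' y x ` carrier K"
      using False by (simp add: residue_def)
    ultimately show ?thesis
      using x y by (auto simp: gamma_envelope deg_ideal_coset gamma_simplices residue_not_interlaced)
  qed
  finally show ?thesis .
qed

abbreviation gamma_arr :: "simplex \<Rightarrow> simplex \<Rightarrow> (simplex \<times> simplex \<Rightarrow> 'k) set \<Rightarrow> (simplex \<times> simplex \<Rightarrow>
    'k) set"
  where "gamma_arr \<equiv> farr (gamma_bar K m n)"

context
  fixes x y assumes x: "x \<in> simplices m' n'" and y: "y \<in> simplices m' n'"
begin

lemma gm_closed: "f \<in> Mor U' y x \<Longrightarrow> gamma_arr y x f \<in> Mor U (gamma m y) (gamma m x)"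
  using x y by (auto simp: uKDelta_Mor gamma_bar_residue gamma_simplices)

lemma gm_linear: "linear_map K (lin U' y x) (lin U (gamma m y) (gamma m x)) (gamma_arr y x)"
  using x y
  by (intro linear_mapI)
    (auto simp: uKDelta_carrier gamma_bar_residue uKDelta_add uKDelta_smult gamma_simplices)

end

lemma gm_idm: "x \<in> simplices m' n' \<Longrightarrow> gamma_arr x x (idm U' x) = idm U (gamma m x)"
  by (simp add: uKDelta_idm gamma_bar_residue gamma_simplices)

lemma gm_cmp:
  "\<lbrakk>x \<in> simplices m' n'; y \<in> simplices m' n'; z \<in> simplices m' n';
    f \<in> Mor U' x y; g \<in> Mor U' y z\<rbrakk>
    \<Longrightarrow> gamma_arr x z (cmp U' x y z g f) = cmp U (gamma m x) (gamma m y) (gamma m z) (gamma_arr y z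
        g) (gamma_arr x y f)"
  by (auto simp: uKDelta_Mor uKDelta_cmp gamma_bar_residue gamma_simplices gamma_interlaced_iff)

lemma eps_ob_eq: "eps_ob K m n \<sigma> = mk_func (op_lcat U') (\<lambda>x. lin U (gamma m x) \<sigma>)
    (\<lambda>x y f. \<lambda>h \<in> Mor U (gamma m x) \<sigma>. cmp U (gamma m y) (gamma m x) \<sigma> h (gamma_arr y x f))"
  by (simp add: eps_ob_def)

lemma eps_ob_fob: "x \<in> simplices m' n' \<Longrightarrow> fob (eps_ob K m n \<sigma>) x = lin U (gamma m x) \<sigma>"
  by (simp add: eps_ob_def)

lemma eps_ob_farr:
  "\<lbrakk>x \<in> simplices m' n'; y \<in> simplices m' n'; f \<in> Mor U' y x\<rbrakk>
    \<Longrightarrow> farr (eps_ob K m n \<sigma>) x y f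
      = (\<lambda>h \<in> Mor U (gamma m x) \<sigma>. cmp U (gamma m y) (gamma m x) \<sigma> h (gamma_arr y x f))"
  by (simp add: eps_ob_def)

lemma finite_dim_uKDelta:
  assumes "\<sigma> \<in> simplices m n" "\<tau> \<in> simplices m n"
  shows "finite_dim K (lin U \<sigma> \<tau>)"
  unfolding finite_dim_def
proof (intro exI[of _ "{residue K m \<sigma> \<tau> \<one>\<^bsub>K\<^esub>}"] conjI allI impI)
  interpret L: module K "lin U \<sigma> \<tau>" using assms by (simp add: U.lin_module)
  show "{residue K m \<sigma> \<tau> \<one>\<^bsub>K\<^esub>} \<subseteq> carrier (lin U \<sigma> \<tau>)" using assms by (simp add: uKDelta_carrier)
  fix W assume W: "submodule W K (lin U \<sigma> \<tau>) \<and> {residue K m \<sigma> \<tau> \<one>\<^bsub>K\<^esub>} \<subseteq> W"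
  have "residue K m \<sigma> \<tau> c \<in> W" if c: "c \<in> carrier K" for c
    using L.submoduleE(4)[OF conjunct1[OF W] c, of "residue K m \<sigma> \<tau> \<one>\<^bsub>K\<^esub>"] W c assms
    by (simp add: uKDelta_smult)
  then show "W = carrier (lin U \<sigma> \<tau>)"
    using L.submoduleE(1)[OF conjunct1[OF W]] assms by (auto simp: uKDelta_carrier)
qed simp

lemma eps_ob_Ob:
  assumes s: "\<sigma> \<in> simplices m n"
  shows "eps_ob K m n \<sigma> \<in> Ob Vect_fun"
proof -
  have mod: "module K (lin U (gamma m x) \<sigma>)" if "x \<in> simplices m' n'" for x
    using that s by (simp add: U.lin_module gamma_simplices)
  have F: "is_functor (op_lcat U') (fd_vec K) (eps_ob K m n \<sigma>)"
    unfolding eps_ob_eq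
  proof (rule is_functor_mk_func)
    fix x assume "x \<in> Ob (op_lcat U')"
    then show "lin U (gamma m x) \<sigma> \<in> Ob (fd_vec K)"
      using s by (simp add: mod finite_dim_uKDelta gamma_simplices)
  next
    fix x y f assume "x \<in> Ob (op_lcat U')" "y \<in> Ob (op_lcat U')" "f \<in> Mor (op_lcat U') x y"
    then have xy: "x \<in> simplices m' n'" "y \<in> simplices m' n'" "f \<in> Mor U' y x"
      by simp_all
    have "linear_map K (lin U (gamma m x) \<sigma>) (lin U (gamma m y) \<sigma>)
        (\<lambda>h. cmp U (gamma m y) (gamma m x) \<sigma> h (gamma_arr y x f))"
      using xy s by (intro U.cmp_linear_left) (simp_all add: gamma_simplices gm_closed)
    from restrict_linear_maps[OF mod[OF xy(1)] this]
    show "(\<lambda>h \<in> Mor U (gamma m x) \<sigma>. cmp U (gamma m y) (gamma m x) \<sigma> h (gamma_arr y x f))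
      \<in> Mor (fd_vec K) (lin U (gamma m x) \<sigma>) (lin U (gamma m y) \<sigma>)"
      using xy s by (simp add: U.lin_carrier gamma_simplices)
  next
    fix x assume "x \<in> Ob (op_lcat U')"
    then show "(\<lambda>h \<in> Mor U (gamma m x) \<sigma>. cmp U (gamma m x) (gamma m x) \<sigma> h (gamma_arr x x (idm
        (op_lcat U') x)))
      = idm (fd_vec K) (lin U (gamma m x) \<sigma>)"
      using s by (auto intro!: restrict_ext simp: gm_idm U.lin_carrier gamma_simplices U.cmp_idm_right)
  next
    fix x y z f g assume "x \<in> Ob (op_lcat U')" "y \<in> Ob (op_lcat U')" "z \<in> Ob (op_lcat U')"
      "f \<in> Mor (op_lcat U') x y" "g \<in> Mor (op_lcat U') y z"
    then have xyz: "x \<in> simplices m' n'" "y \<in> simplices m' n'"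
      "z \<in> simplices m' n'" "f \<in> Mor U' y x" "g \<in> Mor U' z y" by simp_all
    note g = gamma_simplices[OF xyz(1)] gamma_simplices[OF xyz(2)] gamma_simplices[OF xyz(3)]
    have "cmp U (gamma m z) (gamma m x) \<sigma> h (gamma_arr z x (cmp U' z y x f g))
      = cmp U (gamma m z) (gamma m y) \<sigma> (cmp U (gamma m y) (gamma m x) \<sigma> h (gamma_arr y x f))
          (gamma_arr z y g)"
      if h: "h \<in> Mor U (gamma m x) \<sigma>" for h
      unfolding gm_cmp[OF xyz(3,2,1,5,4)]
      by (rule U.cmp_assoc) (use xyz s h g in \<open>auto intro: gm_closed\<close>)
    then show "(\<lambda>h \<in> Mor U (gamma m x) \<sigma>. cmp U (gamma m z) (gamma m x) \<sigma> h
        (gamma_arr z x (cmp (op_lcat U') x y z g f)))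
      = cmp (fd_vec K) (lin U (gamma m x) \<sigma>) (lin U (gamma m y) \<sigma>) (lin U (gamma m z) \<sigma>)
        (\<lambda>h \<in> Mor U (gamma m y) \<sigma>. cmp U (gamma m z) (gamma m y) \<sigma> h (gamma_arr z y g))
        (\<lambda>h \<in> Mor U (gamma m x) \<sigma>. cmp U (gamma m y) (gamma m x) \<sigma> h (gamma_arr y x f))"
      using xyz s g
      by (intro ext) (auto simp: compose_def restrict_def U.lin_carrier U.cmp_closed gm_closed)
  qed (rule category_axioms)
  have "linear_map K (lin (op_lcat U') x y) (lin (fd_vec K) (fob (eps_ob K m n \<sigma>) x) (fob (eps_ob
      K m n \<sigma>) y))
      (farr (eps_ob K m n \<sigma>) x y)" if "x \<in> Ob (op_lcat U')" "y \<in> Ob (op_lcat U')" for x y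
  proof -
    have xy: "x \<in> simplices m' n'" "y \<in> simplices m' n'" using that by simp_all
    note g = gamma_simplices[OF xy(1)] gamma_simplices[OF xy(2)]
    note lin = gm_linear[OF xy] and closed = gm_closed[OF xy]
    have car: "carrier (lin U' y x) = Mor U' y x" using xy by (simp add: U'.lin_carrier)
    show ?thesis
    proof (rule linear_mapI)
      fix f assume "f \<in> carrier (lin (op_lcat U') x y)"
      then show "farr (eps_ob K m n \<sigma>) x y f
        \<in> carrier (lin (fd_vec K) (fob (eps_ob K m n \<sigma>) x) (fob (eps_ob K m n \<sigma>) y))"
        using functor_arr[OF F, of f x y] that by (simp add: car)
    next
      fix f h assume "f \<in> carrier (lin (op_lcat U') x y)" "h \<in> carrier (lin (op_lcat U') x y)"
      then have fh: "f \<in> Mor U' y x" "h \<in> Mor U' y x" by (simp_all add: car)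
      then show "farr (eps_ob K m n \<sigma>) x y (f \<oplus>\<^bsub>lin (op_lcat U') x y\<^esub> h)
        = farr (eps_ob K m n \<sigma>) x y f
          \<oplus>\<^bsub>lin (fd_vec K) (fob (eps_ob K m n \<sigma>) x) (fob (eps_ob K m n \<sigma>) y)\<^esub> farr (eps_ob K m n
              \<sigma>) x y h"
        using xy s g
        by (auto intro!: restrict_ext simp: eps_ob_fob eps_ob_farr U'.add_mor_closed U.lin_carrier
            linear_map_add[OF lin] car closed U.cmp_add_right)
    next
      fix c f assume c: "c \<in> carrier K" and "f \<in> carrier (lin (op_lcat U') x y)"
      then have f: "f \<in> Mor U' y x" by (simp add: car)
      then show "farr (eps_ob K m n \<sigma>) x y (c \<odot>\<^bsub>lin (op_lcat U') x y\<^esub> f)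
        = c \<odot>\<^bsub>lin (fd_vec K) (fob (eps_ob K m n \<sigma>) x) (fob (eps_ob K m n \<sigma>) y)\<^esub> farr (eps_ob K m n
            \<sigma>) x y f"
        using xy s g c
        by (auto intro!: restrict_ext simp: eps_ob_fob eps_ob_farr U'.smult_mor_closed U.lin_carrier
            linear_map_smult[OF lin] car closed U.cmp_smult_right)
    qed
  qed
  with F show ?thesis by (simp add: is_linear_functor_def)
qed

lemma eps_fob: "\<sigma> \<in> simplices m n \<Longrightarrow> fob (eps K m n) \<sigma> = eps_ob K m n \<sigma>"
  by (simp add: eps_def)

lemma eps_edge:
  assumes "\<sigma> \<in> simplices m n" "\<tau> \<in> simplices m n" "\<forall>i\<le>m. \<sigma> i \<le> \<tau> i"
  shows "edge (eps K m n) \<sigma> \<tau> = (\<lambda>x \<in> simplices m' n'. \<lambda>h \<in> Mor U (gamma m x) \<sigma>.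
    cmp U (gamma m x) \<sigma> \<tau> (residue K m \<sigma> \<tau> \<one>\<^bsub>K\<^esub>) h)"
  using assms by (simp add: eps_def basis_elt_multiple deg_ideal_coset)

text \<open>If \<open>\<rho>\<close> and \<open>\<tau>\<close> do not interlace, there is only one residue class.\<close>

lemma residue_one_cmp:
  assumes st: "\<rho> \<in> simplices m n" "\<sigma> \<in> simplices m n" "\<tau> \<in> simplices m n"
    and le: "\<forall>i\<le>m. \<rho> i \<le> \<sigma> i" "\<forall>i\<le>m. \<sigma> i \<le> \<tau> i"
  shows "cmp U \<rho> \<sigma> \<tau> (residue K m \<sigma> \<tau> \<one>\<^bsub>K\<^esub>) (residue K m \<rho> \<sigma> \<one>\<^bsub>K\<^esub>) = residue K m \<rho> \<tau> \<one>\<^bsub>K\<^esub>"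
proof (cases "interlaced m \<rho> \<tau>")
  case True
  then show ?thesis
    using interlaced_between[OF True, of \<sigma>] st le by (simp add: uKDelta_cmp)
next
  case False
  then show ?thesis
    using st by (simp add: uKDelta_cmp residue_not_interlaced)
qed

lemma eps_eq: "eps K m n = mk_func (Delta m n) (eps_ob K m n)
    (\<lambda>\<sigma> \<tau> u. \<lambda>x \<in> simplices m' n'. \<lambda>h \<in> Mor U (gamma m x) \<sigma>.
      cmp U (gamma m x) \<sigma> \<tau> (deg_ideal K m n \<sigma> \<tau> +>\<^bsub>lin (KDelta K m n) \<sigma> \<tau>\<^esub> basis_elt K u) h)"
  by (simp add: eps_def)

lemma eps_functor: "is_functor (Delta m n) Vect_fun (eps K m n)"
  unfolding eps_eq
proof (rule is_functor_mk_func[OF _ _ _ _ category_Delta])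
  fix \<sigma> assume "\<sigma> \<in> Ob (Delta m n)"
  then show "eps_ob K m n \<sigma> \<in> Ob Vect_fun" using eps_ob_Ob by simp
next
  fix \<sigma> \<tau> u assume "\<sigma> \<in> Ob (Delta m n)" "\<tau> \<in> Ob (Delta m n)" "u \<in> Mor (Delta m n) \<sigma> \<tau>"
  then have s: "\<sigma> \<in> simplices m n" and t: "\<tau> \<in> simplices m n" and le: "\<forall>i\<le>m. \<sigma> i \<le> \<tau> i"
    and u: "u = (\<sigma>, \<tau>)" by auto
  let ?e = "residue K m \<sigma> \<tau> \<one>\<^bsub>K\<^esub>"
  have e: "?e \<in> Mor U \<sigma> \<tau>" using s t by (simp add: uKDelta_Mor)
  have "restrict (\<lambda>x. \<lambda>h \<in> Mor U (gamma m x) \<sigma>. cmp U (gamma m x) \<sigma> \<tau> ?e h) (Ob (op_lcat U'))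
    \<in> nat_trans (op_lcat U') (fd_vec K) (eps_ob K m n \<sigma>) (eps_ob K m n \<tau>)"
  proof (rule nat_trans_VectI[OF eps_ob_Ob[OF s]])
    fix x assume "x \<in> Ob (op_lcat U')"
    then have x: "x \<in> simplices m' n'" by simp
    note g = gamma_simplices[OF x]
    have "linear_map K (lin U (gamma m x) \<sigma>) (lin U (gamma m x) \<tau>) (\<lambda>h. cmp U (gamma m x) \<sigma> \<tau> ?e h)"
      using g s t e by (intro U.cmp_linear_right) simp_all
    from restrict_linear_maps[OF _ this]
    show "(\<lambda>h \<in> Mor U (gamma m x) \<sigma>. cmp U (gamma m x) \<sigma> \<tau> ?e h)
        \<in> linear_maps K (fob (eps_ob K m n \<sigma>) x) (fob (eps_ob K m n \<tau>) x)"
      using g s x by (simp add: eps_ob_fob U.lin_module U.lin_carrier)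
  next
    fix x y f h assume "x \<in> Ob (op_lcat U')" "y \<in> Ob (op_lcat U')" "f \<in> Mor (op_lcat U') x y"
      "h \<in> carrier (fob (eps_ob K m n \<sigma>) x)"
    then have xy: "x \<in> simplices m' n'" "y \<in> simplices m' n'" "f \<in> Mor U' y x"
      and h: "h \<in> Mor U (gamma m x) \<sigma>"
      using s by (simp_all add: eps_ob_fob U.lin_carrier gamma_simplices)
    note g = gamma_simplices[OF xy(1)] gamma_simplices[OF xy(2)] and gf = gm_closed[OF xy]
    have "cmp U (gamma m y) (gamma m x) \<tau> (cmp U (gamma m x) \<sigma> \<tau> ?e h) (gamma_arr y x f)
      = cmp U (gamma m y) \<sigma> \<tau> ?e (cmp U (gamma m y) (gamma m x) \<sigma> h (gamma_arr y x f))"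
      by (rule U.cmp_assoc[symmetric]) (use g s t gf h e in auto)
    then show "farr (eps_ob K m n \<tau>) x y f ((\<lambda>h \<in> Mor U (gamma m x) \<sigma>. cmp U (gamma m x) \<sigma> \<tau> ?e h) h)
      = (\<lambda>h \<in> Mor U (gamma m y) \<sigma>. cmp U (gamma m y) \<sigma> \<tau> ?e h) (farr (eps_ob K m n \<sigma>) x y f h)"
      using xy h g s t gf e by (simp add: eps_ob_farr U.cmp_closed)
  qed
  then show "(\<lambda>x \<in> simplices m' n'. \<lambda>h \<in> Mor U (gamma m x) \<sigma>.
      cmp U (gamma m x) \<sigma> \<tau> (deg_ideal K m n \<sigma> \<tau> +>\<^bsub>lin (KDelta K m n) \<sigma> \<tau>\<^esub> basis_elt K u) h)
    \<in> Mor Vect_fun (eps_ob K m n \<sigma>) (eps_ob K m n \<tau>)"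
    using s t le by (simp add: u basis_elt_multiple deg_ideal_coset)
next
  fix \<sigma> assume "\<sigma> \<in> Ob (Delta m n)"
  then have s: "\<sigma> \<in> simplices m n" by simp
  then have "residue K m \<sigma> \<sigma> \<one>\<^bsub>K\<^esub> = idm U \<sigma>" by (simp add: uKDelta_idm)
  with s show "(\<lambda>x \<in> simplices m' n'. \<lambda>h \<in> Mor U (gamma m x) \<sigma>.
      cmp U (gamma m x) \<sigma> \<sigma> (deg_ideal K m n \<sigma> \<sigma> +>\<^bsub>lin (KDelta K m n) \<sigma> \<sigma>\<^esub> basis_elt K (idm
          (Delta m n) \<sigma>)) h)
    = idm Vect_fun (eps_ob K m n \<sigma>)"
    by (auto intro!: restrict_ext simp: basis_elt_multiple[of m] deg_ideal_coset eps_ob_fob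
        U.lin_carrier
        U.cmp_idm_left gamma_simplices)
next
  fix \<rho> \<sigma> \<tau> u v assume "\<rho> \<in> Ob (Delta m n)" "\<sigma> \<in> Ob (Delta m n)" "\<tau> \<in> Ob (Delta m n)"
    "u \<in> Mor (Delta m n) \<rho> \<sigma>" "v \<in> Mor (Delta m n) \<sigma> \<tau>"
  then have r: "\<rho> \<in> simplices m n" and s: "\<sigma> \<in> simplices m n" and t: "\<tau> \<in> simplices m n"
    and le: "\<forall>i\<le>m. \<rho> i \<le> \<sigma> i" "\<forall>i\<le>m. \<sigma> i \<le> \<tau> i" and uv: "u = (\<rho>, \<sigma>)" "v = (\<sigma>, \<tau>)" by auto
  have le': "\<forall>i\<le>m. \<rho> i \<le> \<tau> i" using le by (auto intro: le_trans)
  have "cmp U (gamma m x) \<rho> \<tau> (residue K m \<rho> \<tau> \<one>\<^bsub>K\<^esub>) h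
      = cmp U (gamma m x) \<sigma> \<tau> (residue K m \<sigma> \<tau> \<one>\<^bsub>K\<^esub>) (cmp U (gamma m x) \<rho> \<sigma> (residue K m \<rho> \<sigma> \<one>\<^bsub>K\<^esub>) h)"
    if "x \<in> simplices m' n'" "h \<in> Mor U (gamma m x) \<rho>" for x h
    unfolding residue_one_cmp[OF r s t le, symmetric]
    by (rule U.cmp_assoc[symmetric]) (use that r s t in \<open>auto simp: gamma_simplices uKDelta_Mor\<close>)
  moreover have "cmp U (gamma m x) \<rho> \<sigma> (residue K m \<rho> \<sigma> \<one>\<^bsub>K\<^esub>) h \<in> Mor U (gamma m x) \<sigma>"
    if "x \<in> simplices m' n'" "h \<in> Mor U (gamma m x) \<rho>" for x h
    by (rule U.cmp_closed) (use that r s in \<open>auto simp: gamma_simplices uKDelta_Mor\<close>)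
  ultimately show "(\<lambda>x \<in> simplices m' n'. \<lambda>h \<in> Mor U (gamma m x) \<rho>. cmp U (gamma m x) \<rho> \<tau>
        (deg_ideal K m n \<rho> \<tau> +>\<^bsub>lin (KDelta K m n) \<rho> \<tau>\<^esub> basis_elt K (cmp (Delta m n) \<rho> \<sigma> \<tau> v u)) h)
    = cmp Vect_fun (eps_ob K m n \<rho>) (eps_ob K m n \<sigma>) (eps_ob K m n \<tau>)
      (\<lambda>x \<in> simplices m' n'. \<lambda>h \<in> Mor U (gamma m x) \<sigma>. cmp U (gamma m x) \<sigma> \<tau>
        (deg_ideal K m n \<sigma> \<tau> +>\<^bsub>lin (KDelta K m n) \<sigma> \<tau>\<^esub> basis_elt K v) h)
      (\<lambda>x \<in> simplices m' n'. \<lambda>h \<in> Mor U (gamma m x) \<rho>. cmp U (gamma m x) \<rho> \<sigma>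
        (deg_ideal K m n \<rho> \<sigma> +>\<^bsub>lin (KDelta K m n) \<rho> \<sigma>\<^esub> basis_elt K u) h)"
    using r s t le le'
    by (auto intro!: restrict_ext simp: uv basis_elt_multiple[of m] deg_ideal_coset compose_def
        eps_ob_fob
        U.lin_carrier gamma_simplices)
qed

end


context universal_simplex
begin

lemma residue_carrier:
  assumes "x \<in> simplices m' n'" "\<sigma> \<in> simplices m n"
  shows "v \<in> carrier (fob (eps_ob K m n \<sigma>) x) \<longleftrightarrow> (\<exists>c\<in>carrier K. v = residue K m (gamma m x) \<sigma> c)"
  using assms by (auto simp: eps_ob_fob uKDelta_carrier gamma_simplices)

lemma value_zero:
  assumes "x \<in> simplices m' n'" "\<sigma> \<in> simplices m n"
  shows "\<zero>\<^bsub>fob (eps_ob K m n \<sigma>) x\<^esub> = residue K m (gamma m x) \<sigma> \<zero>\<^bsub>K\<^esub>"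
  using assms by (simp add: eps_ob_fob uKDelta_zero gamma_simplices)

text \<open>The value of \<open>\<epsilon>(\<sigma>)\<close> at \<open>x\<close> is one-dimensional if \<open>x\<close> lies in the box of \<open>\<sigma>\<close>, and zero otherwise.\<close>

lemma residue_eq_zero_iff:
  "residue K m (gamma m x) \<sigma> c = residue K m (gamma m x) \<sigma> \<zero>\<^bsub>K\<^esub> \<longleftrightarrow> x \<notin> box m \<sigma> \<or> c = \<zero>\<^bsub>K\<^esub>"
  using residue_inj[of m "gamma m x" \<sigma> K c "\<zero>\<^bsub>K\<^esub>"]
  by (auto simp: residue_not_interlaced interlaced_gamma_iff)

lemma eps_ob_apply:
  assumes "x \<in> simplices m' n'" "y \<in> simplices m' n'" "\<sigma> \<in> simplices m n" "c \<in> carrier K"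
    and il: "interlaced m' y x"
  shows "farr (eps_ob K m n \<sigma>) x y (residue K m' y x \<one>\<^bsub>K\<^esub>) (residue K m (gamma m x) \<sigma> c)
    = residue K m (gamma m y) \<sigma> (if x \<in> box m \<sigma> then c else \<zero>\<^bsub>K\<^esub>)"
  using assms gamma_interlaced_iff[of y x]
  by (simp add: eps_ob_farr uKDelta_Mor gamma_bar_residue gamma_simplices uKDelta_cmp
      interlaced_gamma_iff)

lemma edge_apply:
  assumes "\<sigma> \<in> simplices m n" "\<tau> \<in> simplices m n" "interlaced m \<sigma> \<tau>" "x \<in> simplices m' n'" "c \<in>
      carrier K"
  shows "edge (eps K m n) \<sigma> \<tau> x (residue K m (gamma m x) \<sigma> c)
    = residue K m (gamma m x) \<tau> (if x \<in> box m \<sigma> then c else \<zero>\<^bsub>K\<^esub>)"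
  using assms interlaced_le[OF assms(3)]
  by (simp add: eps_edge uKDelta_Mor gamma_simplices uKDelta_cmp interlaced_gamma_iff)

lemma box_restrict_iff: "restrict y {..m'} \<in> box m \<sigma> \<longleftrightarrow> y \<in> box m \<sigma>"
  by (auto simp: box_def m_eq)

lemma box_restrict_simplices:
  assumes "\<sigma> \<in> simplices m n" "y \<in> box m \<sigma>"
  shows "restrict y {..m'} \<in> simplices m' n'"
proof (rule simplicesI)
  show "restrict y {..m'} i \<le> restrict y {..m'} (Suc i)" if "i < m'" for i
    using box_chain(1)[OF assms, of i] that by (simp add: m_eq)
  show "restrict y {..m'} m' \<le> n'"
    using box_chain(2)[OF assms, of m'] by (simp add: m_eq n_eq)
qed simp

lemma box_interlaced:
  assumes "y \<in> box m \<tau>" "x \<in> box m \<tau>" "\<And>i. i \<le> m' \<Longrightarrow> y i \<le> x i"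
  shows "interlaced m' y x"
proof -
  have "x i < y (Suc i)" if "i < m'" for i
    using box_less[OF assms(2), of i] box_ge[OF assms(1), of "Suc i"] that by (simp add: m_eq)
  with assms(3) show ?thesis by (simp add: interlaced_def)
qed

context
  fixes \<sigma> \<tau> f
  assumes s: "\<sigma> \<in> simplices m n" and t: "\<tau> \<in> simplices m n"
    and f: "f \<in> nat_trans (op_lcat U') (fd_vec K) (eps_ob K m n \<sigma>) (eps_ob K m n \<tau>)"
begin

lemma component_coefficient:
  assumes x: "x \<in> simplices m' n'"
  obtains a where "a \<in> carrier K"
    "\<And>c. c \<in> carrier K \<Longrightarrow> f x (residue K m (gamma m x) \<sigma> c) = residue K m (gamma m x) \<tau> (c \<otimes>\<^bsub>K\<^esub> a)"
proof -
  have lin: "linear_map K (fob (eps_ob K m n \<sigma>) x) (fob (eps_ob K m n \<tau>) x) (f x)"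
    using component_linear[OF f, of x] x by simp
  have one: "residue K m (gamma m x) \<sigma> \<one>\<^bsub>K\<^esub> \<in> carrier (fob (eps_ob K m n \<sigma>) x)"
    unfolding residue_carrier[OF x s] by blast
  from linear_map_closed[OF lin this] obtain a where a: "a \<in> carrier K"
    "f x (residue K m (gamma m x) \<sigma> \<one>\<^bsub>K\<^esub>) = residue K m (gamma m x) \<tau> a"
    unfolding residue_carrier[OF x t] by blast
  have "f x (residue K m (gamma m x) \<sigma> c) = residue K m (gamma m x) \<tau> (c \<otimes>\<^bsub>K\<^esub> a)"
    if c: "c \<in> carrier K" for c
  proof -
    have "f x (c \<odot>\<^bsub>fob (eps_ob K m n \<sigma>) x\<^esub> residue K m (gamma m x) \<sigma> \<one>\<^bsub>K\<^esub>)
      = c \<odot>\<^bsub>fob (eps_ob K m n \<tau>) x\<^esub> residue K m (gamma m x) \<tau> a"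
      using linear_map_smult[OF lin c one] a(2) by simp
    then show ?thesis
      using c a(1) x s t by (simp add: eps_ob_fob uKDelta_smult gamma_simplices)
  qed
  with a(1) show ?thesis using that by blast
qed

lemma component_natural_residue:
  assumes "x \<in> simplices m' n'" "y \<in> simplices m' n'" "interlaced m' y x" "x \<in> box m \<sigma>"
  shows "farr (eps_ob K m n \<tau>) x y (residue K m' y x \<one>\<^bsub>K\<^esub>) (f x (residue K m (gamma m x) \<sigma> \<one>\<^bsub>K\<^esub>))
    = f y (residue K m (gamma m y) \<sigma> \<one>\<^bsub>K\<^esub>)"
proof -
  have "residue K m' y x \<one>\<^bsub>K\<^esub> \<in> Mor U' y x" using assms by (simp add: uKDelta_Mor)
  moreover have "residue K m (gamma m x) \<sigma> \<one>\<^bsub>K\<^esub> \<in> carrier (fob (eps_ob K m n \<sigma>) x)"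
    unfolding residue_carrier[OF assms(1) s] by blast
  ultimately show ?thesis
    using component_natural[OF f, of x y "residue K m' y x \<one>\<^bsub>K\<^esub>" "residue K m (gamma m x) \<sigma> \<one>\<^bsub>K\<^esub>"]
      assms s by (simp add: eps_ob_apply)
qed

text \<open>A nonzero component at \<open>x\<close> forces \<open>\<sigma> \<le> \<tau>\<close>: moving \<open>x\<close> out of one of the two boxes, but not out
  of the other, would contradict naturality.\<close>

lemma nonzero_component_interlaced:
  assumes x: "x \<in> simplices m' n'" and xs: "x \<in> box m \<sigma>" and xt: "x \<in> box m \<tau>"
    and nz: "f x (residue K m (gamma m x) \<sigma> \<one>\<^bsub>K\<^esub>) \<noteq> residue K m (gamma m x) \<tau> \<zero>\<^bsub>K\<^esub>"
  shows "interlaced m \<sigma> \<tau>"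
proof -
  obtain a where a: "a \<in> carrier K"
    "\<And>c. c \<in> carrier K \<Longrightarrow> f x (residue K m (gamma m x) \<sigma> c) = residue K m (gamma m x) \<tau> (c \<otimes>\<^bsub>K\<^esub> a)"
    using component_coefficient[OF x] by blast
  have a0: "a \<noteq> \<zero>\<^bsub>K\<^esub>" using nz a(2)[of "\<one>\<^bsub>K\<^esub>"] a(1) by auto
  have low: "\<sigma> i \<le> \<tau> i" if i: "i < m" for i
  \<comment> \<open>otherwise \<open>x\<close> can be lowered out of the box of \<open>\<sigma>\<close> in the direction \<open>i\<close>\<close>
  proof (rule ccontr)
    assume "\<not> \<sigma> i \<le> \<tau> i"
    define y where "y = restrict (x(i := \<tau> i)) {..m'}"
    have "x(i := \<tau> i) \<in> box m \<tau>"
      using xt box_ge[OF xt i] box_less[OF xt i] by (auto simp: box_def intro: le_less_trans)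
    then have yt: "y \<in> box m \<tau>" and y: "y \<in> simplices m' n'"
      unfolding y_def box_restrict_iff using box_restrict_simplices[OF t] by auto
    have ys: "y \<notin> box m \<sigma>"
      unfolding y_def box_restrict_iff using i \<open>\<not> \<sigma> i \<le> \<tau> i\<close> by (auto simp: box_def)
    have "y j \<le> x j" if "j \<le> m'" for j
      using that box_ge[OF xt i] by (simp add: y_def)
    then have il: "interlaced m' y x" by (rule box_interlaced[OF yt xt])
    obtain b where b: "b \<in> carrier K"
      "\<And>c. c \<in> carrier K \<Longrightarrow> f y (residue K m (gamma m y) \<sigma> c) = residue K m (gamma m y) \<tau> (c \<otimes>\<^bsub>K\<^esub> b)"
      using component_coefficient[OF y] by blast
    have "residue K m (gamma m y) \<sigma> \<one>\<^bsub>K\<^esub> = residue K m (gamma m y) \<sigma> \<zero>\<^bsub>K\<^esub>"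
      using ys by (simp add: residue_eq_zero_iff)
    then have "f y (residue K m (gamma m y) \<sigma> \<one>\<^bsub>K\<^esub>) = residue K m (gamma m y) \<tau> \<zero>\<^bsub>K\<^esub>"
      using b by simp
    then have "residue K m (gamma m y) \<tau> a = residue K m (gamma m y) \<tau> \<zero>\<^bsub>K\<^esub>"
      using component_natural_residue[OF x y il xs] a x y t il xt by (simp add: eps_ob_apply)
    then show False using yt a0 by (simp add: residue_eq_zero_iff)
  qed
  have top: "\<sigma> m \<le> \<tau> m"
  \<comment> \<open>otherwise \<open>x\<close> can be raised out of the box of \<open>\<tau>\<close> in the last direction\<close>
  proof (rule ccontr)
    assume gt: "\<not> \<sigma> m \<le> \<tau> m"
    define z where "z = restrict (x(m' := \<tau> m)) {..m'}"
    have "x m' < \<tau> m" "\<sigma> m' \<le> x m'" using box_less[OF xt, of m'] box_ge[OF xs, of m'] by (simp_all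
        add: m_eq)
    then have "x(m' := \<tau> m) \<in> box m \<sigma>"
      using xs gt by (auto simp: box_def m_eq)
    then have zs: "z \<in> box m \<sigma>" and z: "z \<in> simplices m' n'"
      unfolding z_def box_restrict_iff using box_restrict_simplices[OF s] by auto
    have zt: "z \<notin> box m \<tau>"
      unfolding z_def box_restrict_iff by (auto simp: box_def m_eq)
    have "x j \<le> z j" if "j \<le> m'" for j
      using that \<open>x m' < \<tau> m\<close> by (simp add: z_def)
    then have il: "interlaced m' x z" by (rule box_interlaced[OF xs zs])
    obtain b where b: "b \<in> carrier K"
      "\<And>c. c \<in> carrier K \<Longrightarrow> f z (residue K m (gamma m z) \<sigma> c) = residue K m (gamma m z) \<tau> (c \<otimes>\<^bsub>K\<^esub> b)"
      using component_coefficient[OF z] by blast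
    have "residue K m (gamma m x) \<tau> a = residue K m (gamma m x) \<tau> \<zero>\<^bsub>K\<^esub>"
      using component_natural_residue[OF z x il zs] a b x z t il zt by (simp add: eps_ob_apply)
    then show False using xt a0 by (simp add: residue_eq_zero_iff)
  qed
  have "\<sigma> i \<le> \<tau> i" if "i \<le> m" for i using low[of i] top that by (cases "i = m") auto
  moreover have "\<tau> i < \<sigma> (Suc i)" if "i < m" for i
    using box_ge[OF xt that] box_less[OF xs that] by simp
  ultimately show ?thesis by (simp add: interlaced_def)
qed

text \<open>The common part of the two boxes has a lowest point \<open>x0\<close>, given by the vertices of \<open>\<tau>\<close>, and
  naturality along \<open>x0 \<le> x\<close> carries the coefficient at \<open>x0\<close> to all its points \<open>x\<close>.\<close>

lemma eps_hom_multiple: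
  assumes nz: "f \<noteq> zero_mor Vect_fun (eps_ob K m n \<sigma>) (eps_ob K m n \<tau>)"
  shows "interlaced m \<sigma> \<tau> \<and> (\<exists>c\<in>carrier K.
    f = c \<odot>\<^bsub>lin Vect_fun (eps_ob K m n \<sigma>) (eps_ob K m n \<tau>)\<^esub> edge (eps K m n) \<sigma> \<tau>)"
proof -
  interpret A: linear_category K Vect_fun by (rule linear_category_Vect_fun)
  note ob = eps_ob_Ob[OF s] eps_ob_Ob[OF t]
  have il: "interlaced m \<sigma> \<tau>"
  proof (rule ccontr)
    assume not_il: "\<not> interlaced m \<sigma> \<tau>"
    have "f x v = \<zero>\<^bsub>fob (eps_ob K m n \<tau>) x\<^esub>"
      if "x \<in> Ob (op_lcat U')" and v: "v \<in> carrier (fob (eps_ob K m n \<sigma>) x)" for x v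
    proof -
      have x: "x \<in> simplices m' n'" using that by simp
      obtain c where c: "c \<in> carrier K" "v = residue K m (gamma m x) \<sigma> c"
        using v unfolding residue_carrier[OF x s] by blast
      obtain a where a: "a \<in> carrier K"
        "\<And>c. c \<in> carrier K \<Longrightarrow> f x (residue K m (gamma m x) \<sigma> c) = residue K m (gamma m x) \<tau> (c \<otimes>\<^bsub>K\<^esub> a)"
        using component_coefficient[OF x] by blast
      have "x \<notin> box m \<tau> \<or> c \<otimes>\<^bsub>K\<^esub> a = \<zero>\<^bsub>K\<^esub> \<or> f x v = residue K m (gamma m x) \<tau> \<zero>\<^bsub>K\<^esub>"
      proof (cases "x \<in> box m \<sigma>")
        case True
        have "x \<notin> box m \<tau> \<or> a = \<zero>\<^bsub>K\<^esub>"
          using nonzero_component_interlaced[OF x True] not_il a(1) a(2)[OF one_closed]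
            residue_eq_zero_iff[of x \<tau> a] by auto
        then show ?thesis using r_null[OF c(1)] by blast
      next
        case False
        then have "v = residue K m (gamma m x) \<sigma> \<zero>\<^bsub>K\<^esub>"
          unfolding c(2) residue_eq_zero_iff by blast
        then have "f x v = residue K m (gamma m x) \<tau> (\<zero>\<^bsub>K\<^esub> \<otimes>\<^bsub>K\<^esub> a)"
          using a(2)[OF zero_closed] by (simp only:)
        then show ?thesis using l_null[OF a(1)] by metis
      qed
      then show ?thesis
        using a(2)[OF c(1)] c(2) residue_eq_zero_iff[of x \<tau> "c \<otimes>\<^bsub>K\<^esub> a"] value_zero[OF x t] by metis
    qed
    then have "f = zero_mor Vect_fun (eps_ob K m n \<sigma>) (eps_ob K m n \<tau>)"
      using A.zero_mor_closed[OF ob] by (intro nat_trans_Vect_eqI[OF f]) auto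
    with nz show False by simp
  qed
  have t_box: "\<tau> \<in> box m \<sigma>" "\<tau> \<in> box m \<tau>"
    using il by (auto intro: interlaced_right_in_left_box interlaced_right_in_box)
  define x0 where "x0 = restrict \<tau> {..m'}"
  have x0: "x0 \<in> simplices m' n'" and x0t: "x0 \<in> box m \<tau>"
    unfolding x0_def box_restrict_iff using t_box box_restrict_simplices[OF t] by auto
  obtain a0 where a0: "a0 \<in> carrier K"
    "\<And>c. c \<in> carrier K \<Longrightarrow> f x0 (residue K m (gamma m x0) \<sigma> c) = residue K m (gamma m x0) \<tau> (c \<otimes>\<^bsub>K\<^esub> a0)"
    using component_coefficient[OF x0] by blast
  have e: "edge (eps K m n) \<sigma> \<tau> \<in> Mor Vect_fun (eps_ob K m n \<sigma>) (eps_ob K m n \<tau>)"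
    using edge_closed[OF eps_functor s t interlaced_le[OF il]] by (simp add: eps_fob s t)
  let ?g = "a0 \<odot>\<^bsub>lin Vect_fun (eps_ob K m n \<sigma>) (eps_ob K m n \<tau>)\<^esub> edge (eps K m n) \<sigma> \<tau>"
  have "f = ?g"
  proof (rule nat_trans_Vect_eqI[OF f])
    show "?g \<in> nat_trans (op_lcat U') (fd_vec K) (eps_ob K m n \<sigma>) (eps_ob K m n \<tau>)"
      using A.smult_mor_closed[OF ob a0(1) e] by simp
    fix x v assume "x \<in> Ob (op_lcat U')" and v: "v \<in> carrier (fob (eps_ob K m n \<sigma>) x)"
    then have x: "x \<in> simplices m' n'" by simp
    obtain c where c: "c \<in> carrier K" "v = residue K m (gamma m x) \<sigma> c"
      using v unfolding residue_carrier[OF x s] by blast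
    obtain a where a: "a \<in> carrier K"
      "\<And>c. c \<in> carrier K \<Longrightarrow> f x (residue K m (gamma m x) \<sigma> c) = residue K m (gamma m x) \<tau> (c \<otimes>\<^bsub>K\<^esub> a)"
      using component_coefficient[OF x] by blast
    have "?g x v = a0 \<odot>\<^bsub>fob (eps_ob K m n \<tau>) x\<^esub> edge (eps K m n) \<sigma> \<tau> x v"
      using x v by simp
    also have "\<dots> = residue K m (gamma m x) \<tau> (a0 \<otimes>\<^bsub>K\<^esub> (if x \<in> box m \<sigma> then c else \<zero>\<^bsub>K\<^esub>))"
      using x c s t il a0(1) by (simp add: edge_apply eps_ob_fob uKDelta_smult gamma_simplices)
    finally have g: "?g x v = residue K m (gamma m x) \<tau> (a0 \<otimes>\<^bsub>K\<^esub> (if x \<in> box m \<sigma> then c else \<zero>\<^bsub>K\<^esub>))" .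
    have fv: "f x v = residue K m (gamma m x) \<tau> (c \<otimes>\<^bsub>K\<^esub> a)"
      unfolding c(2) by (rule a(2)[OF c(1)])
    show "f x v = ?g x v"
    proof (cases "x \<in> box m \<sigma> \<and> x \<in> box m \<tau>")
      case True
      have "x0 i \<le> x i" if "i \<le> m'" for i
        using box_ge[of x m \<tau> i] True that by (simp add: x0_def m_eq)
      then have "interlaced m' x0 x" using True x0t by (intro box_interlaced) auto
      from component_natural_residue[OF x x0 this]
      have "residue K m (gamma m x0) \<tau> a = residue K m (gamma m x0) \<tau> a0"
        using True a a0 x x0 t \<open>interlaced m' x0 x\<close> by (simp add: eps_ob_apply)
      then have "a = a0"
        using x0t residue_inj[of m "gamma m x0" \<tau> K a a0] by (simp add: interlaced_gamma_iff)
      then show ?thesis unfolding g fv using True a0(1) c(1) by (simp add: m_comm)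
    next
      case False
      then have "x \<notin> box m \<sigma> \<or> x \<notin> box m \<tau>" by blast
      then show ?thesis
      proof
        assume xs: "x \<notin> box m \<sigma>"
        then have "v = residue K m (gamma m x) \<sigma> \<zero>\<^bsub>K\<^esub>"
          unfolding c(2) residue_eq_zero_iff by blast
        then have "f x v = residue K m (gamma m x) \<tau> \<zero>\<^bsub>K\<^esub>"
          using a(1) a(2)[OF zero_closed] by simp
        then show ?thesis unfolding g using a0(1) xs by simp
      next
        assume "x \<notin> box m \<tau>"
        then have "\<not> interlaced m (gamma m x) \<tau>" by (simp add: interlaced_gamma_iff)
        then show ?thesis unfolding g fv by (simp add: residue_not_interlaced)
      qed
    qed
  qed
  with il a0(1) show ?thesis by blast
qed

end

lemma eps_edge_nonzero:
  assumes s: "\<sigma> \<in> simplices m n" and t: "\<tau> \<in> simplices m n" and il: "interlaced m \<sigma> \<tau>"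
  shows "edge (eps K m n) \<sigma> \<tau> \<noteq> zero_mor Vect_fun (eps_ob K m n \<sigma>) (eps_ob K m n \<tau>)"
proof
  assume eq: "edge (eps K m n) \<sigma> \<tau> = zero_mor Vect_fun (eps_ob K m n \<sigma>) (eps_ob K m n \<tau>)"
  define x where "x = restrict \<tau> {..m'}"
  have x: "x \<in> simplices m' n'" and xs: "x \<in> box m \<sigma>" and xt: "x \<in> box m \<tau>"
    unfolding x_def box_restrict_iff
    using il box_restrict_simplices[OF t] interlaced_right_in_left_box interlaced_right_in_box by auto
  have "residue K m (gamma m x) \<sigma> \<one>\<^bsub>K\<^esub> \<in> carrier (fob (eps_ob K m n \<sigma>) x)"
    unfolding residue_carrier[OF x s] by blast
  then have "edge (eps K m n) \<sigma> \<tau> x (residue K m (gamma m x) \<sigma> \<one>\<^bsub>K\<^esub>) = residue K m (gamma m x) \<tau> \<zero>\<^bsub>K\<^esub>"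
    unfolding eq using x value_zero[OF x t] by simp
  then have "residue K m (gamma m x) \<tau> \<one>\<^bsub>K\<^esub> = residue K m (gamma m x) \<tau> \<zero>\<^bsub>K\<^esub>"
    using edge_apply[OF s t il x] xs by simp
  then show False using xt by (simp add: residue_eq_zero_iff)
qed

text \<open>At a point of the box of face \<open>i\<close>, the incoming morphism is onto and the outgoing one zero, or the
  incoming one is zero and the outgoing one injective, according to which of the neighbouring
  faces contains the point in its box.\<close>

lemma eps_faces_exact:
  assumes \<zeta>: "\<zeta> \<in> nondegenerate (Suc m) n"
  shows "exact_sequence Vect_fun (Suc m) (\<lambda>i. fob (eps K m n) (face m \<zeta> i))
    (\<lambda>i. edge (eps K m n) (face m \<zeta> (Suc i)) (face m \<zeta> i))"
proof -
  interpret A: linear_category K Vect_fun by (rule linear_category_Vect_fun)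
  let ?F = "face m \<zeta>" and ?E = "\<lambda>i. eps_ob K m n (face m \<zeta> i)"
  let ?e = "\<lambda>i. edge (eps K m n) (face m \<zeta> (Suc i)) (face m \<zeta> i)"
  have s: "?F i \<in> simplices m n" for i by (intro face_simplices nondegenerate_simplices \<zeta>)
  note il = face_interlaced[OF \<zeta>]
  have e: "?e i \<in> nat_trans (op_lcat U') (fd_vec K) (?E (Suc i)) (?E i)" for i
    using edge_closed[OF eps_functor s s interlaced_le[OF il]] by (simp add: eps_fob s)
  define z where "z = (\<lambda>i\<in>{..m}. 0 :: nat)"
  have z: "z \<in> simplices m n" by (intro simplicesI) (auto simp: z_def)
  have z_box: "x \<notin> box m z" for x using m_pos by (auto simp: box_def z_def intro!: exI[of _ 0])
  let ?Z = "eps_ob K m n z"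
  have Z_zero: "v = \<zero>\<^bsub>fob ?Z x\<^esub>" if "x \<in> simplices m' n'" "v \<in> carrier (fob ?Z x)" for x v
    using that z_box[of x] residue_eq_zero_iff[of x z] unfolding residue_carrier[OF that(1) z]
        value_zero[OF that(1) z] by blast
  have zero: "zero_object Vect_fun ?Z"
  proof (rule A.zero_objectI[OF eps_ob_Ob[OF z]])
    show "idm Vect_fun ?Z = zero_mor Vect_fun ?Z ?Z"
      using A.idm_closed[OF eps_ob_Ob[OF z]] A.zero_mor_closed[OF eps_ob_Ob[OF z] eps_ob_Ob[OF z]]
      by (intro nat_trans_Vect_eqI) (auto dest: Z_zero)
  qed
  have ex_at: "exact_at Vect_fun (if i < Suc m then ?E (Suc i) else ?Z) (?E i) (if 0 < i then ?E
      (i - 1) else ?Z)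
      (if i < Suc m then ?e i else zero_mor Vect_fun ?Z (?E i))
      (if 0 < i then ?e (i - 1) else zero_mor Vect_fun (?E i) ?Z)"
    (is "exact_at _ ?L ?Y ?R ?g ?h") if i: "i \<le> Suc m" for i
  proof (rule exact_at_pointwise)
    show L: "?L \<in> Ob Vect_fun" and Y: "?Y \<in> Ob Vect_fun" and R: "?R \<in> Ob Vect_fun"
      using eps_ob_Ob[OF s] eps_ob_Ob[OF z] by (simp_all del: lin_fun_cat_simps)
    show g: "?g \<in> nat_trans (op_lcat U') (fd_vec K) ?L ?Y"
      using e[of i] A.zero_mor_closed[OF eps_ob_Ob[OF z] eps_ob_Ob[OF s]] by simp
    show h: "?h \<in> nat_trans (op_lcat U') (fd_vec K) ?Y ?R"
      using e[of "i - 1"] A.zero_mor_closed[OF eps_ob_Ob[OF s] eps_ob_Ob[OF z]] by auto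
    fix x assume "x \<in> Ob (op_lcat U')"
    then have x: "x \<in> simplices m' n'" by simp
    have gl: "linear_map K (fob ?L x) (fob ?Y x) (?g x)" and hl: "linear_map K (fob ?Y x) (fob ?R
        x) (?h x)"
      using component_linear[OF g, of x] component_linear[OF h, of x] x by simp_all
    have mods: "module K (fob ?L x)" "module K (fob ?Y x)" "module K (fob ?R x)"
      using value_module[OF L, of x] value_module[OF Y, of x] value_module[OF R, of x] x by simp_all
    have g0: "?g x \<zero>\<^bsub>fob ?L x\<^esub> = \<zero>\<^bsub>fob ?Y x\<^esub>" and h0: "?h x \<zero>\<^bsub>fob ?Y x\<^esub> = \<zero>\<^bsub>fob ?R x\<^esub>"
      using linear_map_zero[OF mods(1,2) gl] linear_map_zero[OF mods(2,3) hl] by auto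
    have L0: "\<zero>\<^bsub>fob ?L x\<^esub> \<in> carrier (fob ?L x)" and Y0: "\<zero>\<^bsub>fob ?Y x\<^esub> \<in> carrier (fob ?Y x)"
      using mods module.axioms(2) abelian_group.axioms(1) abelian_monoid.zero_closed by metis+
    have E_zero: "v = \<zero>\<^bsub>fob (?E j) x\<^esub>" if "v \<in> carrier (fob (?E j) x)" "x \<notin> box m (?F j)" for v j
      using that residue_eq_zero_iff[of x "?F j"]
      unfolding residue_carrier[OF x s] value_zero[OF x s] by blast
    let ?left = "i < Suc m \<and> x \<in> box m (?F (Suc i))" and ?right = "0 < i \<and> x \<in> box m (?F (i - 1))"
    have L_zero: "v = \<zero>\<^bsub>fob ?L x\<^esub>" if "\<not> ?left" "v \<in> carrier (fob ?L x)" for v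
      using that E_zero[of v "Suc i"] Z_zero[OF x, of v] by (auto split: if_splits)
    have R_zero: "v = \<zero>\<^bsub>fob ?R x\<^esub>" if "\<not> ?right" "v \<in> carrier (fob ?R x)" for v
      using that E_zero[of v "i - 1"] Z_zero[OF x, of v] by (auto split: if_splits)
    show "?g x ` carrier (fob ?L x) = {v \<in> carrier (fob ?Y x). ?h x v = \<zero>\<^bsub>fob ?R x\<^esub>}"
    proof (cases "x \<in> box m (?F i)")
      case False
      then have Y_zero: "v = \<zero>\<^bsub>fob ?Y x\<^esub>" if "v \<in> carrier (fob ?Y x)" for v
        using that E_zero by blast
      show ?thesis
      proof (intro equalityI subsetI)
        fix w assume "w \<in> ?g x ` carrier (fob ?L x)"
        then have "w \<in> carrier (fob ?Y x)" using linear_map_closed[OF gl] by blast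
        then show "w \<in> {v \<in> carrier (fob ?Y x). ?h x v = \<zero>\<^bsub>fob ?R x\<^esub>}"
          using Y_zero[of w] h0 by blast
      next
        fix w assume "w \<in> {v \<in> carrier (fob ?Y x). ?h x v = \<zero>\<^bsub>fob ?R x\<^esub>}"
        then have "w = ?g x \<zero>\<^bsub>fob ?L x\<^esub>" using Y_zero[of w] unfolding g0 by blast
        then show "w \<in> ?g x ` carrier (fob ?L x)" using L0 by blast
      qed
    next
      case True
      have one: "?left \<noteq> ?right"
        using face_box_exact[OF \<zeta>] True i unfolding box_exact_def by simp
      show ?thesis
      proof (cases ?left)
        case True
        then have "\<not> ?right" using one by blast
        then have h_zero: "?h x v = \<zero>\<^bsub>fob ?R x\<^esub>" if "v \<in> carrier (fob ?Y x)" for v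
          using R_zero linear_map_closed[OF hl that] by blast
        have g_surj: "v \<in> ?g x ` carrier (fob ?L x)" if v: "v \<in> carrier (fob ?Y x)" for v
        proof -
          obtain c where c: "c \<in> carrier K" "v = residue K m (gamma m x) (?F i) c"
            using v unfolding residue_carrier[OF x s] by blast
          have "residue K m (gamma m x) (?F (Suc i)) c \<in> carrier (fob (?E (Suc i)) x)"
            unfolding residue_carrier[OF x s] using c by blast
          moreover have "?e i x (residue K m (gamma m x) (?F (Suc i)) c) = v"
            using True edge_apply[OF s s il x c(1), of i] unfolding c(2) by simp
          ultimately have "v = ?g x (residue K m (gamma m x) (?F (Suc i)) c)"
            "residue K m (gamma m x) (?F (Suc i)) c \<in> carrier (fob ?L x)"
            using True by simp_all
          then show ?thesis by (rule image_eqI)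
        qed
        show ?thesis
        proof (intro equalityI subsetI)
          fix w assume "w \<in> ?g x ` carrier (fob ?L x)"
          then have "w \<in> carrier (fob ?Y x)" using linear_map_closed[OF gl] by blast
          then show "w \<in> {v \<in> carrier (fob ?Y x). ?h x v = \<zero>\<^bsub>fob ?R x\<^esub>}" using h_zero by blast
        next
          fix w assume "w \<in> {v \<in> carrier (fob ?Y x). ?h x v = \<zero>\<^bsub>fob ?R x\<^esub>}"
          then show "w \<in> ?g x ` carrier (fob ?L x)" using g_surj by blast
        qed
      next
        case False
        then have right: ?right using one by blast
        have h_inj: "v = \<zero>\<^bsub>fob ?Y x\<^esub>" if v: "v \<in> carrier (fob ?Y x)" "?h x v = \<zero>\<^bsub>fob ?R x\<^esub>" for v
        proof -
          obtain c where c: "c \<in> carrier K" "v = residue K m (gamma m x) (?F i) c"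
            using v(1) unfolding residue_carrier[OF x s] by blast
          have "residue K m (gamma m x) (?F (i - 1)) c = residue K m (gamma m x) (?F (i - 1)) \<zero>\<^bsub>K\<^esub>"
            using v(2) right edge_apply[OF s s il x c(1), of "i - 1"] \<open>x \<in> box m (?F i)\<close>
            unfolding c(2) by (simp add: value_zero[OF x s])
          then have "c = \<zero>\<^bsub>K\<^esub>" using right by (simp add: residue_eq_zero_iff)
          then show ?thesis unfolding c(2) value_zero[OF x s] by (simp only:)
        qed
        have g_zero: "?g x v = \<zero>\<^bsub>fob ?Y x\<^esub>" if "v \<in> carrier (fob ?L x)" for v
          unfolding L_zero[OF False that] by (rule g0)
        show ?thesis
        proof (intro equalityI subsetI)
          fix w assume "w \<in> ?g x ` carrier (fob ?L x)"
          then have "w = \<zero>\<^bsub>fob ?Y x\<^esub>" using g_zero by blast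
          then show "w \<in> {v \<in> carrier (fob ?Y x). ?h x v = \<zero>\<^bsub>fob ?R x\<^esub>}" using Y0 h0 by blast
        next
          fix w assume "w \<in> {v \<in> carrier (fob ?Y x). ?h x v = \<zero>\<^bsub>fob ?R x\<^esub>}"
          then have "w = ?g x \<zero>\<^bsub>fob ?L x\<^esub>" using h_inj[of w] unfolding g0 by blast
          then show "w \<in> ?g x ` carrier (fob ?L x)" using L0 by blast
        qed
      qed
    qed
  qed
  have "exact_sequence Vect_fun (Suc m) ?E ?e"
    unfolding A.exact_sequence_iff[OF zero_less_Suc]
  proof (intro conjI exI[of _ ?Z] allI impI zero ex_at)
    show "?e i \<in> Mor Vect_fun (?E (Suc i)) (?E i)" for i using e by simp
  qed (use eps_ob_Ob[OF s] in auto)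
  then show ?thesis
    by (simp add: eps_fob s)
qed

lemma interlacing_functor_eps: "interlacing_functor K Vect_fun m n (eps K m n)"
proof (intro interlacing_functor.intro interlacing_functor_axioms.intro)
  show "linear_category K Vect_fun" by (rule linear_category_Vect_fun)
  show "field K" by (rule field_axioms)
next
  fix \<sigma> \<tau> f
  assume s: "\<sigma> \<in> simplices m n" and t: "\<tau> \<in> simplices m n"
    and f: "f \<in> Mor Vect_fun (fob (eps K m n) \<sigma>) (fob (eps K m n) \<tau>)"
    and nz: "f \<noteq> zero_mor Vect_fun (fob (eps K m n) \<sigma>) (fob (eps K m n) \<tau>)"
  show "interlaced m \<sigma> \<tau> \<and> (\<exists>c\<in>carrier K.
      f = c \<odot>\<^bsub>lin Vect_fun (fob (eps K m n) \<sigma>) (fob (eps K m n) \<tau>)\<^esub> edge (eps K m n) \<sigma> \<tau>)"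
    unfolding eps_fob[OF s] eps_fob[OF t]
    by (rule eps_hom_multiple[OF s t f[unfolded eps_fob[OF s] eps_fob[OF t] lin_fun_cat_simps]
          nz[unfolded eps_fob[OF s] eps_fob[OF t]]])
next
  fix \<sigma> \<tau>
  assume s: "\<sigma> \<in> simplices m n" and t: "\<tau> \<in> simplices m n" and il: "interlaced m \<sigma> \<tau>"
  show "edge (eps K m n) \<sigma> \<tau> \<noteq> zero_mor Vect_fun (fob (eps K m n) \<sigma>) (fob (eps K m n) \<tau>)"
    unfolding eps_fob[OF s] eps_fob[OF t] by (rule eps_edge_nonzero[OF s t il])
qed (fact m_pos eps_functor eps_faces_exact)+

end

theorem theorem1p14:
  fixes K :: "('k, 'r) ring_scheme" and m n l :: nat
  assumes "field K" and "1 \<le> m" and "m \<le> n" and "l = n - m + 1"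
  shows "eps K m n \<in> Ob (S_cat m n (mod_A K m l)) \<and>
    (\<forall>B :: ('k, 'o, 'b) lcat. abelian_linear_category K B \<longrightarrow>
      is_equivalence
        (exact_lin_fun_cat K (m + 1) (mod_A K m l) (M_objects K m l) B)
        (S_cat m n B)
        (pullback (exact_lin_fun_cat K (m + 1) (mod_A K m l) (M_objects K m l) B)
          (Delta m n) (eps K m n)))"
proof -
  obtain m' n' where eqs: "m = Suc m'" "n = Suc n'"
    using assms(2,3) by (cases m; cases n) auto
  interpret universal_simplex K m n m' n'
    using assms(1,3) eqs by (simp add: universal_simplex_def universal_simplex_axioms_def
        scalar_field_def)
  interpret E: interlacing_functor K Vect_fun m n "eps K m n"
    by (rule interlacing_functor_eps)
  have "l + m - 2 = n'" "l + m - 1 = n" using assms(3,4) eqs by auto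
  then have A: "mod_A K m l = Vect_fun" and S: "M_objects K m l = fob (eps K m n) ` simplices m n"
    by (simp_all add: mod_A_def M_objects_def)
  show ?thesis
    unfolding A S Suc_eq_plus1[symmetric] using E.E_in_S_cat E.pullback_is_equivalence by blast
qed

end
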